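(* Let $X\hookrightarrow M$ be a closed embedding of affine toric $\Lambda$-schemes, with $M=\mathrm{Spec}\,\mathbb{Z}[x_1,\dots,x_r,y_1^{\pm},\dots,y_{n-r}^{\pm}]$, induced by an unpointed closed immersion of monoid schemes, and let $I\subset\mathbb{Z}[x_1,\dots,x_r,y_1^{\pm},\dots,y_{n-r}^{\pm}]$ be the ideal defining $X$, where $I$ is generated by finitely many binomials of the forms $x^{\alpha}-x^{\beta}y^{\gamma}$ (with $\alpha,\beta\in\mathbb{N}^r$, $\gamma\in\mathbb{Z}^{n-r}$, $1\le|\alpha|\le|\beta|$) and $1-y^{\gamma}$ (with $\gamma\in\mathbb{Z}^{n-r}$). Let $a\in X$ be the distinguished point of $X$, and for each prime ideal $(p)\subset\mathbb{Z}$ (including $(0)$) let $(p,a)_p\in X_p$ be the distinguished point of the fiber $X_p$. Then $$H_{X,a}=H_{X_p,(p,a)_p}\quad\text{for all prime ideals }(p)\subset\mathbb{Z}.$$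
   Context: Monoids are commutative and pointed (with $1$ and absorbing $0$). For a ring $R$ and monoid $A$, $R[A]$ is the free $R$-module on $A\setminus\{0\}$ with induced multiplication. An affine toric $\Lambda$-scheme is $\mathrm{Spec}\,\mathbb{Z}[A]$ with $A$ a finitely generated monoid that is cancellative ($ab=ac$, $a\ne0\Rightarrow b=c$) and torsionfree ($a^n=b^n$, $n\geq 1\Rightarrow a=b$). An unpointed closed immersion (in the affine case) is given by a surjective monoid morphism $B\to A$ under which the preimage of $0$ is $\{0\}$; here $B$ is the monoid with $0$ generated by $x_1,\dots,x_r,y_1^{\pm},\dots,y_{n-r}^{\pm}$, so that $X=\mathrm{Spec}\,\mathbb{Z}[A]$ is a closed subscheme of $M=\mathrm{Spec}\,\mathbb{Z}[B]$. For a prime ideal $(p)\subset\mathbb{Z}$, $\mathbb{F}_p$ is the residue field ($\mathbb{F}_0=\mathbb{Q}$) and $X_p=X\times_{\mathrm{Spec}\,\mathbb{Z}}\mathrm{Spec}\,\mathbb{F}_p$. For a point of $X$ lying over $(p)$, a subscript $p$ denotes the corresponding point of $X_p$. The distinguished point $a\in X$ is the point corresponding to the prime ideal $(x_1,\dots,x_r,y_1-1,\dots,y_{n-r}-1)$, which contains $I$; $(p,a)\in X$ is the point corresponding to $(p,x_1,\dots,x_r,y_1-1,\dots,y_{n-r}-1)$, and $(p,a)_p$ is the corresponding point of $X_p$. The Hilbert-Samuel function of a Noetherian local ring $R$ with maximal ideal $\mathfrak m$ is $H_R:\mathbb{N}\to\mathbb{N}$, $H_R(l)=\mathrm{length}(R/\mathfrak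 m^{l+1})$; for a point $b$ of a Noetherian scheme $Y$, $H_{Y,b}:=H_{\mathcal{O}_{Y,b}}$. *)

theory Defs
  imports "HOL-Algebra.Algebra" "HOL-Library.Extended_Nat"
begin

section \<open>Pointed monoids\<close>

record 'a pointed_monoid = "'a monoid" +
  pzero :: 'a

locale pointed_comm_monoid = comm_monoid A
  for A :: "('a, 'b) pointed_monoid_scheme" (structure) +
  assumes pzero_closed: "pzero A \<in> carrier A"
    and pzero_absorbing: "a \<in> carrier A \<Longrightarrow> a \<otimes> pzero A = pzero A"

text \<open>The affine toric schemes are the spectra of the rings \<open>\<int>[A]\<close> for \<open>A\<close> as follows.\<close>

locale toric_monoid = pointed_comm_monoid A
  for A :: "('a, 'b) pointed_monoid_scheme" (structure) +
  assumes finitely_generated: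
      "\<exists>S. finite S \<and> S \<subseteq> carrier A \<and>
        (\<forall>H. submonoid H A \<and> pzero A \<in> H \<and> S \<subseteq> H \<longrightarrow> H = carrier A)"
    and cancellative:
      "\<lbrakk>a \<in> carrier A; b \<in> carrier A; c \<in> carrier A; a \<otimes> b = a \<otimes> c; a \<noteq> pzero A\<rbrakk> \<Longrightarrow> b = c"
    and torsionfree:
      "\<lbrakk>a \<in> carrier A; b \<in> carrier A; 1 \<le> k; a [^] (k :: nat) = b [^] k\<rbrakk> \<Longrightarrow> a = b"

definition pointed_hom ::
    "('a, 'm) pointed_monoid_scheme \<Rightarrow> ('b, 'n) pointed_monoid_scheme \<Rightarrow> ('a \<Rightarrow> 'b) set" where
  "pointed_hom B A = {\<phi> \<in> hom B A. \<phi> \<one>\<^bsub>B\<^esub> = \<one>\<^bsub>A\<^esub> \<and> \<phi> (pzero B) = pzero A}"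

text \<open>
  An unpointed closed immersion of the affine monoid scheme of \<open>A\<close> into that of \<open>B\<close>,
  given by the morphism \<open>\<phi>: B \<rightarrow> A\<close>.
\<close>

definition unpointed_closed_immersion ::
    "('a, 'm) pointed_monoid_scheme \<Rightarrow> ('b, 'n) pointed_monoid_scheme \<Rightarrow> ('a \<Rightarrow> 'b) \<Rightarrow> bool" where
  "unpointed_closed_immersion B A \<phi> \<longleftrightarrow>
     \<phi> \<in> pointed_hom B A \<and> \<phi> ` carrier B = carrier A \<and>
     {b \<in> carrier B. \<phi> b = pzero A} = {pzero B}"

definition adjoin_zero :: "('a, 'm) monoid_scheme \<Rightarrow> 'a option pointed_monoid" where
  "adjoin_zero G =
    \<lparr>carrier = insert None (Some ` carrier G),
     monoid.mult = (\<lambda>u v. case (u, v) of (Some a, Some b) \<Rightarrow> Some (a \<otimes>\<^bsub>G\<^esub> b) | _ \<Rightarrow> None),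
     one = Some \<one>\<^bsub>G\<^esub>,
     pzero = None\<rparr>"


section \<open>Monoid rings\<close>

definition nonzero :: "('a, 'm) pointed_monoid_scheme \<Rightarrow> 'a set" where
  "nonzero A = carrier A - {pzero A}"

text \<open>
  The term \<open>c a\<close> of \<open>R[A]\<close>. It vanishes for \<open>a = pzero A\<close>, as the zero of \<open>A\<close> is
  identified with the zero of \<open>R[A]\<close>.
\<close>

definition monoid_term ::
    "('r, 'k) ring_scheme \<Rightarrow> ('a, 'm) pointed_monoid_scheme \<Rightarrow> 'r \<Rightarrow> 'a \<Rightarrow> 'a \<Rightarrow> 'r" where
  "monoid_term R A c a = (\<lambda>b\<in>nonzero A. if b = a then c else \<zero>\<^bsub>R\<^esub>)"

definition monoid_ring ::
    "('r, 'k) ring_scheme \<Rightarrow> ('a, 'm) pointed_monoid_scheme \<Rightarrow> ('a \<Rightarrow> 'r) ring" where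
  "monoid_ring R A =
    \<lparr>carrier = {f \<in> nonzero A \<rightarrow>\<^sub>E carrier R. finite {a \<in> nonzero A. f a \<noteq> \<zero>\<^bsub>R\<^esub>}},
     monoid.mult = (\<lambda>f g. \<lambda>c\<in>nonzero A.
       finsum R (\<lambda>(a, b). f a \<otimes>\<^bsub>R\<^esub> g b)
         {(a, b). a \<in> nonzero A \<and> b \<in> nonzero A \<and>
            f a \<noteq> \<zero>\<^bsub>R\<^esub> \<and> g b \<noteq> \<zero>\<^bsub>R\<^esub> \<and> a \<otimes>\<^bsub>A\<^esub> b = c}),
     one = monoid_term R A \<one>\<^bsub>R\<^esub> \<one>\<^bsub>A\<^esub>,
     ring.zero = (\<lambda>a\<in>nonzero A. \<zero>\<^bsub>R\<^esub>),
     ring.add = (\<lambda>f g. \<lambda>a\<in>nonzero A. f a \<oplus>\<^bsub>R\<^esub> g a)\<rparr>"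

text \<open>The homomorphism \<open>R[B] \<rightarrow> R[A]\<close> induced by \<open>\<phi>: B \<rightarrow> A\<close>.\<close>

definition monoid_ring_map ::
    "('r, 'k) ring_scheme \<Rightarrow> ('b, 'n) pointed_monoid_scheme \<Rightarrow> ('a, 'm) pointed_monoid_scheme
      \<Rightarrow> ('b \<Rightarrow> 'a) \<Rightarrow> ('b \<Rightarrow> 'r) \<Rightarrow> 'a \<Rightarrow> 'r" where
  "monoid_ring_map R B A \<phi> f =
    (\<lambda>a\<in>nonzero A. finsum R f {b \<in> nonzero B. f b \<noteq> \<zero>\<^bsub>R\<^esub> \<and> \<phi> b = a})"


section \<open>Localization and residue fields\<close>

text \<open>
  An affine scheme is represented by its coordinate ring \<open>S\<close>, a point of it by a prime ideal
  \<open>P\<close> of \<open>S\<close>, and the local ring at that point by the localization of \<open>S\<close> at \<open>P\<close>.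
\<close>

definition fraction_rel :: "('a, 'm) ring_scheme \<Rightarrow> 'a set \<Rightarrow> (('a \<times> 'a) \<times> ('a \<times> 'a)) set" where
  "fraction_rel R P =
    {((a, s), (b, t)). a \<in> carrier R \<and> s \<in> carrier R - P \<and> b \<in> carrier R \<and> t \<in> carrier R - P \<and>
       (\<exists>u\<in>carrier R - P. u \<otimes>\<^bsub>R\<^esub> (a \<otimes>\<^bsub>R\<^esub> t \<ominus>\<^bsub>R\<^esub> b \<otimes>\<^bsub>R\<^esub> s) = \<zero>\<^bsub>R\<^esub>)}"

definition fraction :: "('a, 'm) ring_scheme \<Rightarrow> 'a set \<Rightarrow> 'a \<Rightarrow> 'a \<Rightarrow> ('a \<times> 'a) set" where
  "fraction R P a s = fraction_rel R P `` {(a, s)}"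

definition localization :: "('a, 'm) ring_scheme \<Rightarrow> 'a set \<Rightarrow> ('a \<times> 'a) set ring" where
  "localization R P =
    \<lparr>carrier = (carrier R \<times> (carrier R - P)) // fraction_rel R P,
     monoid.mult = (\<lambda>U V. \<Union>(a, s)\<in>U. \<Union>(b, t)\<in>V. fraction R P (a \<otimes>\<^bsub>R\<^esub> b) (s \<otimes>\<^bsub>R\<^esub> t)),
     one = fraction R P \<one>\<^bsub>R\<^esub> \<one>\<^bsub>R\<^esub>,
     ring.zero = fraction R P \<zero>\<^bsub>R\<^esub> \<one>\<^bsub>R\<^esub>,
     ring.add = (\<lambda>U V. \<Union>(a, s)\<in>U. \<Union>(b, t)\<in>V.
       fraction R P (a \<otimes>\<^bsub>R\<^esub> t \<oplus>\<^bsub>R\<^esub> b \<otimes>\<^bsub>R\<^esub> s) (s \<otimes>\<^bsub>R\<^esub> t))\<rparr>"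

text \<open>Only meaningful for local rings.\<close>

definition max_ideal :: "('a, 'm) ring_scheme \<Rightarrow> 'a set" where
  "max_ideal R = (THE M. maximalideal M R)"

definition residue_field :: "('a, 'm) ring_scheme \<Rightarrow> 'a set \<Rightarrow> ('a \<times> 'a) set set ring" where
  "residue_field R P = localization R P Quot max_ideal (localization R P)"


section \<open>Tensor products over the integers and fibres\<close>

text \<open>
  \<open>S \<otimes>\<^sub>\<int> T\<close> for commutative rings \<open>S\<close> and \<open>T\<close>. The free abelian group on \<open>S \<times> T\<close> is the
  monoid ring over \<open>\<int>\<close> of the multiplicative monoid \<open>S \<times> T\<close> with a new zero adjoined, and
  the biadditivity relations generate the same subgroup and ideal in it. Compatibility with
  integer scalars follows from biadditivity.
\<close>

definition free_tensor_ring ::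
    "('a, 'm) ring_scheme \<Rightarrow> ('b, 'n) ring_scheme \<Rightarrow> (('a \<times> 'b) option \<Rightarrow> int) ring" where
  "free_tensor_ring S T = monoid_ring \<Z> (adjoin_zero (S \<times>\<times> T))"

definition free_tensor ::
    "('a, 'm) ring_scheme \<Rightarrow> ('b, 'n) ring_scheme \<Rightarrow> 'a \<Rightarrow> 'b \<Rightarrow> ('a \<times> 'b) option \<Rightarrow> int" where
  "free_tensor S T s t = monoid_term \<Z> (adjoin_zero (S \<times>\<times> T)) 1 (Some (s, t))"

definition tensor_relations ::
    "('a, 'm) ring_scheme \<Rightarrow> ('b, 'n) ring_scheme \<Rightarrow> (('a \<times> 'b) option \<Rightarrow> int) set" where
  "tensor_relations S T = genideal (free_tensor_ring S T)
    ({free_tensor S T (s \<oplus>\<^bsub>S\<^esub> s') t \<ominus>\<^bsub>free_tensor_ring S T\<^esub>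
        (free_tensor S T s t \<oplus>\<^bsub>free_tensor_ring S T\<^esub> free_tensor S T s' t) | s s' t.
        s \<in> carrier S \<and> s' \<in> carrier S \<and> t \<in> carrier T} \<union>
     {free_tensor S T s (t \<oplus>\<^bsub>T\<^esub> t') \<ominus>\<^bsub>free_tensor_ring S T\<^esub>
        (free_tensor S T s t \<oplus>\<^bsub>free_tensor_ring S T\<^esub> free_tensor S T s t') | s t t'.
        s \<in> carrier S \<and> t \<in> carrier T \<and> t' \<in> carrier T})"

definition tensor_ring ::
    "('a, 'm) ring_scheme \<Rightarrow> ('b, 'n) ring_scheme \<Rightarrow> (('a \<times> 'b) option \<Rightarrow> int) set ring" where
  "tensor_ring S T = free_tensor_ring S T Quot tensor_relations S T"

definition tensor ::
    "('a, 'm) ring_scheme \<Rightarrow> ('b, 'n) ring_scheme \<Rightarrow> 'a \<Rightarrow> 'b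
      \<Rightarrow> (('a \<times> 'b) option \<Rightarrow> int) set" where
  "tensor S T s t = tensor_relations S T +>\<^bsub>free_tensor_ring S T\<^esub> free_tensor S T s t"

text \<open>
  The coordinate ring of the fibre of \<open>Spec S\<close> over a prime ideal \<open>\<pp>\<close> of \<open>\<int>\<close>, and the point
  of this fibre that the projection to \<open>Spec S\<close> maps to a given point \<open>Q\<close> over \<open>\<pp>\<close>.
\<close>

definition fibre ::
    "('a, 'm) ring_scheme \<Rightarrow> int set
      \<Rightarrow> (('a \<times> (int \<times> int) set set) option \<Rightarrow> int) set ring" where
  "fibre S \<pp> = tensor_ring S (residue_field \<Z> \<pp>)"

definition fibre_point ::
    "('a, 'm) ring_scheme \<Rightarrow> int set \<Rightarrow> 'a set
      \<Rightarrow> (('a \<times> (int \<times> int) set set) option \<Rightarrow> int) set set" where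
  "fibre_point S \<pp> Q =
    (THE Q'. primeideal Q' (fibre S \<pp>) \<and>
       {s \<in> carrier S. tensor S (residue_field \<Z> \<pp>) s \<one>\<^bsub>residue_field \<Z> \<pp>\<^esub> \<in> Q'} = Q)"


section \<open>Hilbert-Samuel functions\<close>

text \<open>
  The length of a module as the supremum of the lengths of its chains of submodules, which is
  \<open>\<infinity>\<close> for modules that are not of finite length.
\<close>

definition module_length :: "('r, 'k) ring_scheme \<Rightarrow> ('r, 'a, 'm) module_scheme \<Rightarrow> enat" where
  "module_length R M =
    (SUP k \<in> {k. \<exists>N :: nat \<Rightarrow> 'a set.
        (\<forall>i\<le>k. submodule (N i) R M) \<and> (\<forall>i<k. N i \<subset> N (Suc i))}. enat k)"

definition quotient_module :: "('a, 'm) ring_scheme \<Rightarrow> 'a set \<Rightarrow> ('a, 'a set) module" where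
  "quotient_module R J =
    ring.extend (R Quot J) (module.fields (\<lambda>r U. (J +>\<^bsub>R\<^esub> r) \<otimes>\<^bsub>R Quot J\<^esub> U))"

definition hilbert_samuel :: "('a, 'm) ring_scheme \<Rightarrow> nat \<Rightarrow> enat" where
  "hilbert_samuel R l =
    module_length R (quotient_module R (max_ideal R [^]\<^bsub>ideals_set R\<^esub> (l + 1)))"

definition hilbert_samuel_at :: "('a, 'm) ring_scheme \<Rightarrow> 'a set \<Rightarrow> nat \<Rightarrow> enat" where
  "hilbert_samuel_at S P = hilbert_samuel (localization S P)"


section \<open>The ambient toric scheme\<close>

text \<open>
  The monoid of the monomials \<open>x\<^sup>\<alpha> y\<^sup>\<gamma>\<close> in \<open>x\<^sub>0, \<dots>, x\<^sub>r\<^sub>-\<^sub>1\<close> and the invertible variables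
  \<open>y\<^sub>0, \<dots>, y\<^sub>s\<^sub>-\<^sub>1\<close>, with \<open>0\<close> adjoined. Exponent vectors vanish outside the index range.
\<close>

definition exponent_monoid :: "nat \<Rightarrow> nat \<Rightarrow> ((nat \<Rightarrow> nat) \<times> (nat \<Rightarrow> int)) monoid" where
  "exponent_monoid r s =
    \<lparr>carrier = {(\<alpha>, \<gamma>). (\<forall>i\<ge>r. \<alpha> i = 0) \<and> (\<forall>j\<ge>s. \<gamma> j = 0)},
     monoid.mult = (\<lambda>(\<alpha>, \<gamma>) (\<alpha>', \<gamma>'). (\<lambda>i. \<alpha> i + \<alpha>' i, \<lambda>j. \<gamma> j + \<gamma>' j)),
     one = (\<lambda>_. 0, \<lambda>_. 0)\<rparr>"

type_synonym monomial = "((nat \<Rightarrow> nat) \<times> (nat \<Rightarrow> int)) option"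

definition ambient_monoid :: "nat \<Rightarrow> nat \<Rightarrow> monomial pointed_monoid" where
  "ambient_monoid r s = adjoin_zero (exponent_monoid r s)"

text \<open>\<open>\<int>[x\<^sub>0, \<dots>, x\<^sub>r\<^sub>-\<^sub>1, y\<^sub>0\<^sup>\<plusminus>, \<dots>, y\<^sub>s\<^sub>-\<^sub>1\<^sup>\<plusminus>]\<close>\<close>

definition ambient_ring :: "nat \<Rightarrow> nat \<Rightarrow> (monomial \<Rightarrow> int) ring" where
  "ambient_ring r s = monoid_ring \<Z> (ambient_monoid r s)"

definition xy_monomial ::
    "nat \<Rightarrow> nat \<Rightarrow> (nat \<Rightarrow> nat) \<Rightarrow> (nat \<Rightarrow> int) \<Rightarrow> monomial \<Rightarrow> int" where
  "xy_monomial r s \<alpha> \<gamma> = monoid_term \<Z> (ambient_monoid r s) 1 (Some (\<alpha>, \<gamma>))"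

definition x_var :: "nat \<Rightarrow> nat \<Rightarrow> nat \<Rightarrow> monomial \<Rightarrow> int" where
  "x_var r s i = xy_monomial r s ((\<lambda>_. 0)(i := 1)) (\<lambda>_. 0)"

definition y_var :: "nat \<Rightarrow> nat \<Rightarrow> nat \<Rightarrow> monomial \<Rightarrow> int" where
  "y_var r s j = xy_monomial r s (\<lambda>_. 0) ((\<lambda>_. 0)(j := 1))"

definition admissible_binomials :: "nat \<Rightarrow> nat \<Rightarrow> (monomial \<Rightarrow> int) set" where
  "admissible_binomials r s =
    {xy_monomial r s \<alpha> (\<lambda>_. 0) \<ominus>\<^bsub>ambient_ring r s\<^esub> xy_monomial r s \<beta> \<gamma> | \<alpha> \<beta> \<gamma>.
       (\<forall>i\<ge>r. \<alpha> i = 0) \<and> (\<forall>i\<ge>r. \<beta> i = 0) \<and> (\<forall>j\<ge>s. \<gamma> j = 0) \<and>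
       1 \<le> (\<Sum>i<r. \<alpha> i) \<and> (\<Sum>i<r. \<alpha> i) \<le> (\<Sum>i<r. \<beta> i)} \<union>
    {\<one>\<^bsub>ambient_ring r s\<^esub> \<ominus>\<^bsub>ambient_ring r s\<^esub> xy_monomial r s (\<lambda>_. 0) \<gamma> | \<gamma>.
       \<forall>j\<ge>s. \<gamma> j = 0}"

text \<open>
  The prime ideal \<open>(p, x\<^sub>0, \<dots>, x\<^sub>r\<^sub>-\<^sub>1, y\<^sub>0 - 1, \<dots>, y\<^sub>s\<^sub>-\<^sub>1 - 1)\<close>, where \<open>\<pp> = (p)\<close>, of the ambient
  ring. For \<open>\<pp> = {0}\<close> it is the distinguished point.
\<close>

definition distinguished_prime :: "nat \<Rightarrow> nat \<Rightarrow> int set \<Rightarrow> (monomial \<Rightarrow> int) set" where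
  "distinguished_prime r s \<pp> = genideal (ambient_ring r s)
    ({monoid_term \<Z> (ambient_monoid r s) c \<one>\<^bsub>ambient_monoid r s\<^esub> | c. c \<in> \<pp>} \<union>
     {x_var r s i | i. i < r} \<union>
     {y_var r s j \<ominus>\<^bsub>ambient_ring r s\<^esub> \<one>\<^bsub>ambient_ring r s\<^esub> | j. j < s})"

text \<open>
  The same point as a point of the closed subscheme \<open>Spec \<int>[A]\<close>: the map
  \<open>\<int>[B] \<rightarrow> \<int>[A]\<close> is surjective, and primes containing its kernel correspond to their images.
\<close>

definition distinguished_point ::
    "nat \<Rightarrow> nat \<Rightarrow> ('a, 'm) pointed_monoid_scheme \<Rightarrow> (monomial \<Rightarrow> 'a) \<Rightarrow> int set
      \<Rightarrow> ('a \<Rightarrow> int) set" where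
  "distinguished_point r s A \<phi> \<pp> =
    monoid_ring_map \<Z> (ambient_monoid r s) A \<phi> ` distinguished_prime r s \<pp>"

definition defining_ideal ::
    "nat \<Rightarrow> nat \<Rightarrow> ('a, 'm) pointed_monoid_scheme \<Rightarrow> (monomial \<Rightarrow> 'a) \<Rightarrow> (monomial \<Rightarrow> int) set" where
  "defining_ideal r s A \<phi> =
    a_kernel (ambient_ring r s) (monoid_ring \<Z> A) (monoid_ring_map \<Z> (ambient_monoid r s) A \<phi>)"

end

theory Submission
  imports Defs "HOL-Decision_Procs.Algebra_Aux" "HOL-Computational_Algebra.Formal_Power_Series"
begin

text \<open>
  Let \<open>U\<close> be the group of units of \<open>A\<close>. It is finitely generated and torsionfree, hence free with
  a basis \<open>g\<^sub>1, \<dots>, g\<^sub>k\<close>, and by cancellativity it acts freely on the nonzero elements of \<open>A\<close>.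
  The special form of the binomials implies that no monomial that contains some \<open>x\<^sub>i\<close> becomes a
  unit in \<open>A\<close>, so the distinguished prime \<open>Q\<close> of \<open>R[A]\<close> is generated by the nonunits
  of \<open>A\<close> and the elements \<open>g\<^sub>i - 1\<close>. For a \<open>U\<close>-orbit \<open>c\<close> let \<open>d(c)\<close> be the largest number of
  nonunits of which its elements are products. With respect to the grading by orbits,
  the component of \<open>Q\<^sup>l\<^sup>+\<^sup>1\<close> in degree \<open>c\<close> is the power with exponent \<open>l + 1 - d(c)\<close> of the
  augmentation ideal of \<open>R[U]\<close>. Hence the elements \<open>c \<Prod>\<^sub>i (g\<^sub>i - 1)\<^bsup>e i\<^esup>\<close> with
  \<open>d(c) + \<Sum>\<^sub>i e i \<le> l\<close> form a basis of \<open>R[A]\<close> modulo \<open>Q\<^sup>l\<^sup>+\<^sup>1\<close>, and the Hilbert-Samuel functions of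
  all fibres and of the total space at the distinguished points count the same indices \<open>(c, e)\<close>.

  No dimensions are computed: a dual family of \<open>\<int>\<close>-valued functionals (Taylor coefficients) on
  \<open>\<int>[A]\<close> defines a chain of ideals with simple factors, and the ideals of all local rings involved
  are handled through their contractions to \<open>\<int>[A]\<close>.
\<close>

subsection \<open>Localization\<close>

text \<open>The local ring at \<open>a\<close> has residue characteristic zero and those of the
  other fibres have characteristic \<open>p\<close>, so lengths counted as dimensions would refer to
  different fields. What makes the count uniform is integrality: the Taylor coefficients are
  products of generalized binomial coefficients, hence integers, and their pairing with the basis
  elements is the identity matrix over the integers, which survives reduction modulo every prime.
  The argument therefore runs for an arbitrary prime ideal \<open>P\<close> of
  \<open>\<int>\<close>, with vanishing read as membership in \<open>P\<close>. Multiplication acts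
  on Taylor coefficients triangularly with respect to the degree, with the value at the point on the
  diagonal. This is why they cut out ideals, and why the factors of the chain are simple. The
  obstacle is the fibre, a ring of cosets of formal sums that is then localized. A presentation does
  not show that an element is nonzero. For this, additive maps \<open>d\<close> from
  \<open>\<int>[A]\<close> to the integers are extended to the tensor product by sending
  \<open>s \<otimes> t\<close> to \<open>d(s) t\<close>, and the Taylor coefficients are such
  maps.\<close>

context primeideal
begin

lemma compl_mult: "s \<in> carrier R - I \<Longrightarrow> t \<in> carrier R - I \<Longrightarrow> s \<otimes> t \<in> carrier R - I"
  using I_prime by auto

lemma compl_one: "\<one> \<in> carrier R - I"
  using I_notcarr one_imp_carrier by auto

lemma fraction_rel_iff:
  "((a, s), (b, t)) \<in> fraction_rel R I \<longleftrightarrow>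
    a \<in> carrier R \<and> s \<in> carrier R - I \<and> b \<in> carrier R \<and> t \<in> carrier R - I \<and>
    (\<exists>u\<in>carrier R - I. u \<otimes> (a \<otimes> t) = u \<otimes> (b \<otimes> s))"
proof -
  have "u \<otimes> (a \<otimes> t \<ominus> b \<otimes> s) = \<zero> \<longleftrightarrow> u \<otimes> (a \<otimes> t) = u \<otimes> (b \<otimes> s)"
    if "a \<in> carrier R" "s \<in> carrier R" "b \<in> carrier R" "t \<in> carrier R" "u \<in> carrier R" for u
  proof -
    have "u \<otimes> (a \<otimes> t \<ominus> b \<otimes> s) = u \<otimes> (a \<otimes> t) \<ominus> u \<otimes> (b \<otimes> s)"
      using that by (simp add: a_minus_def r_distr r_minus)
    then show ?thesis using that by (simp add: eq_diff0)
  qed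
  then show ?thesis
    unfolding fraction_rel_def by (auto; blast)
qed

lemma equiv_fraction_rel: "equiv (carrier R \<times> (carrier R - I)) (fraction_rel R I)"
proof (rule equivI)
  show "fraction_rel R I \<subseteq> (carrier R \<times> (carrier R - I)) \<times> (carrier R \<times> (carrier R - I))"
    unfolding fraction_rel_def by auto
  show "refl_on (carrier R \<times> (carrier R - I)) (fraction_rel R I)"
    by (rule refl_onI) (use compl_one in \<open>auto simp: fraction_rel_iff\<close>)
  show "sym (fraction_rel R I)"
    by (rule symI) (auto simp: fraction_rel_iff; metis DiffI)
  show "trans (fraction_rel R I)"
  proof (rule transI)
    fix x y z assume xy: "(x, y) \<in> fraction_rel R I" and yz: "(y, z) \<in> fraction_rel R I"
    obtain a s b t c w where e: "x = (a, s)" "y = (b, t)" "z = (c, w)" by (cases x, cases y, cases z)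
    obtain u where u: "u \<in> carrier R - I" "u \<otimes> (a \<otimes> t) = u \<otimes> (b \<otimes> s)"
      and as: "a \<in> carrier R" "s \<in> carrier R - I" "b \<in> carrier R" "t \<in> carrier R - I"
      using xy by (auto simp: fraction_rel_iff e)
    obtain v where v: "v \<in> carrier R - I" "v \<otimes> (b \<otimes> w) = v \<otimes> (c \<otimes> t)"
      and cw: "c \<in> carrier R" "w \<in> carrier R - I"
      using yz by (auto simp: fraction_rel_iff e)
    note c = u(1) v(1) as cw
    \<comment> \<open>Zero divisors may be present, so the middle denominator \<open>t\<close>
      cannot be cancelled; it joins \<open>u\<close> and \<open>v\<close> in the multiplier, which
      stays outside the prime.\<close>
    have "(u \<otimes> v \<otimes> t) \<otimes> (a \<otimes> w) = (v \<otimes> w) \<otimes> (u \<otimes> (a \<otimes> t))"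
      using c by (simp add: m_ac)
    also have "\<dots> = (u \<otimes> s) \<otimes> (v \<otimes> (b \<otimes> w))"
      unfolding u(2) using c by (simp add: m_ac)
    also have "\<dots> = (u \<otimes> v \<otimes> t) \<otimes> (c \<otimes> s)"
      unfolding v(2) using c by (simp add: m_ac)
    finally show "(x, z) \<in> fraction_rel R I"
      using c compl_mult[OF compl_mult[OF u(1) v(1)] as(4)] by (auto simp: fraction_rel_iff e)
  qed
qed

lemma fraction_eq_iff:
  assumes "a \<in> carrier R" "s \<in> carrier R - I" "b \<in> carrier R" "t \<in> carrier R - I"
  shows "fraction R I a s = fraction R I b t \<longleftrightarrow>
    (\<exists>u\<in>carrier R - I. u \<otimes> (a \<otimes> t) = u \<otimes> (b \<otimes> s))"
  unfolding fraction_def using assms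
  by (subst eq_equiv_class_iff[OF equiv_fraction_rel]) (auto simp: fraction_rel_iff)

lemma fraction_eqI:
  assumes "a \<in> carrier R" "s \<in> carrier R - I" "b \<in> carrier R" "t \<in> carrier R - I"
    and "a \<otimes> t = b \<otimes> s"
  shows "fraction R I a s = fraction R I b t"
  using assms compl_one by (subst fraction_eq_iff) auto

lemma localization_carrier:
  "carrier (localization R I) = {fraction R I a s | a s. a \<in> carrier R \<and> s \<in> carrier R - I}"
  by (auto simp: localization_def fraction_def quotient_def)

lemma fraction_closed [simp]:
  "a \<in> carrier R \<Longrightarrow> s \<in> carrier R - I \<Longrightarrow> fraction R I a s \<in> carrier (localization R I)"
  by (auto simp: localization_carrier)

lemma localizationE:
  assumes "w \<in> carrier (localization R I)"
  obtains a s where "a \<in> carrier R" "s \<in> carrier R - I" "w = fraction R I a s"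
  using assms by (auto simp: localization_carrier)

text \<open>The product is defined as a union over all representatives. It collapses to one class
  because the fraction formed does not depend on them: if \<open>u\<close> and \<open>v\<close>
  witness the two equivalences, \<open>u \<otimes> v\<close> witnesses the third. Addition works in
  the same way.\<close>

lemma localization_mult:
  assumes "a \<in> carrier R" "s \<in> carrier R - I" "b \<in> carrier R" "t \<in> carrier R - I"
  shows "fraction R I a s \<otimes>\<^bsub>localization R I\<^esub> fraction R I b t = fraction R I (a \<otimes> b) (s \<otimes> t)"
proof -
  let ?f = "\<lambda>x y. fraction R I (fst x \<otimes> fst y) (snd x \<otimes> snd y)"
  have "?f (a, s) (b, t) = ?f (a', s') (b', t')"
    if r: "((a, s), (a', s')) \<in> fraction_rel R I" "((b, t), (b', t')) \<in> fraction_rel R I"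
    for a s a' s' b t b' t'
  proof -
    obtain u where u: "u \<in> carrier R - I" "u \<otimes> (a \<otimes> s') = u \<otimes> (a' \<otimes> s)"
      using r(1) by (auto simp: fraction_rel_iff)
    obtain v where v: "v \<in> carrier R - I" "v \<otimes> (b \<otimes> t') = v \<otimes> (b' \<otimes> t)"
      using r(2) by (auto simp: fraction_rel_iff)
    have c: "a \<in> carrier R" "s \<in> carrier R - I" "a' \<in> carrier R" "s' \<in> carrier R - I"
        "b \<in> carrier R" "t \<in> carrier R - I" "b' \<in> carrier R" "t' \<in> carrier R - I"
      using r by (simp_all add: fraction_rel_iff)
    have "(u \<otimes> v) \<otimes> ((a \<otimes> b) \<otimes> (s' \<otimes> t')) = (u \<otimes> (a \<otimes> s')) \<otimes> (v \<otimes> (b \<otimes> t'))"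
      using c u(1) v(1) by (simp add: m_ac)
    also have "\<dots> = (u \<otimes> v) \<otimes> ((a' \<otimes> b') \<otimes> (s \<otimes> t))"
      unfolding u(2) v(2) using c u(1) v(1) by (simp add: m_ac)
    finally show ?thesis
      unfolding fst_conv snd_conv
      by (subst fraction_eq_iff)
        (use c u(1) v(1) compl_mult[OF u(1) v(1)] compl_mult[OF c(2) c(6)] compl_mult[OF c(4) c(8)]
          in \<open>auto intro!: bexI[of _ "u \<otimes> v"]\<close>)
  qed
  note * = this
  have "congruent2 (fraction_rel R I) (fraction_rel R I) ?f"
  proof (rule congruent2I')
    fix x x' y y' assume "(x, x') \<in> fraction_rel R I" "(y, y') \<in> fraction_rel R I"
    then show "?f x y = ?f x' y'"
      using *[of "fst x" "snd x" "fst x'" "snd x'" "fst y" "snd y" "fst y'" "snd y'"] by simp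
  qed
  from UN_equiv_class2[OF equiv_fraction_rel equiv_fraction_rel this, of "(a, s)" "(b, t)"]
  show ?thesis using assms
    by (simp add: localization_def fraction_def[of R I a s] fraction_def[of R I b t] case_prod_beta)
qed

lemma localization_add:
  assumes "a \<in> carrier R" "s \<in> carrier R - I" "b \<in> carrier R" "t \<in> carrier R - I"
  shows "fraction R I a s \<oplus>\<^bsub>localization R I\<^esub> fraction R I b t =
    fraction R I (a \<otimes> t \<oplus> b \<otimes> s) (s \<otimes> t)"
proof -
  let ?f = "\<lambda>x y. fraction R I (fst x \<otimes> snd y \<oplus> fst y \<otimes> snd x) (snd x \<otimes> snd y)"
  have "?f (a, s) (b, t) = ?f (a', s') (b', t')"
    if r: "((a, s), (a', s')) \<in> fraction_rel R I" "((b, t), (b', t')) \<in> fraction_rel R I"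
    for a s a' s' b t b' t'
  proof -
    obtain u where u: "u \<in> carrier R - I" "u \<otimes> (a \<otimes> s') = u \<otimes> (a' \<otimes> s)"
      using r(1) by (auto simp: fraction_rel_iff)
    obtain v where v: "v \<in> carrier R - I" "v \<otimes> (b \<otimes> t') = v \<otimes> (b' \<otimes> t)"
      using r(2) by (auto simp: fraction_rel_iff)
    have c: "a \<in> carrier R" "s \<in> carrier R - I" "a' \<in> carrier R" "s' \<in> carrier R - I"
        "b \<in> carrier R" "t \<in> carrier R - I" "b' \<in> carrier R" "t' \<in> carrier R - I"
      using r by (simp_all add: fraction_rel_iff)
    have c': "u \<in> carrier R" "v \<in> carrier R" "s \<in> carrier R" "s' \<in> carrier R"
        "t \<in> carrier R" "t' \<in> carrier R"
      using u(1) v(1) c by auto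
    have "(u \<otimes> v) \<otimes> ((a \<otimes> t \<oplus> b \<otimes> s) \<otimes> (s' \<otimes> t')) =
        (v \<otimes> t \<otimes> t') \<otimes> (u \<otimes> (a \<otimes> s')) \<oplus> (u \<otimes> s \<otimes> s') \<otimes> (v \<otimes> (b \<otimes> t'))"
      using c(1,3,5,7) c' by algebra
    also have "\<dots> = (u \<otimes> v) \<otimes> ((a' \<otimes> t' \<oplus> b' \<otimes> s') \<otimes> (s \<otimes> t))"
      unfolding u(2) v(2) using c(1,3,5,7) c' by algebra
    finally show ?thesis
      unfolding fst_conv snd_conv
      by (subst fraction_eq_iff)
        (use c u(1) v(1) compl_mult[OF u(1) v(1)] compl_mult[OF c(2) c(6)] compl_mult[OF c(4) c(8)]
          in \<open>auto intro!: bexI[of _ "u \<otimes> v"]\<close>)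
  qed
  note * = this
  have "congruent2 (fraction_rel R I) (fraction_rel R I) ?f"
  proof (rule congruent2I')
    fix x x' y y' assume "(x, x') \<in> fraction_rel R I" "(y, y') \<in> fraction_rel R I"
    then show "?f x y = ?f x' y'"
      using *[of "fst x" "snd x" "fst x'" "snd x'" "fst y" "snd y" "fst y'" "snd y'"] by simp
  qed
  from UN_equiv_class2[OF equiv_fraction_rel equiv_fraction_rel this, of "(a, s)" "(b, t)"]
  show ?thesis using assms
    by (simp add: localization_def fraction_def[of R I a s] fraction_def[of R I b t] case_prod_beta)
qed

lemma localization_one: "\<one>\<^bsub>localization R I\<^esub> = fraction R I \<one> \<one>"
  and localization_zero: "\<zero>\<^bsub>localization R I\<^esub> = fraction R I \<zero> \<one>"
  by (simp_all add: localization_def)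

lemma cring_localization: "cring (localization R I)"
proof (intro cringI abelian_groupI comm_monoidI)
  let ?L = "localization R I"
  note simps = localization_add localization_mult localization_one localization_zero
    compl_mult compl_one
  have [simp]: "s \<otimes> t \<in> carrier R - I \<longleftrightarrow> True" if "s \<in> carrier R - I" "t \<in> carrier R - I" for s t
    using compl_mult[OF that] by simp
  fix x assume x: "x \<in> carrier ?L"
  obtain a s where a: "a \<in> carrier R" "s \<in> carrier R - I" "x = fraction R I a s"
    using x by (rule localizationE)
  show "\<zero>\<^bsub>?L\<^esub> \<oplus>\<^bsub>?L\<^esub> x = x" "\<one>\<^bsub>?L\<^esub> \<otimes>\<^bsub>?L\<^esub> x = x"
    using a compl_one by (auto simp: simps)
  have "fraction R I (\<ominus> a) s \<oplus>\<^bsub>?L\<^esub> x = \<zero>\<^bsub>?L\<^esub>"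
    unfolding a(3) localization_zero using a(1,2) compl_one
    by (subst localization_add; simp add: compl_mult l_minus l_neg l_distr[symmetric] del: Diff_iff)
      (rule fraction_eqI, auto simp: compl_mult l_minus l_neg simp del: Diff_iff)
  then show "\<exists>y\<in>carrier ?L. y \<oplus>\<^bsub>?L\<^esub> x = \<zero>\<^bsub>?L\<^esub>"
    using a by (intro bexI[of _ "fraction R I (\<ominus> a) s"]) auto
  fix y assume y: "y \<in> carrier ?L"
  obtain b t where b: "b \<in> carrier R" "t \<in> carrier R - I" "y = fraction R I b t"
    using y by (rule localizationE)
  show "x \<oplus>\<^bsub>?L\<^esub> y \<in> carrier ?L" "x \<otimes>\<^bsub>?L\<^esub> y \<in> carrier ?L"
    using a b compl_mult by (auto simp: simps)
  show "x \<oplus>\<^bsub>?L\<^esub> y = y \<oplus>\<^bsub>?L\<^esub> x" "x \<otimes>\<^bsub>?L\<^esub> y = y \<otimes>\<^bsub>?L\<^esub> x"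
    using a b by (auto simp: simps m_ac a_ac)
  fix z assume z: "z \<in> carrier ?L"
  obtain c u where c: "c \<in> carrier R" "u \<in> carrier R - I" "z = fraction R I c u"
    using z by (rule localizationE)
  have abc: "s \<in> carrier R" "t \<in> carrier R" "u \<in> carrier R"
    using a b c by auto
  show "x \<otimes>\<^bsub>?L\<^esub> y \<otimes>\<^bsub>?L\<^esub> z = x \<otimes>\<^bsub>?L\<^esub> (y \<otimes>\<^bsub>?L\<^esub> z)"
    unfolding a(3) b(3) c(3) using a(1,2) b(1,2) c(1,2) abc
    by (simp add: simps del: Diff_iff) (simp add: m_ac)
  have add_assoc: "(a \<otimes> t \<oplus> b \<otimes> s) \<otimes> u \<oplus> c \<otimes> (s \<otimes> t) = a \<otimes> (t \<otimes> u) \<oplus> (b \<otimes> u \<oplus> c \<otimes> t) \<otimes> s"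
    using a(1) b(1) c(1) abc by algebra
  \<comment> \<open>The two sides of the distributive law arise with the different denominators
    \<open>s t u\<close> and \<open>s u t u\<close>, so they are compared by
    cross-multiplication.\<close>
  have distr: "(a \<otimes> t \<oplus> b \<otimes> s) \<otimes> c \<otimes> (s \<otimes> u \<otimes> (t \<otimes> u)) =
      (a \<otimes> c \<otimes> (t \<otimes> u) \<oplus> b \<otimes> c \<otimes> (s \<otimes> u)) \<otimes> (s \<otimes> t \<otimes> u)"
    using a(1) b(1) c(1) abc by algebra
  show "x \<oplus>\<^bsub>?L\<^esub> y \<oplus>\<^bsub>?L\<^esub> z = x \<oplus>\<^bsub>?L\<^esub> (y \<oplus>\<^bsub>?L\<^esub> z)"
    unfolding a(3) b(3) c(3) using a(1,2) b(1,2) c(1,2) abc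
    by (simp add: simps del: Diff_iff) (simp add: add_assoc m_assoc)
  show "(x \<oplus>\<^bsub>?L\<^esub> y) \<otimes>\<^bsub>?L\<^esub> z = x \<otimes>\<^bsub>?L\<^esub> z \<oplus>\<^bsub>?L\<^esub> y \<otimes>\<^bsub>?L\<^esub> z"
    unfolding a(3) b(3) c(3) using a(1,2) b(1,2) c(1,2) abc
    by (simp add: simps del: Diff_iff)
      (rule fraction_eqI, auto simp: compl_mult distr simp del: Diff_iff)
qed (use compl_one in \<open>auto simp: localization_one localization_zero\<close>)

lemma localization_hom: "(\<lambda>a. fraction R I a \<one>) \<in> ring_hom R (localization R I)"
  using compl_one
  by (intro ring_hom_memI) (auto simp: localization_mult localization_add localization_one)

end

subsection \<open>Homomorphisms that are surjective up to denominators\<close>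

text \<open>Instances are the identity, the map from a ring to its fibre, and the maps into
  localizations and residue fields. Every element of \<open>T\<close> is a fraction with numerator
  and denominator from \<open>S\<close>, so ideals and primes of \<open>T\<close> can be studied in
  \<open>S\<close>; \<open>kernel\<close> ensures that \<open>Q\<close> survives in
  \<open>T\<close>.\<close>

locale fraction_hom = S?: cring S + T?: cring T + Q?: primeideal Q S
  for S (structure) and T (structure) and Q and h +
  assumes hom: "h \<in> ring_hom S T"
    and denominators: "t \<in> carrier T \<Longrightarrow>
      \<exists>s\<in>carrier S. \<exists>u\<in>carrier S - Q. h u \<otimes>\<^bsub>T\<^esub> t = h s"
    and kernel: "s \<in> carrier S \<Longrightarrow> h s = \<zero>\<^bsub>T\<^esub> \<Longrightarrow> s \<in> Q"
begin

sublocale H: ring_hom_cring S T h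
  by (intro ring_hom_cring.intro ring_hom_cring_axioms.intro S.cring_axioms T.cring_axioms hom)

text \<open>Besides the ideal generated by the image of \<open>J\<close> this contains whatever a
  denominator multiplies into it, since \<open>h u\<close> need not be a unit of \<open>T\<close>.
  It is the contraction to \<open>T\<close> of the extension of \<open>J\<close> to the local
  ring.\<close>

definition ext :: "'a set \<Rightarrow> 'c set" where
  "ext J = {t \<in> carrier T. \<exists>s\<in>J. \<exists>u\<in>carrier S - Q. h u \<otimes>\<^bsub>T\<^esub> t = h s}"

definition contr :: "'c set \<Rightarrow> 'a set" where
  "contr I = {s \<in> carrier S. h s \<in> I}"

lemma idealD:
  assumes "ideal J S"
  shows "J \<subseteq> carrier S" "\<And>x y. x \<in> J \<Longrightarrow> y \<in> J \<Longrightarrow> x \<oplus> y \<in> J"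
    "\<And>x y. x \<in> carrier S \<Longrightarrow> y \<in> J \<Longrightarrow> x \<otimes> y \<in> J" "\<zero> \<in> J" "\<And>x. x \<in> J \<Longrightarrow> \<ominus> x \<in> J"
    "\<And>x y. x \<in> J \<Longrightarrow> y \<in> J \<Longrightarrow> x \<ominus> y \<in> J"
proof -
  interpret J: ideal J S by fact
  show "J \<subseteq> carrier S" "\<And>x y. x \<in> J \<Longrightarrow> y \<in> J \<Longrightarrow> x \<oplus> y \<in> J"
    "\<And>x y. x \<in> carrier S \<Longrightarrow> y \<in> J \<Longrightarrow> x \<otimes> y \<in> J" "\<zero> \<in> J" "\<And>x. x \<in> J \<Longrightarrow> \<ominus> x \<in> J"
    "\<And>x y. x \<in> J \<Longrightarrow> y \<in> J \<Longrightarrow> x \<ominus> y \<in> J"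
    using J.a_subset J.I_l_closed by (auto simp: S.minus_eq)
qed

lemma ext_ideal:
  assumes J: "ideal J S"
  shows "ideal (ext J) T"
proof (rule idealI)
  note J' = idealD[OF J]
  show "ring T" by (rule T.ring_axioms)
  have smult: "x \<otimes>\<^bsub>T\<^esub> t \<in> ext J" if t: "t \<in> ext J" and x: "x \<in> carrier T" for t x
  proof -
    obtain s u where s: "s \<in> J" "u \<in> carrier S - Q" "h u \<otimes>\<^bsub>T\<^esub> t = h s" and tc: "t \<in> carrier T"
      using t by (auto simp: ext_def)
    obtain s' u' where s': "s' \<in> carrier S" "u' \<in> carrier S - Q" "h u' \<otimes>\<^bsub>T\<^esub> x = h s'"
      using denominators[OF x] by blast
    have "h (u \<otimes> u') \<otimes>\<^bsub>T\<^esub> (x \<otimes>\<^bsub>T\<^esub> t) = (h u' \<otimes>\<^bsub>T\<^esub> x) \<otimes>\<^bsub>T\<^esub> (h u \<otimes>\<^bsub>T\<^esub> t)"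
      using s(2) s'(2) x tc by (simp add: T.m_ac)
    also have "\<dots> = h (s' \<otimes> s)" unfolding s(3) s'(3) using s s' J'(1) by (simp add: subset_iff)
    finally show ?thesis
      using Q.compl_mult[OF s(2) s'(2)] J'(3)[OF s'(1) s(1)] x tc unfolding ext_def by blast
  qed
  show "x \<otimes>\<^bsub>T\<^esub> t \<in> ext J" "t \<otimes>\<^bsub>T\<^esub> x \<in> ext J" if "t \<in> ext J" "x \<in> carrier T" for t x
    using smult[OF that] that by (simp_all add: T.m_comm ext_def)
  show "subgroup (ext J) (add_monoid T)"
  proof (unfold_locales, goal_cases)
    case 1
    then show ?case by (auto simp: ext_def)
  next
    case (2 x y)
    obtain s u where s: "s \<in> J" "u \<in> carrier S - Q" "h u \<otimes>\<^bsub>T\<^esub> x = h s" and x: "x \<in> carrier T"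
      using 2 by (auto simp: ext_def)
    obtain t v where t: "t \<in> J" "v \<in> carrier S - Q" "h v \<otimes>\<^bsub>T\<^esub> y = h t" and y: "y \<in> carrier T"
      using 2 by (auto simp: ext_def)
    have c: "h u \<in> carrier T" "h v \<in> carrier T" using s t by auto
    have "h (u \<otimes> v) \<otimes>\<^bsub>T\<^esub> (x \<oplus>\<^bsub>T\<^esub> y) =
        h v \<otimes>\<^bsub>T\<^esub> (h u \<otimes>\<^bsub>T\<^esub> x) \<oplus>\<^bsub>T\<^esub> h u \<otimes>\<^bsub>T\<^esub> (h v \<otimes>\<^bsub>T\<^esub> y)"
      using s(2) t(2) x y c by (simp add: T.r_distr T.m_ac)
    also have "\<dots> = h (v \<otimes> s \<oplus> u \<otimes> t)"
      unfolding s(3) t(3) using s t J'(1) by (simp add: subset_iff)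
    finally have "x \<oplus>\<^bsub>T\<^esub> y \<in> ext J"
      using Q.compl_mult[OF s(2) t(2)] J'(2)[OF J'(3) J'(3), of v s u t] T.a_closed[OF x y] s t
      unfolding ext_def by blast
    then show ?case by simp
  next
    case 3
    show ?case
      using J'(4) Q.compl_one unfolding ext_def by force
  next
    case (4 x)
    then obtain s u where s: "s \<in> J" "u \<in> carrier S - Q" "h u \<otimes>\<^bsub>T\<^esub> x = h s" and x: "x \<in> carrier T"
      by (auto simp: ext_def)
    have "h u \<otimes>\<^bsub>T\<^esub> (\<ominus>\<^bsub>T\<^esub> x) = h (\<ominus> s)"
      using s x J'(1) by (auto simp: T.r_minus subset_iff)
    then show ?case
      using s x J'(5)[OF s(1)] unfolding ext_def a_inv_def[symmetric] by blast
  qed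
qed

lemma contr_ideal: "ideal I T \<Longrightarrow> ideal (contr I) S"
  unfolding contr_def by (rule ring_hom_ring.ideal_vimage[OF ring_hom_ringI2[OF S.ring_axioms T.ring_axioms hom]])

text \<open>These are the ideals that are contracted from the localization at
  \<open>Q\<close>.\<close>

definition saturated :: "'a set \<Rightarrow> bool" where
  "saturated J \<longleftrightarrow> (\<forall>s\<in>carrier S. \<forall>u\<in>carrier S - Q. u \<otimes> s \<in> J \<longrightarrow> s \<in> J)"

lemma saturatedD:
  "saturated J \<Longrightarrow> u \<in> carrier S - Q \<Longrightarrow> s \<in> carrier S \<Longrightarrow> u \<otimes> s \<in> J \<Longrightarrow> s \<in> J"
  by (auto simp: saturated_def)

lemma saturated_prime: "saturated Q"
  using Q.I_prime by (auto simp: saturated_def)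

text \<open>If \<open>h u\<close> times \<open>h x\<close> equals \<open>h s\<close> with
  \<open>s \<in> J\<close>, then \<open>u \<otimes> x \<ominus> s\<close> lies in the kernel, hence
  in \<open>J\<close>; so \<open>u \<otimes> x \<in> J\<close>, and saturation removes
  \<open>u\<close>.\<close>

lemma contr_ext:
  assumes J: "ideal J S" "saturated J" and ker: "{s \<in> carrier S. h s = \<zero>\<^bsub>T\<^esub>} \<subseteq> J"
  shows "contr (ext J) = J"
proof
  note J' = idealD[OF J(1)]
  show "J \<subseteq> contr (ext J)"
  proof
    fix s assume s: "s \<in> J"
    then have "h \<one> \<otimes>\<^bsub>T\<^esub> h s = h s" using J'(1) by (simp add: subset_iff)
    then show "s \<in> contr (ext J)"
      using s J'(1) Q.compl_one unfolding contr_def ext_def by blast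
  qed
  show "contr (ext J) \<subseteq> J"
  proof
    fix x assume "x \<in> contr (ext J)"
    then obtain s u where s: "s \<in> J" "u \<in> carrier S - Q" "h u \<otimes>\<^bsub>T\<^esub> h x = h s" and x: "x \<in> carrier S"
      by (auto simp: contr_def ext_def)
    have "u \<otimes> x \<ominus> s \<in> J"
      using ker s x J'(1) by (auto simp: S.minus_eq T.r_neg subset_iff)
    then have "(u \<otimes> x \<ominus> s) \<oplus> s \<in> J" using s by (intro J'(2))
    moreover have "(u \<otimes> x \<ominus> s) \<oplus> s = u \<otimes> x"
      using s x J'(1) by (simp add: S.minus_eq S.a_assoc S.l_neg subset_iff)
    ultimately show "x \<in> J" using J(2) s(2) x by (auto intro: saturatedD)
  qed
qed

lemma contr_ext_prime: "contr (ext Q) = Q"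
  using kernel by (intro contr_ext Q.is_ideal saturated_prime) auto

lemma ext_prime: "primeideal (ext Q) T"
proof (rule primeidealI)
  show "ideal (ext Q) T" by (rule ext_ideal[OF Q.is_ideal])
  show "cring T" by (rule T.cring_axioms)
  show "carrier T \<noteq> ext Q"
    using contr_ext_prime Q.compl_one by (auto simp: contr_def)
  fix x y assume x: "x \<in> carrier T" and y: "y \<in> carrier T" and xy: "x \<otimes>\<^bsub>T\<^esub> y \<in> ext Q"
  obtain s u where s: "s \<in> carrier S" "u \<in> carrier S - Q" "h u \<otimes>\<^bsub>T\<^esub> x = h s"
    using denominators[OF x] by blast
  obtain t v where t: "t \<in> carrier S" "v \<in> carrier S - Q" "h v \<otimes>\<^bsub>T\<^esub> y = h t"
    using denominators[OF y] by blast
  have "h (s \<otimes> t) = h (u \<otimes> v) \<otimes>\<^bsub>T\<^esub> (x \<otimes>\<^bsub>T\<^esub> y)"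
    using s t x y by (simp add: s(3)[symmetric] t(3)[symmetric] T.m_ac)
  also have "\<dots> \<in> ext Q"
    using ideal.I_l_closed[OF ext_ideal[OF Q.is_ideal] xy] s t by simp
  finally have "s \<otimes> t \<in> contr (ext Q)" using s t by (simp add: contr_def)
  then have "s \<in> Q \<or> t \<in> Q"
    using Q.I_prime s t by (simp add: contr_ext_prime)
  then show "x \<in> ext Q \<or> y \<in> ext Q" using s t x y by (auto simp: ext_def)
qed

text \<open>A prime with contraction \<open>Q\<close> contains no \<open>h u\<close>, so it contains
  an element exactly when it contains the numerator, and numerators are tested in \<open>Q\<close>.
  This uniqueness gives the definite description in \<open>fibre_point\<close> its value.\<close>

lemma prime_eq_ext:
  assumes P: "primeideal P T" and c: "contr P = Q"
  shows "P = ext Q"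
proof -
  interpret P: primeideal P T by fact
  have "x \<in> P \<longleftrightarrow> x \<in> ext Q" if x: "x \<in> carrier T" for x
  proof -
    obtain s u where s: "s \<in> carrier S" "u \<in> carrier S - Q" "h u \<otimes>\<^bsub>T\<^esub> x = h s"
      using denominators[OF x] by blast
    have hu: "h u \<in> carrier T" using s(2) by simp
    have "h u \<notin> P" using s c by (auto simp: contr_def)
    then have "x \<in> P \<longleftrightarrow> h s \<in> P"
      unfolding s(3)[symmetric] using P.I_prime[of "h u" x] P.I_l_closed[of x "h u"] hu x
      by blast
    moreover have "h u \<notin> ext Q" using s contr_ext_prime by (auto simp: contr_def)
    then have "x \<in> ext Q \<longleftrightarrow> h s \<in> ext Q"
      using primeideal.I_prime[OF ext_prime, of "h u" x] hu x
        ideal.I_l_closed[OF ext_ideal[OF Q.is_ideal], of x "h u"]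
      unfolding s(3)[symmetric] by blast
    ultimately show ?thesis
      using c contr_ext_prime s(1) by (auto simp: contr_def)
  qed
  moreover have "P \<subseteq> carrier T" "ext Q \<subseteq> carrier T" using P.a_subset by (auto simp: ext_def)
  ultimately show ?thesis by blast
qed

lemma the_prime_eq:
  "(THE P. primeideal P T \<and> {s \<in> carrier S. h s \<in> P} = Q) = ext Q"
proof (rule the_equality)
  show "primeideal (ext Q) T \<and> {s \<in> carrier S. h s \<in> ext Q} = Q"
    using ext_prime contr_ext_prime by (simp add: contr_def)
  show "P = ext Q" if "primeideal P T \<and> {s \<in> carrier S. h s \<in> P} = Q" for P
    using that prime_eq_ext by (simp add: contr_def)
qed

end

text \<open>With invertible denominators \<open>T\<close> is a quotient of the localization of
  \<open>S\<close> at \<open>Q\<close>, hence local, and its ideals correspond to the saturated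
  ideals of \<open>S\<close> that contain the kernel.\<close>

locale local_fraction_hom = fraction_hom +
  assumes units: "u \<in> carrier S - Q \<Longrightarrow> h u \<in> Units T"
begin

lemma contr_saturated:
  assumes I: "ideal I T"
  shows "saturated (contr I)"
  unfolding saturated_def
proof (intro ballI impI)
  fix s u assume s: "s \<in> carrier S" and u: "u \<in> carrier S - Q" and us: "u \<otimes> s \<in> contr I"
  interpret I: ideal I T by fact
  have "inv\<^bsub>T\<^esub> (h u) \<otimes>\<^bsub>T\<^esub> (h u \<otimes>\<^bsub>T\<^esub> h s) \<in> I"
    by (rule I.I_l_closed) (use us units[OF u] s u in \<open>auto simp: contr_def\<close>)
  moreover have "inv\<^bsub>T\<^esub> (h u) \<otimes>\<^bsub>T\<^esub> (h u \<otimes>\<^bsub>T\<^esub> h s) = h s"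
    using units[OF u] s u by (simp add: T.m_assoc[symmetric])
  ultimately show "s \<in> contr I" using s by (simp add: contr_def)
qed

lemma ext_contr:
  assumes I: "ideal I T"
  shows "ext (contr I) = I"
proof -
  interpret I: ideal I T by fact
  have "x \<in> ext (contr I) \<longleftrightarrow> x \<in> I" if x: "x \<in> carrier T" for x
  proof
    assume "x \<in> ext (contr I)"
    then obtain s u where s: "h s \<in> I" "s \<in> carrier S" "u \<in> carrier S - Q" "h u \<otimes>\<^bsub>T\<^esub> x = h s"
      by (auto simp: ext_def contr_def)
    have "inv\<^bsub>T\<^esub> (h u) \<otimes>\<^bsub>T\<^esub> (h u \<otimes>\<^bsub>T\<^esub> x) \<in> I"
      unfolding s(4) by (rule I.I_l_closed) (use units[OF s(3)] s in auto)
    moreover have "inv\<^bsub>T\<^esub> (h u) \<otimes>\<^bsub>T\<^esub> (h u \<otimes>\<^bsub>T\<^esub> x) = x"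
      using units[OF s(3)] x T.Units_closed[OF units[OF s(3)]]
      by (simp add: T.m_assoc[symmetric] del: T.m_assoc)
    ultimately show "x \<in> I" by simp
  next
    assume "x \<in> I"
    obtain s u where s: "s \<in> carrier S" "u \<in> carrier S - Q" "h u \<otimes>\<^bsub>T\<^esub> x = h s"
      using denominators[OF x] by blast
    have "h s \<in> I" unfolding s(3)[symmetric] by (rule I.I_l_closed) (use \<open>x \<in> I\<close> s in auto)
    then show "x \<in> ext (contr I)" using s x by (auto simp: ext_def contr_def)
  qed
  then show ?thesis using I.a_subset by (auto simp: ext_def)
qed

lemma Units_iff: "x \<in> carrier T \<Longrightarrow> x \<in> Units T \<longleftrightarrow> x \<notin> ext Q"
proof
  assume x: "x \<in> carrier T" "x \<in> Units T"
  show "x \<notin> ext Q"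
  proof
    assume "x \<in> ext Q"
    then have "inv\<^bsub>T\<^esub> x \<otimes>\<^bsub>T\<^esub> x \<in> ext Q"
      by (rule ideal.I_l_closed[OF ext_ideal[OF Q.is_ideal]]) (use x in auto)
    then have "\<one> \<in> contr (ext Q)" using x by (simp add: contr_def)
    then show False using contr_ext_prime Q.compl_one by simp
  qed
next
  assume x: "x \<in> carrier T" "x \<notin> ext Q"
  obtain s u where s: "s \<in> carrier S" "u \<in> carrier S - Q" "h u \<otimes>\<^bsub>T\<^esub> x = h s"
    using denominators[OF x(1)] by blast
  have "s \<notin> Q" using s x by (auto simp: ext_def)
  then have "h u \<otimes>\<^bsub>T\<^esub> x \<in> Units T" using s(1) units unfolding s(3) by simp
  then show "x \<in> Units T" using x s T.prod_unit_l[of "h u" x] units[OF s(2)] by simp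
qed

lemma maximal_ext: "maximalideal (ext Q) T"
proof (rule maximalidealI)
  show "ideal (ext Q) T" by (rule ext_ideal[OF Q.is_ideal])
  show "carrier T \<noteq> ext Q" using primeideal.I_notcarr[OF ext_prime] .
  fix J assume J: "ideal J T" "ext Q \<subseteq> J" "J \<subseteq> carrier T"
  interpret J: ideal J T by fact
  show "J = ext Q \<or> J = carrier T"
  proof (cases "J \<subseteq> ext Q")
    case False
    then obtain x where x: "x \<in> J" "x \<notin> ext Q" by blast
    then have u: "x \<in> Units T" using J.Icarr Units_iff by blast
    then have "inv\<^bsub>T\<^esub> x \<otimes>\<^bsub>T\<^esub> x \<in> J" by (intro J.I_l_closed) (use x in auto)
    then show ?thesis using u J.one_imp_carrier by simp
  qed (use J in auto)
qed

text \<open>Elements outside \<open>ext Q\<close> are units, so every maximal ideal lies in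
  \<open>ext Q\<close>; this is the uniqueness behind \<open>max_ideal\<close>.\<close>

lemma max_ideal_eq: "max_ideal T = ext Q"
  unfolding max_ideal_def
proof (rule the_equality)
  show "maximalideal (ext Q) T" by (rule maximal_ext)
  fix M assume "maximalideal M T"
  then interpret M: maximalideal M T .
  have "M \<subseteq> ext Q"
  proof
    fix x assume x: "x \<in> M"
    show "x \<in> ext Q"
    proof (rule ccontr)
      assume "x \<notin> ext Q"
      then have u: "x \<in> Units T" using x M.Icarr Units_iff by blast
      then have "inv\<^bsub>T\<^esub> x \<otimes>\<^bsub>T\<^esub> x \<in> M" by (intro M.I_l_closed) (use x in auto)
      then show False using u M.one_imp_carrier M.I_notcarr by simp
    qed
  qed
  then show "M = ext Q"
    using M.I_maximal[OF ext_ideal[OF Q.is_ideal]] primeideal.I_notcarr[OF ext_prime]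
    by (auto simp: ext_def)
qed

end

text \<open>This is how the local ring of a fibre is reached from the total space: the denominators
  needed in \<open>R\<close> and those introduced by localizing are cleared together.\<close>

lemma (in primeideal) local_fraction_hom_localization:
  fixes S (structure)
  assumes "fraction_hom S R Q h" and I: "I = fraction_hom.ext S R Q h Q"
  shows "local_fraction_hom S (localization R I) Q (\<lambda>s. fraction R I (h s) \<one>\<^bsub>R\<^esub>)"
proof -
  interpret F: fraction_hom S R Q h by fact
  let ?L = "localization R I"
  interpret L: cring ?L by (rule cring_localization)
  have hI: "h s \<in> I \<longleftrightarrow> s \<in> Q" if "s \<in> carrier S" for s
    using F.contr_ext_prime that by (auto simp: I F.contr_def)
  have compl: "h u \<in> carrier R - I" if "u \<in> carrier S - Q" for u
    using that hI by auto
  show ?thesis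
  proof (unfold_locales)
    show "(\<lambda>s. fraction R I (h s) \<one>\<^bsub>R\<^esub>) \<in> ring_hom S ?L"
      using ring_hom_trans[OF F.hom localization_hom] by (simp add: comp_def)
    fix w assume "w \<in> carrier ?L"
    then obtain x y where w: "x \<in> carrier R" "y \<in> carrier R - I" "w = fraction R I x y"
      by (rule localizationE)
    obtain s u where s: "s \<in> carrier S" "u \<in> carrier S - Q" "h u \<otimes>\<^bsub>R\<^esub> x = h s"
      using F.denominators[OF w(1)] by blast
    obtain t v where t: "t \<in> carrier S" "v \<in> carrier S - Q" "h v \<otimes>\<^bsub>R\<^esub> y = h t"
      using F.denominators[of y] w by blast
    \<comment> \<open>If \<open>x = s / u\<close> and \<open>y = t / v\<close>, then
      \<open>x / y = (v s) / (u t)\<close>, so \<open>t\<close> has to be an admissible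
      denominator.\<close>
    have "t \<notin> Q"
      using I_prime[of "h v" y] compl[OF t(2)] w t hI[OF t(1)] by auto
    then have ut: "u \<otimes>\<^bsub>S\<^esub> t \<in> carrier S - Q" using F.Q.compl_mult s t by simp
    have vs: "v \<otimes>\<^bsub>S\<^esub> s \<in> carrier S" using s t by simp
    have "h (u \<otimes>\<^bsub>S\<^esub> t) \<otimes>\<^bsub>R\<^esub> x = h (v \<otimes>\<^bsub>S\<^esub> s) \<otimes>\<^bsub>R\<^esub> y"
      using s t w by (simp add: s(3)[symmetric] t(3)[symmetric] m_ac)
    then have "fraction R I (h (u \<otimes>\<^bsub>S\<^esub> t) \<otimes> x) (\<one> \<otimes> y) = fraction R I (h (v \<otimes>\<^bsub>S\<^esub> s)) \<one>"
      by (intro fraction_eqI)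
        (use w compl_one ut vs F.H.hom_closed[of "u \<otimes>\<^bsub>S\<^esub> t"] F.H.hom_closed[of "v \<otimes>\<^bsub>S\<^esub> s"]
          in simp_all)
    then have "fraction R I (h (u \<otimes>\<^bsub>S\<^esub> t)) \<one> \<otimes>\<^bsub>?L\<^esub> w = fraction R I (h (v \<otimes>\<^bsub>S\<^esub> s)) \<one>"
      using w compl_one ut F.H.hom_closed[of "u \<otimes>\<^bsub>S\<^esub> t"] unfolding w(3)
      by (subst localization_mult) auto
    then show "\<exists>s\<in>carrier S. \<exists>u\<in>carrier S - Q. fraction R I (h u) \<one> \<otimes>\<^bsub>?L\<^esub> w = fraction R I (h s) \<one>"
      using ut vs by blast
  next
    fix s assume s: "s \<in> carrier S" "fraction R I (h s) \<one> = \<zero>\<^bsub>?L\<^esub>"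
    then obtain v where v: "v \<in> carrier R - I" "v \<otimes> (h s \<otimes> \<one>) = v \<otimes> (\<zero> \<otimes> \<one>)"
      using fraction_eq_iff[of "h s" \<one> \<zero> \<one>] compl_one unfolding localization_zero by auto
    then have "v \<otimes> h s \<in> I" using s by (simp add: additive_subgroup.zero_closed)
    then show "s \<in> Q" using I_prime[of v "h s"] v s hI by auto
  next
    fix u assume u: "u \<in> carrier S - Q"
    have "fraction R I \<one> (h u) \<otimes>\<^bsub>?L\<^esub> fraction R I (h u) \<one> = \<one>\<^bsub>?L\<^esub>"
      unfolding localization_one using compl[OF u] compl_one
      by (subst localization_mult) (simp_all, intro fraction_eqI, simp_all)
    then show "fraction R I (h u) \<one> \<in> Units ?L"
      using compl[OF u] compl_one L.m_comm unfolding Units_def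
      by (auto intro!: bexI[of _ "fraction R I \<one> (h u)"])
  qed
qed

subsection \<open>Hilbert-Samuel functions through chains of ideals\<close>

lemma quotient_module_simps:
  "carrier (quotient_module R J) = carrier (R Quot J)"
  "ring.add (quotient_module R J) = ring.add (R Quot J)"
  "ring.zero (quotient_module R J) = ring.zero (R Quot J)"
  "smult (quotient_module R J) r U = (J +>\<^bsub>R\<^esub> r) \<otimes>\<^bsub>R Quot J\<^esub> U"
  by (simp_all add: quotient_module_def ring.defs module.defs)

lemma ideals_one: "\<one>\<^bsub>ideals_set R\<^esub> = carrier R"
  and ideals_mult: "I \<otimes>\<^bsub>ideals_set R\<^esub> J = ideal_prod R I J"
  and ideals_pow_Suc: "I [^]\<^bsub>ideals_set R\<^esub> Suc n = ideal_prod R (I [^]\<^bsub>ideals_set R\<^esub> n) I"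
  by (simp_all add: ideals_set_def)

context cring
begin

lemma submodule_quotient_module_vimage:
  assumes "ideal I R" and N: "submodule N R (quotient_module R I)"
  shows "ideal {r \<in> carrier R. I +> r \<in> N} R" "I \<subseteq> {r \<in> carrier R. I +> r \<in> N}"
    "N = (+>) I ` {r \<in> carrier R. I +> r \<in> N}"
proof -
  interpret I: ideal I R by fact
  interpret \<pi>: ring_hom_ring R "R Quot I" "(+>) I" by (rule I.rcos_ring_hom_ring)
  interpret N: submodule N R "quotient_module R I" by fact
  have sub: "N \<subseteq> carrier (R Quot I)" and zero: "\<zero>\<^bsub>R Quot I\<^esub> \<in> N"
    and add: "\<And>x y. x \<in> N \<Longrightarrow> y \<in> N \<Longrightarrow> x \<oplus>\<^bsub>R Quot I\<^esub> y \<in> N"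
    and smult: "\<And>r x. r \<in> carrier R \<Longrightarrow> x \<in> N \<Longrightarrow> (I +> r) \<otimes>\<^bsub>R Quot I\<^esub> x \<in> N"
    using N.subset N.one_closed N.m_closed N.smult_closed by (auto simp: quotient_module_simps)
  let ?J = "{r \<in> carrier R. I +> r \<in> N}"
  have mult: "r \<otimes> x \<in> ?J" if "r \<in> carrier R" "x \<in> ?J" for r x
    using that smult by (simp add: \<pi>.hom_mult)
  show "ideal ?J R"
  proof (rule idealI)
    show "ring R" by (rule ring_axioms)
    show "subgroup ?J (add_monoid R)"
    proof (unfold_locales, goal_cases)
      case (2 x y)
      then show ?case using add by (simp add: \<pi>.hom_add)
    next
      case (4 x)
      have "\<ominus> x = (\<ominus> \<one>) \<otimes> x" using 4 by (simp add: l_minus)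
      then show ?case using mult[of "\<ominus> \<one>" x] 4 by (simp add: a_inv_def[symmetric])
    qed (use zero in auto)
    show "r \<otimes> x \<in> ?J" "x \<otimes> r \<in> ?J" if "x \<in> ?J" "r \<in> carrier R" for x r
      using mult[OF that(2,1)] that m_comm[of x r] by auto
  qed
  show "I \<subseteq> ?J"
  proof
    fix x assume x: "x \<in> I"
    have "I +> x = \<zero>\<^bsub>R Quot I\<^esub>"
      unfolding a_rcos_zero[OF assms(1) x] by (simp only: FactRing_def ring.select_convs)
    then show "x \<in> ?J" using x I.Icarr zero by simp
  qed
  show "N = (+>) I ` ?J"
  proof
    show "N \<subseteq> (+>) I ` ?J"
    proof
      fix x assume x: "x \<in> N"
      then have "x \<in> carrier (R Quot I)" using sub by blast
      then have "x \<in> a_rcosets I" by (simp only: FactRing_def partial_object.select_convs)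
      then obtain r where "r \<in> carrier R" "x = I +> r" unfolding A_RCOSETS_def' by blast
      with x show "x \<in> (+>) I ` ?J" by blast
    qed
  qed blast
qed

lemma submodule_quotient_module_image:
  assumes "ideal I R" "ideal J R"
  shows "submodule ((+>) I ` J) R (quotient_module R I)"
proof -
  interpret I: ideal I R by fact
  interpret J: ideal J R by fact
  interpret \<pi>: ring_hom_ring R "R Quot I" "(+>) I" by (rule I.rcos_ring_hom_ring)
  have neg: "inv\<^bsub>add_monoid (quotient_module R I)\<^esub> (I +> x) = I +> (\<ominus> x)" if "x \<in> J" for x
  proof -
    have "inv\<^bsub>add_monoid (quotient_module R I)\<^esub> (I +> x) = \<ominus>\<^bsub>R Quot I\<^esub> (I +> x)"
      by (simp add: a_inv_def m_inv_def quotient_module_simps)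
    then show ?thesis using that J.Icarr by simp
  qed
  show ?thesis
  proof (intro submodule.intro subgroup.intro submodule_axioms.intro, goal_cases)
    case 1
    then show ?case using J.Icarr by (auto simp: quotient_module_simps)
  next
    case (2 x y)
    then show ?case
      using J.Icarr by (auto simp: quotient_module_simps simp flip: \<pi>.hom_add)
  next
    case 3
    then show ?case
      using imageI[OF J.zero_closed, of "(+>) I"] \<pi>.hom_zero by (simp add: quotient_module_simps)
  next
    case (4 x)
    then obtain y where y: "y \<in> J" "x = I +> y" by blast
    show ?case unfolding y(2) neg[OF y(1)] using y by (intro imageI) simp
  next
    case (5 r x)
    then show ?case
      using J.Icarr J.I_l_closed by (auto simp: quotient_module_simps simp flip: \<pi>.hom_mult)
  qed
qed

lemma a_rcos_image_strict:
  assumes "ideal I R" "ideal J R" "ideal K R" "I \<subseteq> J" "J \<subset> K"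
  shows "(+>) I ` J \<subset> (+>) I ` K"
proof -
  interpret I: ideal I R by fact
  interpret J: ideal J R by fact
  interpret K: ideal K R by fact
  obtain x where x: "x \<in> K" "x \<notin> J" using assms by blast
  have "I +> x \<noteq> I +> y" if y: "y \<in> J" for y
  proof
    assume "I +> x = I +> y"
    then have "x \<ominus> y \<in> I"
      using quotient_eq_iff_same_a_r_cos[OF assms(1)] x y J.Icarr K.Icarr by simp
    then have "(x \<ominus> y) \<oplus> y \<in> J" using assms y by blast
    moreover have "(x \<ominus> y) \<oplus> y = x"
      using x y J.Icarr K.Icarr by (simp add: minus_eq a_assoc l_neg)
    ultimately show False using x by simp
  qed
  then show ?thesis using assms(5) x by blast
qed

text \<open>Submodules of the quotient correspond to ideals containing \<open>I\<close>, with strict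
  inclusions preserved in both directions. This removes cosets from the computation of
  lengths.\<close>

lemma module_length_quotient:
  assumes I: "ideal I R"
  shows "module_length R (quotient_module R I) =
    (SUP k \<in> {k. \<exists>J :: nat \<Rightarrow> 'a set. (\<forall>i\<le>k. ideal (J i) R \<and> I \<subseteq> J i) \<and> (\<forall>i<k. J i \<subset> J (Suc i))}.
      enat k)"
proof -
  have "(\<exists>N. (\<forall>i\<le>k. submodule (N i) R (quotient_module R I)) \<and> (\<forall>i<k. N i \<subset> N (Suc i))) \<longleftrightarrow>
    (\<exists>J. (\<forall>i\<le>k. ideal (J i) R \<and> I \<subseteq> J i) \<and> (\<forall>i<k. J i \<subset> J (Suc i)))" for k
  proof
    assume "\<exists>N. (\<forall>i\<le>k. submodule (N i) R (quotient_module R I)) \<and> (\<forall>i<k. N i \<subset> N (Suc i))"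
    then obtain N where N: "\<And>i. i \<le> k \<Longrightarrow> submodule (N i) R (quotient_module R I)"
      "\<And>i. i < k \<Longrightarrow> N i \<subset> N (Suc i)" by blast
    note v = submodule_quotient_module_vimage[OF I N(1)]
    have "{r \<in> carrier R. I +> r \<in> N i} \<subset> {r \<in> carrier R. I +> r \<in> N (Suc i)}" if "i < k" for i
      using N(2)[OF that] v(3)[of i] v(3)[of "Suc i"] that by auto
    then show "\<exists>J. (\<forall>i\<le>k. ideal (J i) R \<and> I \<subseteq> J i) \<and> (\<forall>i<k. J i \<subset> J (Suc i))"
      using v(1,2) by (intro exI[of _ "\<lambda>i. {r \<in> carrier R. I +> r \<in> N i}"]) blast
  next
    assume "\<exists>J. (\<forall>i\<le>k. ideal (J i) R \<and> I \<subseteq> J i) \<and> (\<forall>i<k. J i \<subset> J (Suc i))"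
    then obtain J where J: "\<And>i. i \<le> k \<Longrightarrow> ideal (J i) R \<and> I \<subseteq> J i" "\<And>i. i < k \<Longrightarrow> J i \<subset> J (Suc i)"
      by blast
    have "(+>) I ` J i \<subset> (+>) I ` J (Suc i)" if "i < k" for i
      using that J(1)[of i] J(1)[of "Suc i"] J(2)[of i] by (intro a_rcos_image_strict[OF I]) auto
    then show "\<exists>N. (\<forall>i\<le>k. submodule (N i) R (quotient_module R I)) \<and> (\<forall>i<k. N i \<subset> N (Suc i))"
      using submodule_quotient_module_image[OF I] J(1)
      by (intro exI[of _ "\<lambda>i. (+>) I ` J i"]) blast
  qed
  then show ?thesis by (simp add: module_length_def)
qed

lemma ideals_pow_ideal: "ideal I R \<Longrightarrow> ideal (I [^]\<^bsub>ideals_set R\<^esub> (n :: nat)) R"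
  by (induction n) (simp_all add: ideals_one ideals_mult oneideal ideal_prod_is_ideal)

lemma ideals_pow_antimono:
  assumes "ideal I R" "m \<le> n"
  shows "I [^]\<^bsub>ideals_set R\<^esub> n \<subseteq> I [^]\<^bsub>ideals_set R\<^esub> (m :: nat)"
  using assms(2)
proof (induction n rule: dec_induct)
  case (step n)
  have "I [^]\<^bsub>ideals_set R\<^esub> Suc n \<subseteq> I [^]\<^bsub>ideals_set R\<^esub> n"
    unfolding ideals_pow_Suc
    using ideal_prod_inter[OF ideals_pow_ideal[OF assms(1)] assms(1)] by blast
  then show ?case using step.IH by blast
qed simp

lemma ideals_pow_mono:
  assumes "I \<subseteq> J"
  shows "I [^]\<^bsub>ideals_set R\<^esub> (n :: nat) \<subseteq> J [^]\<^bsub>ideals_set R\<^esub> n"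
proof (induction n)
  case (Suc n)
  have "x \<in> ideal_prod R (J [^]\<^bsub>ideals_set R\<^esub> n) J"
    if "x \<in> ideal_prod R (I [^]\<^bsub>ideals_set R\<^esub> n) I" for x
    using that by induction (use Suc assms in \<open>auto intro: ideal_prod.intros\<close>)
  then show ?case by (auto simp: ideals_mult)
qed (simp add: ideals_one)

end

context local_fraction_hom
begin

text \<open>Products of fractions are fractions of products. Together with
  \<open>pow_subset_contr\<close> this identifies the powers of the maximal ideal with the
  extensions of the powers of \<open>Q\<close>.\<close>

lemma max_ideal_pow_subset_ext:
  "ext Q [^]\<^bsub>ideals_set T\<^esub> (n :: nat) \<subseteq> ext (Q [^]\<^bsub>ideals_set S\<^esub> n)"
proof (induction n)
  case 0
  have "ideal (carrier S) S" by (rule S.oneideal)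
  have "t \<in> ext (carrier S)" if "t \<in> carrier T" for t
    using denominators[OF that] that by (auto simp: ext_def)
  then show ?case by (auto simp: ideals_one)
next
  case (Suc n)
  have "x \<in> ext (Q [^]\<^bsub>ideals_set S\<^esub> Suc n)"
    if "x \<in> ideal_prod T (ext Q [^]\<^bsub>ideals_set T\<^esub> n) (ext Q)" for x
    using that
  proof induction
    case (prod i j)
    have "i \<in> ext (Q [^]\<^bsub>ideals_set S\<^esub> n)" using prod Suc by blast
    then obtain s u where s: "s \<in> Q [^]\<^bsub>ideals_set S\<^esub> n" "u \<in> carrier S - Q" "h u \<otimes>\<^bsub>T\<^esub> i = h s"
      and i: "i \<in> carrier T" by (auto simp: ext_def)
    obtain t v where t: "t \<in> Q" "v \<in> carrier S - Q" "h v \<otimes>\<^bsub>T\<^esub> j = h t"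
      and j: "j \<in> carrier T" using prod by (auto simp: ext_def)
    have c: "s \<in> carrier S" "t \<in> carrier S"
      using s t idealD(1)[OF S.ideals_pow_ideal[OF Q.is_ideal]] Q.Icarr by auto
    have "h (u \<otimes> v) \<otimes>\<^bsub>T\<^esub> (i \<otimes>\<^bsub>T\<^esub> j) = (h u \<otimes>\<^bsub>T\<^esub> i) \<otimes>\<^bsub>T\<^esub> (h v \<otimes>\<^bsub>T\<^esub> j)"
      using s(2) t(2) i j by (simp add: T.m_ac)
    also have "\<dots> = h (s \<otimes> t)" using c unfolding s(3) t(3) by simp
    finally have "\<exists>s\<in>ideal_prod S (Q [^]\<^bsub>ideals_set S\<^esub> n) Q. \<exists>u\<in>carrier S - Q.
        h u \<otimes>\<^bsub>T\<^esub> (i \<otimes>\<^bsub>T\<^esub> j) = h s"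
      using Q.compl_mult[OF s(2) t(2)] ideal_prod.prod[OF s(1) t(1), of S] by blast
    moreover have "i \<otimes>\<^bsub>T\<^esub> j \<in> carrier T" using i j by simp
    ultimately show ?case unfolding ext_def ideals_pow_Suc by (intro CollectI conjI)
  next
    case (sum s1 s2)
    have "ideal (ext (Q [^]\<^bsub>ideals_set S\<^esub> Suc n)) T"
      by (intro ext_ideal S.ideals_pow_ideal Q.is_ideal)
    from additive_subgroup.a_closed[OF ideal.axioms(1)[OF this] sum.IH] show ?case .
  qed
  then show ?case by (auto simp: ideals_mult)
qed

lemma pow_subset_contr:
  "Q [^]\<^bsub>ideals_set S\<^esub> (n :: nat) \<subseteq> contr (ext Q [^]\<^bsub>ideals_set T\<^esub> n)"
proof (induction n)
  case 0
  then show ?case by (auto simp: ideals_one contr_def)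
next
  case (Suc n)
  have QI: "ideal (ext Q [^]\<^bsub>ideals_set T\<^esub> m) T" for m :: nat
    by (intro T.ideals_pow_ideal ext_ideal Q.is_ideal)
  have "x \<in> contr (ext Q [^]\<^bsub>ideals_set T\<^esub> Suc n)"
    if "x \<in> ideal_prod S (Q [^]\<^bsub>ideals_set S\<^esub> n) Q" for x
    using that
  proof induction
    case (prod i j)
    have "h i \<in> ext Q [^]\<^bsub>ideals_set T\<^esub> n" "i \<in> carrier S" using prod Suc by (auto simp: contr_def)
    moreover have "h j \<in> ext Q" "j \<in> carrier S"
      using prod contr_ext_prime Q.Icarr by (auto simp: contr_def)
    ultimately show ?case
      using ideal_prod.prod[of "h i" _ "h j" "ext Q" T] by (simp add: contr_def ideals_mult)
  next
    case (sum s1 s2)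
    then show ?case
      using additive_subgroup.a_closed[OF ideal.axioms(1)[OF QI[of "Suc n"]]]
      by (simp add: contr_def)
  qed
  then show ?case by (auto simp: ideals_mult)
qed

text \<open>A version of the Jordan-Hoelder theorem: the length can be read off from any chain with
  simple factors. A second chain \<open>K\<close> is bounded by the number of the factors of \<open>J\<close> that are met
  by the members of \<open>K\<close>, since this number grows in every step.\<close>

theorem hilbert_samuel_eq:
  fixes J :: "nat \<Rightarrow> 'a set" and N l :: nat
  assumes ideals: "\<And>i. i \<le> N \<Longrightarrow> ideal (J i) S" "\<And>i. i \<le> N \<Longrightarrow> saturated (J i)"
    and strict: "\<And>i. i < N \<Longrightarrow> J i \<subset> J (Suc i)"
    and top: "J N = carrier S"
    and bot: "Q [^]\<^bsub>ideals_set S\<^esub> (l + 1) \<subseteq> J 0" "{s \<in> carrier S. h s = \<zero>\<^bsub>T\<^esub>} \<subseteq> J 0"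
    and least: "\<And>K. ideal K S \<Longrightarrow> saturated K \<Longrightarrow> Q [^]\<^bsub>ideals_set S\<^esub> (l + 1) \<subseteq> K \<Longrightarrow>
      {s \<in> carrier S. h s = \<zero>\<^bsub>T\<^esub>} \<subseteq> K \<Longrightarrow> J 0 \<subseteq> K"
    and simple: "\<And>i s t. i < N \<Longrightarrow> s \<in> J (Suc i) \<Longrightarrow> t \<in> J (Suc i) \<Longrightarrow> t \<notin> J i \<Longrightarrow>
      \<exists>u\<in>carrier S - Q. \<exists>v\<in>carrier S. u \<otimes> s \<ominus> v \<otimes> t \<in> J i"
  shows "hilbert_samuel T l = enat N"
proof -
  let ?M = "ext Q [^]\<^bsub>ideals_set T\<^esub> (l + 1)"
  let ?C = "{k. \<exists>I. (\<forall>i\<le>k. ideal (I i) T \<and> ?M \<subseteq> I i) \<and> (\<forall>i<k. I i \<subset> I (Suc i))}"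
  have M: "ideal ?M T" by (intro T.ideals_pow_ideal ext_ideal Q.is_ideal)
  have hs: "hilbert_samuel T l = (SUP k\<in>?C. enat k)"
    unfolding hilbert_samuel_def max_ideal_eq T.module_length_quotient[OF M] by simp
  have J_mono: "J i \<subseteq> J j" if "i \<le> j" "j \<le> N" for i j
    using that
  proof (induction j rule: dec_induct)
    case (step n)
    then show ?case using strict[of n] by auto
  qed simp
  have J0: "J 0 \<subseteq> J i" if "i \<le> N" for i using J_mono that by simp
  have ker: "{s \<in> carrier S. h s = \<zero>\<^bsub>T\<^esub>} \<subseteq> J i" if "i \<le> N" for i using J0[OF that] bot by blast
  have ce: "contr (ext (J i)) = J i" if "i \<le> N" for i
    using contr_ext[OF ideals(1,2) ker] that by blast
  \<comment> \<open>The given chain itself, extended to \<open>T\<close>; it stays strict because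
    contraction recovers each \<open>J i\<close>.\<close>
  have "N \<in> ?C"
  proof -
    have "ideal (ext (J i)) T" "?M \<subseteq> ext (J i)" if "i \<le> N" for i
    proof -
      show "ideal (ext (J i)) T" using ext_ideal ideals that by blast
      have "ext (Q [^]\<^bsub>ideals_set S\<^esub> (l + 1)) \<subseteq> ext (J i)"
        using order_trans[OF bot(1) J0[OF that]] by (auto simp: ext_def simp del: nat_pow_Suc)
      then show "?M \<subseteq> ext (J i)" using max_ideal_pow_subset_ext by (rule order_trans[rotated])
    qed
    moreover have "ext (J i) \<subset> ext (J (Suc i))" if "i < N" for i
    proof
      show "ext (J i) \<subseteq> ext (J (Suc i))" using strict[OF that] unfolding ext_def by blast
      show "ext (J i) \<noteq> ext (J (Suc i))"
      proof
        assume "ext (J i) = ext (J (Suc i))"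
        then have "contr (ext (J i)) = contr (ext (J (Suc i)))" by (rule arg_cong)
        then show False using ce[of i] ce[of "Suc i"] strict[OF that] that by simp
      qed
    qed
    ultimately show ?thesis by (intro CollectI exI[of _ "\<lambda>i. ext (J i)"]) simp
  qed
  moreover have "k \<le> N" if "k \<in> ?C" for k
  proof -
    obtain I where I: "\<And>i. i \<le> k \<Longrightarrow> ideal (I i) T" "\<And>i. i \<le> k \<Longrightarrow> ?M \<subseteq> I i"
      "\<And>i. i < k \<Longrightarrow> I i \<subset> I (Suc i)" using \<open>k \<in> ?C\<close> by blast
    define K where "K = (\<lambda>i. contr (I i))"
    \<comment> \<open>The indices of the factors of \<open>J (Suc j)\<close> modulo
      \<open>J j\<close> in which \<open>K i\<close> has a nonzero image.\<close>
    define D where "D = (\<lambda>i. {j. j < N \<and> \<not> K i \<inter> J (Suc j) \<subseteq> J j})"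
    have K: "ideal (K i) S" "saturated (K i)" "J 0 \<subseteq> K i" if "i \<le> k" for i
    proof -
      show 1: "ideal (K i) S" "saturated (K i)"
        using contr_ideal contr_saturated I(1)[OF that] by (auto simp: K_def)
      have "Q [^]\<^bsub>ideals_set S\<^esub> (l + 1) \<subseteq> K i"
        using pow_subset_contr[of "l + 1"] I(2)[OF that] unfolding K_def contr_def
        by (auto simp del: nat_pow_Suc)
      moreover have "{s \<in> carrier S. h s = \<zero>\<^bsub>T\<^esub>} \<subseteq> K i"
        using additive_subgroup.zero_closed[OF ideal.axioms(1)[OF I(1)[OF that]]]
        by (auto simp: K_def contr_def)
      ultimately show "J 0 \<subseteq> K i" by (rule least[OF 1])
    qed
    have K_strict: "K i \<subset> K (Suc i)" if "i < k" for i
    proof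
      show "K i \<subseteq> K (Suc i)" using I(3)[OF that] by (auto simp: K_def contr_def)
      show "K i \<noteq> K (Suc i)"
      proof
        assume "K i = K (Suc i)"
        then have "ext (K i) = ext (K (Suc i))" by (rule arg_cong)
        then show False
          using ext_contr[OF I(1), of i] ext_contr[OF I(1), of "Suc i"] I(3)[OF that] that
          by (simp add: K_def)
      qed
    qed
    have D_strict: "D i \<subset> D (Suc i)" if i: "i < k" for i
    proof -
      note Ki = idealD[OF K(1)[of i]] and Ks = idealD[OF K(1)[of "Suc i"]]
      obtain s0 where s0: "s0 \<in> K (Suc i)" "s0 \<notin> K i" using K_strict[OF i] by blast
      \<comment> \<open>The least such index is where the chain \<open>J\<close> first sees an
        element of \<open>K (Suc i)\<close> that is not in \<open>K i\<close>. The factor just below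
        it is met by \<open>K (Suc i)\<close> but not by \<open>K i\<close>.\<close>
      let ?P = "\<lambda>j. j \<le> N \<and> (\<exists>s \<in> K (Suc i) \<inter> J j. s \<notin> K i)"
      define j where "j = (LEAST j. ?P j)"
      have "?P N" using s0 Ks(1) i top by auto
      then have j: "?P j" unfolding j_def by (rule LeastI)
      have min: "K (Suc i) \<inter> J m \<subseteq> K i" if "m < j" for m
      proof -
        have "m \<le> N" using j that by simp
        then show ?thesis using not_less_Least[of m ?P] that unfolding j_def by blast
      qed
      have "j \<noteq> 0" using j K(3)[of i] i by (intro notI) auto
      then obtain m where m: "j = Suc m" using not0_implies_Suc by blast
      obtain s where s: "s \<in> K (Suc i)" "s \<in> J (Suc m)" "s \<notin> K i" using j m by blast
      have mN: "m < N" using j m by simp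
      have "s \<notin> J m" using min[of m] s m by blast
      then have "m \<in> D (Suc i)" using s mN by (auto simp: D_def)
      moreover have "m \<notin> D i"
      proof
        assume "m \<in> D i"
        then obtain t where t: "t \<in> K i" "t \<in> J (Suc m)" "t \<notin> J m" by (auto simp: D_def)
        \<comment> \<open>If \<open>K i\<close> met this factor too, a multiple of \<open>t\<close>
          would cancel \<open>u \<otimes> s\<close> modulo \<open>J m\<close>. The difference is in
          \<open>K i\<close> by the minimality of \<open>j\<close>, so \<open>u \<otimes> s\<close>
          and by saturation \<open>s\<close> would be in \<open>K i\<close>.\<close>
        obtain u v where u: "u \<in> carrier S - Q" "v \<in> carrier S" "u \<otimes> s \<ominus> v \<otimes> t \<in> J m"
          using simple[OF mN s(2) t(2,3)] by blast
        have c: "s \<in> carrier S" "t \<in> carrier S" using s t Ki(1) Ks(1) i by auto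
        have vt: "v \<otimes> t \<in> K i" using Ki(3) t u i by simp
        then have "v \<otimes> t \<in> K (Suc i)" using K_strict[OF i] by blast
        moreover have "u \<otimes> s \<in> K (Suc i)" using Ks(3) s u i by simp
        ultimately have "u \<otimes> s \<ominus> v \<otimes> t \<in> K (Suc i)" using Ks(6) i by simp
        then have "u \<otimes> s \<ominus> v \<otimes> t \<in> K i" using u(3) min[of m] m by auto
        then have "(u \<otimes> s \<ominus> v \<otimes> t) \<oplus> v \<otimes> t \<in> K i" using Ki(2) vt i by simp
        moreover have "(u \<otimes> s \<ominus> v \<otimes> t) \<oplus> v \<otimes> t = u \<otimes> s"
          using u c by (simp add: S.minus_eq S.a_assoc S.l_neg)
        ultimately have "s \<in> K i" using K(2)[of i] i u(1) c by (auto intro: saturatedD)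
        then show False using s by simp
      qed
      moreover have "D i \<subseteq> D (Suc i)" using K_strict[OF i] by (auto simp: D_def)
      ultimately show ?thesis by blast
    qed
    have fin: "finite (D i)" for i by (simp add: D_def)
    have "i \<le> card (D i)" if "i \<le> k" for i
      using that
    proof (induction i)
      case (Suc i)
      then show ?case using psubset_card_mono[OF fin D_strict[of i]] by simp
    qed simp
    from this[of k] have "k \<le> card (D k)" by simp
    also have "\<dots> \<le> card {..<N}" by (rule card_mono) (auto simp: D_def)
    finally show "k \<le> N" by simp
  qed
  ultimately show ?thesis
    unfolding hs by (intro antisym SUP_least SUP_upper) auto
qed

end

section \<open>Monoid rings with integer coefficients\<close>

lemma finsum_int_ring: "finsum \<Z> h Y = sum h Y"
proof (induction Y rule: infinite_finite_induct)
  case (infinite Y)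
  then show ?case by (simp add: finsum_def finprod_def)
next
  case empty
  show ?case
    using abelian_monoid.finsum_empty[OF abelian_group.axioms(1)[OF ring.axioms(1)
        [OF cring.axioms(1)[OF int_is_cring]]]] by simp
next
  case (insert x Y)
  show ?case
    using insert abelian_monoid.finsum_insert[OF abelian_group.axioms(1)[OF ring.axioms(1)
        [OF cring.axioms(1)[OF int_is_cring]]], of Y x h] by auto
qed

definition supp :: "('a, 'm) pointed_monoid_scheme \<Rightarrow> ('a \<Rightarrow> int) \<Rightarrow> 'a set" where
  "supp A f = {a \<in> nonzero A. f a \<noteq> 0}"

lemma monoid_ring_carrier:
  "f \<in> carrier (monoid_ring \<Z> A) \<longleftrightarrow> f \<in> extensional (nonzero A) \<and> finite (supp A f)"
  by (auto simp: monoid_ring_def supp_def PiE_def)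

lemma monoid_ring_zero: "\<zero>\<^bsub>monoid_ring \<Z> A\<^esub> = (\<lambda>a\<in>nonzero A. 0)"
  by (simp add: monoid_ring_def)

lemma monoid_ring_one: "\<one>\<^bsub>monoid_ring \<Z> A\<^esub> = monoid_term \<Z> A 1 \<one>\<^bsub>A\<^esub>"
  by (simp add: monoid_ring_def)

lemma monoid_ring_add: "f \<oplus>\<^bsub>monoid_ring \<Z> A\<^esub> g = (\<lambda>a\<in>nonzero A. f a + g a)"
  by (simp add: monoid_ring_def)

text \<open>The convolution is summed over arbitrary finite sets containing the supports, so that
  functions with different supports can be treated over a common index set.\<close>

lemma monoid_ring_mult:
  assumes "finite F" "supp A f \<subseteq> F" "F \<subseteq> nonzero A"
    and "finite G" "supp A g \<subseteq> G" "G \<subseteq> nonzero A"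
  shows "f \<otimes>\<^bsub>monoid_ring \<Z> A\<^esub> g =
    (\<lambda>c\<in>nonzero A. \<Sum>a\<in>F. \<Sum>b\<in>G. if a \<otimes>\<^bsub>A\<^esub> b = c then f a * g b else 0)"
proof -
  have "(\<Sum>(a, b)\<in>{(a, b). a \<in> nonzero A \<and> b \<in> nonzero A \<and> f a \<noteq> 0 \<and> g b \<noteq> 0 \<and> a \<otimes>\<^bsub>A\<^esub> b = c}.
       f a * g b) = (\<Sum>a\<in>F. \<Sum>b\<in>G. if a \<otimes>\<^bsub>A\<^esub> b = c then f a * g b else 0)" for c
  proof -
    have "(\<Sum>a\<in>F. \<Sum>b\<in>G. if a \<otimes>\<^bsub>A\<^esub> b = c then f a * g b else 0)
      = (\<Sum>(a, b)\<in>F \<times> G. if a \<otimes>\<^bsub>A\<^esub> b = c then f a * g b else 0)"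
      by (simp add: sum.cartesian_product)
    also have "\<dots> = (\<Sum>(a, b)\<in>{(a, b). a \<in> nonzero A \<and> b \<in> nonzero A \<and> f a \<noteq> 0 \<and> g b \<noteq> 0
        \<and> a \<otimes>\<^bsub>A\<^esub> b = c}. f a * g b)"
      using assms by (intro sum.mono_neutral_cong_right) (auto simp: supp_def)
    finally show ?thesis ..
  qed
  then show ?thesis
    unfolding monoid_ring_def by (auto simp: finsum_int_ring intro!: restrict_ext)
qed

definition single :: "('a, 'm) pointed_monoid_scheme \<Rightarrow> 'a \<Rightarrow> 'a \<Rightarrow> int" where
  "single A a = monoid_term \<Z> A 1 a"

lemma single_apply: "single A a b = (if b \<in> nonzero A then if b = a then 1 else 0 else undefined)"
  by (simp add: single_def monoid_term_def)

lemma supp_single: "supp A (single A a) \<subseteq> {a} \<inter> nonzero A"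
  by (auto simp: supp_def single_apply split: if_splits)

lemma single_closed: "single A a \<in> carrier (monoid_ring \<Z> A)"
  using supp_single[of A a] finite_subset
  by (fastforce simp: monoid_ring_carrier single_def monoid_term_def)

lemma single_pzero: "single A (pzero A) = \<zero>\<^bsub>monoid_ring \<Z> A\<^esub>"
  by (auto simp: single_def monoid_term_def monoid_ring_zero nonzero_def)

lemma abelian_group_monoid_ring: "abelian_group (monoid_ring \<Z> A)"
proof (rule abelian_groupI)
  fix f g assume fg: "f \<in> carrier (monoid_ring \<Z> A)" "g \<in> carrier (monoid_ring \<Z> A)"
  have "supp A (\<lambda>a\<in>nonzero A. f a + g a) \<subseteq> supp A f \<union> supp A g"
    by (auto simp: supp_def)
  then show "f \<oplus>\<^bsub>monoid_ring \<Z> A\<^esub> g \<in> carrier (monoid_ring \<Z> A)"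
    using fg finite_subset by (auto simp: monoid_ring_carrier monoid_ring_add)
  show "f \<oplus>\<^bsub>monoid_ring \<Z> A\<^esub> g = g \<oplus>\<^bsub>monoid_ring \<Z> A\<^esub> f"
    by (simp add: monoid_ring_add add.commute)
next
  fix f assume f: "f \<in> carrier (monoid_ring \<Z> A)"
  then show "\<zero>\<^bsub>monoid_ring \<Z> A\<^esub> \<oplus>\<^bsub>monoid_ring \<Z> A\<^esub> f = f"
    by (auto simp: monoid_ring_add monoid_ring_zero monoid_ring_carrier extensional_def fun_eq_iff)
  have "supp A (\<lambda>a\<in>nonzero A. - f a) = supp A f"
    by (auto simp: supp_def)
  then have "(\<lambda>a\<in>nonzero A. - f a) \<in> carrier (monoid_ring \<Z> A)"
    using f by (simp add: monoid_ring_carrier)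
  then show "\<exists>g\<in>carrier (monoid_ring \<Z> A). g \<oplus>\<^bsub>monoid_ring \<Z> A\<^esub> f = \<zero>\<^bsub>monoid_ring \<Z> A\<^esub>"
    by (rule bexI[rotated]) (auto simp: monoid_ring_add monoid_ring_zero)
qed (auto simp: monoid_ring_add monoid_ring_zero monoid_ring_carrier add.assoc supp_def)

text \<open>Serves as an induction principle: a property that is additive in \<open>f\<close> has to
  be checked on monoid elements only. Integer multiples of a basis element are reached by steps in
  both directions, general elements by removing one point of the support at a time.\<close>

lemma additive_subgroup_monoid_ring_eq:
  assumes "additive_subgroup H (monoid_ring \<Z> A)"
    and single: "\<And>a. a \<in> nonzero A \<Longrightarrow> single A a \<in> H"
    and f: "f \<in> carrier (monoid_ring \<Z> A)"
  shows "f \<in> H"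
proof -
  let ?S = "monoid_ring \<Z> A"
  interpret abelian_group ?S by (rule abelian_group_monoid_ring)
  interpret additive_subgroup H ?S by fact
  have scale: "(\<lambda>b\<in>nonzero A. if b = a then c else 0) \<in> H" if a: "a \<in> nonzero A" for a and c :: int
  proof (induction c rule: int_induct[where k=0])
    case base
    then show ?case using zero_closed by (simp add: monoid_ring_zero restrict_def cong: if_cong)
  next
    case (step1 c)
    have "(\<lambda>b\<in>nonzero A. if b = a then c + 1 else 0) =
      (\<lambda>b\<in>nonzero A. if b = a then c else 0) \<oplus>\<^bsub>?S\<^esub> single A a"
      by (auto simp: monoid_ring_add single_apply fun_eq_iff)
    then show ?case using a_closed[OF step1(2) single[OF a]] by metis
  next
    case (step2 c)
    have e: "(\<lambda>b\<in>nonzero A. if b = a then c - 1 else 0) \<oplus>\<^bsub>?S\<^esub> single A a =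
      (\<lambda>b\<in>nonzero A. if b = a then c else 0)"
      by (auto simp: monoid_ring_add single_apply fun_eq_iff)
    have "supp A (\<lambda>b\<in>nonzero A. if b = a then c - 1 else 0) \<subseteq> {a}"
      by (auto simp: supp_def split: if_splits)
    then have "(\<lambda>b\<in>nonzero A. if b = a then c - 1 else 0) \<in> carrier ?S"
      using finite_subset by (auto simp: monoid_ring_carrier)
    then have "(\<lambda>b\<in>nonzero A. if b = a then c - 1 else 0) =
        (\<lambda>b\<in>nonzero A. if b = a then c else 0) \<ominus>\<^bsub>?S\<^esub> single A a"
      unfolding e[symmetric] by (simp add: a_minus_def a_assoc r_neg single_closed)
    then show ?case using a_closed[OF step2(2) a_inv_closed[OF single[OF a]]]
      by (metis a_minus_def)
  qed
  have "f \<in> H" if "finite Y" "supp A f \<subseteq> Y" "f \<in> carrier ?S" for Y f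
    using that
  proof (induction Y arbitrary: f rule: finite_induct)
    case empty
    then have "f = \<zero>\<^bsub>?S\<^esub>"
      by (auto simp: supp_def monoid_ring_zero monoid_ring_carrier extensional_def fun_eq_iff)
    then show ?case by simp
  next
    case (insert x Y)
    show ?case
    proof (cases "x \<in> nonzero A")
      case True
      let ?g = "\<lambda>b\<in>nonzero A. if b = x then 0 else f b"
      have "supp A ?g \<subseteq> Y" using insert.prems by (auto simp: supp_def split: if_splits)
      moreover from this have "?g \<in> carrier ?S"
        using insert.hyps finite_subset by (auto simp: monoid_ring_carrier)
      ultimately have "?g \<in> H" by (rule insert.IH)
      moreover have "f = ?g \<oplus>\<^bsub>?S\<^esub> (\<lambda>b\<in>nonzero A. if b = x then f x else 0)"
        using insert.prems
        by (auto simp: monoid_ring_add monoid_ring_carrier extensional_def fun_eq_iff)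
      ultimately show ?thesis using a_closed[OF _ scale[OF True, of "f x"]] by fastforce
    next
      case False
      then have "supp A f \<subseteq> Y" using insert.prems by (auto simp: supp_def)
      then show ?thesis using insert by blast
    qed
  qed
  with f show ?thesis by (auto simp: monoid_ring_carrier)
qed

lemma group_hom_addI:
  assumes "abelian_group R" "abelian_group S"
    and "\<And>x. x \<in> carrier R \<Longrightarrow> h x \<in> carrier S"
    and "\<And>x y. x \<in> carrier R \<Longrightarrow> y \<in> carrier R \<Longrightarrow> h (x \<oplus>\<^bsub>R\<^esub> y) = h x \<oplus>\<^bsub>S\<^esub> h y"
  shows "group_hom (add_monoid R) (add_monoid S) h"
  using assms by (intro group_hom.intro group_hom_axioms.intro)
    (auto simp: hom_def abelian_group.a_group)

text \<open>The two maps agree on a subgroup, which contains all basis elements. Identities that are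
  additive in each argument are reduced to the monoid in this way.\<close>

lemma additive_ext_monoid_ring:
  assumes T: "abelian_group T"
    and h: "\<And>f. f \<in> carrier (monoid_ring \<Z> A) \<Longrightarrow> h f \<in> carrier T"
      "\<And>f g. f \<in> carrier (monoid_ring \<Z> A) \<Longrightarrow> g \<in> carrier (monoid_ring \<Z> A) \<Longrightarrow>
        h (f \<oplus>\<^bsub>monoid_ring \<Z> A\<^esub> g) = h f \<oplus>\<^bsub>T\<^esub> h g"
    and h': "\<And>f. f \<in> carrier (monoid_ring \<Z> A) \<Longrightarrow> h' f \<in> carrier T"
      "\<And>f g. f \<in> carrier (monoid_ring \<Z> A) \<Longrightarrow> g \<in> carrier (monoid_ring \<Z> A) \<Longrightarrow>
        h' (f \<oplus>\<^bsub>monoid_ring \<Z> A\<^esub> g) = h' f \<oplus>\<^bsub>T\<^esub> h' g"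
    and eq: "\<And>a. a \<in> nonzero A \<Longrightarrow> h (single A a) = h' (single A a)"
    and f: "f \<in> carrier (monoid_ring \<Z> A)"
  shows "h f = h' f"
proof -
  let ?S = "monoid_ring \<Z> A"
  interpret abelian_group ?S by (rule abelian_group_monoid_ring)
  interpret h: group_hom "add_monoid ?S" "add_monoid T" h
    by (intro group_hom_addI abelian_group_axioms T h)
  interpret h': group_hom "add_monoid ?S" "add_monoid T" h'
    by (intro group_hom_addI abelian_group_axioms T h')
  let ?H = "{f \<in> carrier ?S. h f = h' f}"
  have "subgroup ?H (add_monoid ?S)"
  proof (unfold_locales, goal_cases)
    case (2 x y)
    then show ?case using h.hom_mult[of x y] h'.hom_mult[of x y] by auto
  next
    case 3
    then show ?case using h.hom_one h'.hom_one by auto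
  next
    case (4 x)
    then show ?case using h.hom_inv[of x] h'.hom_inv[of x] add.inv_closed[of x] by (auto simp: a_inv_def)
  qed auto
  then have "additive_subgroup ?H ?S" by (rule additive_subgroup.intro)
  from additive_subgroup_monoid_ring_eq[OF this _ f] show ?thesis
    using eq by (auto simp: single_closed)
qed

section \<open>Linear functionals on a monoid ring\<close>

definition lin :: "('a, 'm) pointed_monoid_scheme \<Rightarrow> ('a \<Rightarrow> int) \<Rightarrow> ('a \<Rightarrow> int) \<Rightarrow> int" where
  "lin A w f = (\<Sum>a\<in>supp A f. f a * w a)"

lemma lin_superset:
  assumes "finite F" "supp A f \<subseteq> F" "F \<subseteq> nonzero A"
  shows "lin A w f = (\<Sum>a\<in>F. f a * w a)"
  unfolding lin_def using assms by (intro sum.mono_neutral_left) (auto simp: supp_def)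

lemma lin_add:
  assumes "f \<in> carrier (monoid_ring \<Z> A)" "g \<in> carrier (monoid_ring \<Z> A)"
  shows "lin A w (f \<oplus>\<^bsub>monoid_ring \<Z> A\<^esub> g) = lin A w f + lin A w g"
proof -
  have F: "finite (supp A f \<union> supp A g)" "supp A f \<union> supp A g \<subseteq> nonzero A"
    using assms by (auto simp: monoid_ring_carrier supp_def)
  have s: "supp A (f \<oplus>\<^bsub>monoid_ring \<Z> A\<^esub> g) \<subseteq> supp A f \<union> supp A g"
    by (auto simp: monoid_ring_add supp_def)
  show ?thesis
    unfolding lin_superset[OF F(1) s F(2)] lin_superset[OF F(1) Un_upper1 F(2)]
      lin_superset[OF F(1) Un_upper2 F(2)] sum.distrib[symmetric]
    using F(2) by (intro sum.cong) (auto simp: monoid_ring_add distrib_right)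
qed

lemma lin_single: "a \<in> nonzero A \<Longrightarrow> lin A w (single A a) = w a"
  using lin_superset[of "{a}" A "single A a" w] supp_single[of A a] by (simp add: single_apply)

lemma lin_zero: "lin A w \<zero>\<^bsub>monoid_ring \<Z> A\<^esub> = 0"
  by (simp add: lin_def supp_def monoid_ring_zero)

lemma lin_cong: "(\<And>a. a \<in> nonzero A \<Longrightarrow> w a = w' a) \<Longrightarrow> lin A w f = lin A w' f"
  unfolding lin_def by (intro sum.cong) (auto simp: supp_def)

lemma lin_sum_left: "lin A (\<lambda>a. \<Sum>i\<in>I. k i * w i a) f = (\<Sum>i\<in>I. k i * lin A (w i) f)"
  unfolding lin_def sum_distrib_left by (subst sum.swap) (simp add: ac_simps)

lemma lin_a_inv:
  assumes "f \<in> carrier (monoid_ring \<Z> A)"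
  shows "lin A w (\<ominus>\<^bsub>monoid_ring \<Z> A\<^esub> f) = - lin A w f"
proof -
  interpret abelian_group "monoid_ring \<Z> A" by (rule abelian_group_monoid_ring)
  have "lin A w (\<ominus>\<^bsub>monoid_ring \<Z> A\<^esub> f) + lin A w f = 0"
    using lin_add[OF a_inv_closed[OF assms] assms, of w] assms by (simp add: l_neg lin_zero)
  then show ?thesis by simp
qed

lemma lin_minus:
  assumes "f \<in> carrier (monoid_ring \<Z> A)" "g \<in> carrier (monoid_ring \<Z> A)"
  shows "lin A w (f \<ominus>\<^bsub>monoid_ring \<Z> A\<^esub> g) = lin A w f - lin A w g"
proof -
  interpret abelian_group "monoid_ring \<Z> A" by (rule abelian_group_monoid_ring)
  show ?thesis using assms by (simp add: a_minus_def lin_add lin_a_inv)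
qed

section \<open>The ring structure of a monoid ring\<close>

context pointed_comm_monoid
begin

lemma one_nonzero: "a \<in> nonzero A \<Longrightarrow> \<one> \<in> nonzero A"
  unfolding nonzero_def using pzero_absorbing[of a] r_one[of a] by (metis Diff_iff one_closed singletonD singletonI)

lemma monoid_ring_mult_closed:
  assumes f: "f \<in> carrier (monoid_ring \<Z> A)" and g: "g \<in> carrier (monoid_ring \<Z> A)"
  shows "f \<otimes>\<^bsub>monoid_ring \<Z> A\<^esub> g \<in> carrier (monoid_ring \<Z> A)"
proof -
  have F: "finite (supp A f)" "finite (supp A g)" "supp A f \<subseteq> nonzero A" "supp A g \<subseteq> nonzero A"
    using f g by (auto simp: monoid_ring_carrier supp_def)
  have "supp A (f \<otimes>\<^bsub>monoid_ring \<Z> A\<^esub> g) \<subseteq> (\<lambda>(a, b). a \<otimes> b) ` (supp A f \<times> supp A g)"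
  proof
    fix c assume "c \<in> supp A (f \<otimes>\<^bsub>monoid_ring \<Z> A\<^esub> g)"
    then have "(\<Sum>a\<in>supp A f. \<Sum>b\<in>supp A g. if a \<otimes> b = c then f a * g b else 0) \<noteq> 0"
      by (cases "c \<in> nonzero A") (simp_all add: supp_def[of _ "restrict _ _"]
          monoid_ring_mult[OF F(1) order_refl F(3) F(2) order_refl F(4)])
    then obtain a where a: "a \<in> supp A f" "(\<Sum>b\<in>supp A g. if a \<otimes> b = c then f a * g b else 0) \<noteq> 0"
      by (rule sum.not_neutral_contains_not_neutral)
    from a(2) obtain b where b: "b \<in> supp A g" "(if a \<otimes> b = c then f a * g b else 0) \<noteq> 0"
      by (rule sum.not_neutral_contains_not_neutral)
    have "a \<otimes> b = c" using b(2) by presburger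
    then show "c \<in> (\<lambda>(a, b). a \<otimes> b) ` (supp A f \<times> supp A g)"
      using a(1) b(1) by (intro image_eqI[of _ _ "(a, b)"]) auto
  qed
  then have "finite (supp A (f \<otimes>\<^bsub>monoid_ring \<Z> A\<^esub> g))"
    by (rule finite_subset) (use F in auto)
  then show ?thesis
    by (simp add: monoid_ring_carrier monoid_ring_mult[OF F(1) order_refl F(3) F(2) order_refl F(4)])
qed

lemma monoid_ring_m_comm:
  assumes f: "f \<in> carrier (monoid_ring \<Z> A)" and g: "g \<in> carrier (monoid_ring \<Z> A)"
  shows "f \<otimes>\<^bsub>monoid_ring \<Z> A\<^esub> g = g \<otimes>\<^bsub>monoid_ring \<Z> A\<^esub> f"
proof -
  have F: "finite (supp A f)" "finite (supp A g)" "supp A f \<subseteq> nonzero A" "supp A g \<subseteq> nonzero A"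
    using f g by (auto simp: monoid_ring_carrier supp_def)
  have "(\<Sum>a\<in>supp A f. \<Sum>b\<in>supp A g. if a \<otimes> b = c then f a * g b else 0) =
    (\<Sum>b\<in>supp A g. \<Sum>a\<in>supp A f. if b \<otimes> a = c then g b * f a else 0)" for c
    using F by (subst sum.swap) (auto intro!: sum.cong simp: nonzero_def m_comm subset_iff)
  then show ?thesis
    unfolding monoid_ring_mult[OF F(1) order_refl F(3) F(2) order_refl F(4)]
      monoid_ring_mult[OF F(2) order_refl F(4) F(1) order_refl F(3)] by simp
qed

lemma monoid_ring_l_distr:
  assumes f: "f \<in> carrier (monoid_ring \<Z> A)" and g: "g \<in> carrier (monoid_ring \<Z> A)"
    and h: "h \<in> carrier (monoid_ring \<Z> A)"
  shows "(f \<oplus>\<^bsub>monoid_ring \<Z> A\<^esub> g) \<otimes>\<^bsub>monoid_ring \<Z> A\<^esub> h =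
    f \<otimes>\<^bsub>monoid_ring \<Z> A\<^esub> h \<oplus>\<^bsub>monoid_ring \<Z> A\<^esub> g \<otimes>\<^bsub>monoid_ring \<Z> A\<^esub> h"
proof -
  let ?F = "supp A f \<union> supp A g" and ?G = "supp A h"
  have F: "finite ?F" "finite ?G" "?F \<subseteq> nonzero A" "?G \<subseteq> nonzero A"
    using f g h by (auto simp: monoid_ring_carrier supp_def)
  have s: "supp A (f \<oplus>\<^bsub>monoid_ring \<Z> A\<^esub> g) \<subseteq> ?F"
    by (auto simp: monoid_ring_add supp_def)
  have "(\<Sum>a\<in>?F. \<Sum>b\<in>?G. if a \<otimes> b = c then (f \<oplus>\<^bsub>monoid_ring \<Z> A\<^esub> g) a * h b else 0) =
    (\<Sum>a\<in>?F. \<Sum>b\<in>?G. if a \<otimes> b = c then f a * h b else 0) +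
    (\<Sum>a\<in>?F. \<Sum>b\<in>?G. if a \<otimes> b = c then g a * h b else 0)" for c
    unfolding sum.distrib[symmetric] using F
    by (intro sum.cong) (auto simp: distrib_right monoid_ring_add)
  then show ?thesis
    unfolding monoid_ring_mult[OF F(1) s F(3) F(2) order_refl F(4)]
      monoid_ring_mult[OF F(1) Un_upper1 F(3) F(2) order_refl F(4)]
      monoid_ring_mult[OF F(1) Un_upper2 F(3) F(2) order_refl F(4)]
    by (auto simp: monoid_ring_add[of _ "restrict _ _"] fun_eq_iff)
qed

lemma single_mult:
  assumes "a \<in> nonzero A" "b \<in> nonzero A"
  shows "single A a \<otimes>\<^bsub>monoid_ring \<Z> A\<^esub> single A b = single A (a \<otimes> b)"
proof -
  have "supp A (single A a) \<subseteq> {a}" "supp A (single A b) \<subseteq> {b}" "{a} \<subseteq> nonzero A" "{b} \<subseteq> nonzero A"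
    using supp_single[of A] assms by auto
  from monoid_ring_mult[OF _ this(1,3) _ this(2,4)] show ?thesis
    using assms by (auto simp: single_apply single_def monoid_term_def fun_eq_iff)
qed

text \<open>Associativity is additive in each of the three factors, so it is carried over from
  \<open>A\<close> one argument at a time, through \<open>s3\<close>, \<open>s2\<close> and
  \<open>s1\<close>.\<close>

lemma cring_monoid_ring: "cring (monoid_ring \<Z> A)"
proof (intro cringI comm_monoidI)
  let ?S = "monoid_ring \<Z> A"
  interpret S: abelian_group ?S by (rule abelian_group_monoid_ring)
  note closed = monoid_ring_mult_closed
  have r_distr: "h \<otimes>\<^bsub>?S\<^esub> (f \<oplus>\<^bsub>?S\<^esub> g) = h \<otimes>\<^bsub>?S\<^esub> f \<oplus>\<^bsub>?S\<^esub> h \<otimes>\<^bsub>?S\<^esub> g"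
    if "f \<in> carrier ?S" "g \<in> carrier ?S" "h \<in> carrier ?S" for f g h
    using monoid_ring_l_distr[OF that] that by (simp add: monoid_ring_m_comm)
  show one: "\<one>\<^bsub>?S\<^esub> \<in> carrier ?S"
    using single_closed[of A \<one>] by (simp add: monoid_ring_one single_def)
  show "\<one>\<^bsub>?S\<^esub> \<otimes>\<^bsub>?S\<^esub> f = f" if f: "f \<in> carrier ?S" for f
  proof (rule additive_ext_monoid_ring[where A = A and T = ?S, OF _ _ _ _ _ _ f])
    fix a assume a: "a \<in> nonzero A"
    then show "\<one>\<^bsub>?S\<^esub> \<otimes>\<^bsub>?S\<^esub> single A a = single A a"
      using single_mult[OF one_nonzero[OF a] a]
      by (auto simp: monoid_ring_one single_def nonzero_def)
  qed (auto simp: S.abelian_group_axioms closed one r_distr)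
  have s3: "(single A a \<otimes>\<^bsub>?S\<^esub> single A b) \<otimes>\<^bsub>?S\<^esub> single A c =
      single A a \<otimes>\<^bsub>?S\<^esub> (single A b \<otimes>\<^bsub>?S\<^esub> single A c)"
    if abc: "a \<in> nonzero A" "b \<in> nonzero A" "c \<in> nonzero A" for a b c
  proof -
    \<comment> \<open>Partial products may be the zero of \<open>A\<close>, so the product rule is
      needed on the whole carrier and not just for nonzero elements.\<close>
    have m: "single A x \<otimes>\<^bsub>?S\<^esub> single A y = single A (x \<otimes> y)" if "x \<in> carrier A" "y \<in> carrier A" for x y
    proof (cases "x = pzero A \<or> y = pzero A")
      case True
      have z: "\<zero>\<^bsub>?S\<^esub> \<otimes>\<^bsub>?S\<^esub> f = \<zero>\<^bsub>?S\<^esub>" if f: "f \<in> carrier ?S" for f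
      proof -
        let ?x = "\<zero>\<^bsub>?S\<^esub> \<otimes>\<^bsub>?S\<^esub> f"
        have x: "?x \<in> carrier ?S" using closed f by simp
        have "?x = ?x \<oplus>\<^bsub>?S\<^esub> ?x"
          using monoid_ring_l_distr[of "\<zero>\<^bsub>?S\<^esub>" "\<zero>\<^bsub>?S\<^esub>" f] f by simp
        then show ?thesis using S.add.l_cancel_one'[OF x x] by simp
      qed
      have z': "single A v \<otimes>\<^bsub>?S\<^esub> \<zero>\<^bsub>?S\<^esub> = \<zero>\<^bsub>?S\<^esub>" for v
        using z[of "single A v"] monoid_ring_m_comm[of "single A v" "\<zero>\<^bsub>?S\<^esub>"]
        by (simp add: single_closed)
      from True show ?thesis
      proof
        assume "x = pzero A"
        then show ?thesis
          using z[OF single_closed] pzero_absorbing[of y] m_comm[of y "pzero A"] that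
          by (simp add: single_pzero pzero_closed)
      next
        assume "y = pzero A"
        then show ?thesis
          using z' pzero_absorbing[of x] that by (simp add: single_pzero)
      qed
    qed (use single_mult that in \<open>auto simp: nonzero_def\<close>)
    have "a \<in> carrier A" "b \<in> carrier A" "c \<in> carrier A"
      using abc by (auto simp: nonzero_def)
    then show ?thesis by (simp add: m m_assoc)
  qed
  have s2: "(single A a \<otimes>\<^bsub>?S\<^esub> single A b) \<otimes>\<^bsub>?S\<^esub> h = single A a \<otimes>\<^bsub>?S\<^esub> (single A b \<otimes>\<^bsub>?S\<^esub> h)"
    if ab: "a \<in> nonzero A" "b \<in> nonzero A" and h: "h \<in> carrier ?S" for a b h
    by (rule additive_ext_monoid_ring[where A = A and T = ?S, OF _ _ _ _ _ _ h])
      (auto intro!: s3 simp: S.abelian_group_axioms closed single_closed r_distr ab)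
  have s1: "(single A a \<otimes>\<^bsub>?S\<^esub> g) \<otimes>\<^bsub>?S\<^esub> h = single A a \<otimes>\<^bsub>?S\<^esub> (g \<otimes>\<^bsub>?S\<^esub> h)"
    if a: "a \<in> nonzero A" and g: "g \<in> carrier ?S" and h: "h \<in> carrier ?S" for a g h
    by (rule additive_ext_monoid_ring[where A = A and T = ?S, OF _ _ _ _ _ _ g])
      (auto intro!: s2 simp: S.abelian_group_axioms closed single_closed r_distr monoid_ring_l_distr a h)
  show "f \<otimes>\<^bsub>?S\<^esub> g \<otimes>\<^bsub>?S\<^esub> h = f \<otimes>\<^bsub>?S\<^esub> (g \<otimes>\<^bsub>?S\<^esub> h)"
    if f: "f \<in> carrier ?S" and g: "g \<in> carrier ?S" and h: "h \<in> carrier ?S" for f g h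
    by (rule additive_ext_monoid_ring[where A = A and T = ?S, OF _ _ _ _ _ _ f])
      (auto intro!: s1 simp: S.abelian_group_axioms closed single_closed r_distr monoid_ring_l_distr g h)
qed (auto simp: abelian_group_monoid_ring monoid_ring_mult_closed monoid_ring_m_comm
    monoid_ring_l_distr)

text \<open>Multiplication by a monoid element translates the functional. The value zero at
  \<open>pzero A\<close> accounts for the terms whose product vanishes.\<close>

lemma lin_single_mult:
  assumes "a \<in> nonzero A" "w (pzero A) = 0" and f: "f \<in> carrier (monoid_ring \<Z> A)"
  shows "lin A w (single A a \<otimes>\<^bsub>monoid_ring \<Z> A\<^esub> f) = lin A (\<lambda>b. w (a \<otimes> b)) f"
proof (rule additive_ext_monoid_ring[where A = A and T = \<Z>, OF _ _ _ _ _ _ f])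
  interpret S: cring "monoid_ring \<Z> A" by (rule cring_monoid_ring)
  show "lin A w (single A a \<otimes>\<^bsub>monoid_ring \<Z> A\<^esub> (g \<oplus>\<^bsub>monoid_ring \<Z> A\<^esub> h)) =
      lin A w (single A a \<otimes>\<^bsub>monoid_ring \<Z> A\<^esub> g) \<oplus>\<^bsub>\<Z>\<^esub> lin A w (single A a \<otimes>\<^bsub>monoid_ring \<Z> A\<^esub> h)"
    if "g \<in> carrier (monoid_ring \<Z> A)" "h \<in> carrier (monoid_ring \<Z> A)" for g h
    using that by (simp add: single_closed S.r_distr lin_add)
  show "lin A w (single A a \<otimes>\<^bsub>monoid_ring \<Z> A\<^esub> single A b) = lin A (\<lambda>b. w (a \<otimes> b)) (single A b)"
    if "b \<in> nonzero A" for b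
  proof (cases "a \<otimes> b = pzero A")
    case True
    then show ?thesis using assms that by (simp add: single_mult lin_single single_pzero lin_zero)
  next
    case False
    then have "a \<otimes> b \<in> nonzero A" using assms that by (auto simp: nonzero_def)
    then show ?thesis using assms that by (simp add: single_mult lin_single)
  qed
qed (use int_is_cring cring.axioms(1) ring.axioms(1) in \<open>auto simp: lin_add\<close>)

end

subsection \<open>Residue fields\<close>

text \<open>Allows the total space to be treated in the same way as a fibre.\<close>

lemma (in primeideal) fraction_hom_id:
  assumes "cring R"
  shows "fraction_hom R R I (\<lambda>x. x)" "fraction_hom.ext R R I (\<lambda>x. x) I = I"
proof -
  interpret cring R by fact
  show F: "fraction_hom R R I (\<lambda>x. x)"
  proof (intro fraction_hom.intro fraction_hom_axioms.intro)
    show "(\<lambda>x. x) \<in> ring_hom R R" by (rule ring_hom_memI) auto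
    show "\<exists>s\<in>carrier R. \<exists>u\<in>carrier R - I. u \<otimes> t = s" if "t \<in> carrier R" for t
      using compl_one that by (intro bexI[of _ t] bexI[of _ \<one>]) auto
  qed (simp_all add: cring_axioms primeideal_axioms)
  interpret F: fraction_hom R R I "\<lambda>x. x" by (rule F)
  show "F.ext I = I"
    by (rule F.prime_eq_ext[symmetric]) (auto simp: F.contr_def primeideal_axioms Icarr)
qed

lemma (in primeideal) local_fraction_hom_self:
  assumes "cring R"
  shows "local_fraction_hom R (localization R I) I (\<lambda>r. fraction R I r \<one>)"
  using local_fraction_hom_localization[OF fraction_hom_id(1)[OF assms]]
  by (simp add: fraction_hom_id(2)[OF assms])

context local_fraction_hom
begin

text \<open>Dividing by the maximal ideal keeps numerators, denominators and the invertibility of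
  the latter, and enlarges the kernel to all of \<open>Q\<close>.\<close>

lemma quotient_by_max_ideal:
  defines "M \<equiv> ext Q"
  shows "local_fraction_hom S (T Quot M) Q (\<lambda>s. M +>\<^bsub>T\<^esub> h s)"
    and "s \<in> Q \<Longrightarrow> M +>\<^bsub>T\<^esub> h s = \<zero>\<^bsub>T Quot M\<^esub>"
proof -
  have M: "ideal M T" unfolding M_def by (rule ext_ideal[OF Q.is_ideal])
  interpret M: ideal M T by (rule M)
  interpret K: cring "T Quot M" by (rule M.quotient_is_cring[OF T.cring_axioms])
  interpret \<pi>: ring_hom_ring T "T Quot M" "(+>\<^bsub>T\<^esub>) M" by (rule M.rcos_ring_hom_ring)
  have zero: "\<zero>\<^bsub>T Quot M\<^esub> = M" by (simp only: FactRing_def ring.select_convs)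
  have hM: "h s \<in> M \<longleftrightarrow> s \<in> Q" if "s \<in> carrier S" for s
    using contr_ext_prime that by (auto simp: contr_def M_def)
  show "M +>\<^bsub>T\<^esub> h s = \<zero>\<^bsub>T Quot M\<^esub>" if "s \<in> Q"
    unfolding zero using T.a_rcos_zero[OF M] hM that Q.Icarr by blast
  show "local_fraction_hom S (T Quot M) Q (\<lambda>s. M +>\<^bsub>T\<^esub> h s)"
  proof (unfold_locales)
    show "(\<lambda>s. M +>\<^bsub>T\<^esub> h s) \<in> ring_hom S (T Quot M)"
      using ring_hom_trans[OF hom \<pi>.homh] by (simp add: comp_def)
    fix w assume "w \<in> carrier (T Quot M)"
    then have "w \<in> a_rcosets\<^bsub>T\<^esub> M" by (simp only: FactRing_def partial_object.select_convs)
    then obtain t where t: "t \<in> carrier T" "w = M +>\<^bsub>T\<^esub> t" unfolding A_RCOSETS_def' by blast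
    obtain s u where s: "s \<in> carrier S" "u \<in> carrier S - Q" "h u \<otimes>\<^bsub>T\<^esub> t = h s"
      using denominators[OF t(1)] by blast
    have "(M +>\<^bsub>T\<^esub> h u) \<otimes>\<^bsub>T Quot M\<^esub> w = M +>\<^bsub>T\<^esub> h s"
      unfolding t(2) s(3)[symmetric] using s t by (intro \<pi>.hom_mult[symmetric]) auto
    then show "\<exists>s\<in>carrier S. \<exists>u\<in>carrier S - Q. (M +>\<^bsub>T\<^esub> h u) \<otimes>\<^bsub>T Quot M\<^esub> w = M +>\<^bsub>T\<^esub> h s"
      using s by blast
  next
    fix s assume s: "s \<in> carrier S" "M +>\<^bsub>T\<^esub> h s = \<zero>\<^bsub>T Quot M\<^esub>"
    then have "h s \<in> M" unfolding zero using M.rcos_const_imp_mem by simp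
    then show "s \<in> Q" using hM s by simp
  next
    fix u assume u: "u \<in> carrier S - Q"
    then have hu: "h u \<in> Units T" by (rule units)
    have "(M +>\<^bsub>T\<^esub> inv\<^bsub>T\<^esub> (h u)) \<otimes>\<^bsub>T Quot M\<^esub> (M +>\<^bsub>T\<^esub> h u) = M +>\<^bsub>T\<^esub> (inv\<^bsub>T\<^esub> (h u) \<otimes>\<^bsub>T\<^esub> h u)"
      using hu by (intro \<pi>.hom_mult[symmetric]) auto
    then have 1: "(M +>\<^bsub>T\<^esub> inv\<^bsub>T\<^esub> (h u)) \<otimes>\<^bsub>T Quot M\<^esub> (M +>\<^bsub>T\<^esub> h u) = \<one>\<^bsub>T Quot M\<^esub>"
      using hu \<pi>.hom_one by simp
    have 2: "(M +>\<^bsub>T\<^esub> inv\<^bsub>T\<^esub> (h u)) \<in> carrier (T Quot M)" "(M +>\<^bsub>T\<^esub> h u) \<in> carrier (T Quot M)"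
      using hu by (auto intro!: \<pi>.hom_closed)
    from 1 2 show "M +>\<^bsub>T\<^esub> h u \<in> Units (T Quot M)"
      using K.m_comm[OF 2] unfolding Units_def by auto
  qed
qed

end

lemma (in primeideal) residue_field_hom:
  assumes "cring R"
  obtains h where "local_fraction_hom R (residue_field R I) I h"
    "\<And>r. r \<in> I \<Longrightarrow> h r = \<zero>\<^bsub>residue_field R I\<^esub>"
proof -
  interpret L: local_fraction_hom R "localization R I" I "\<lambda>r. fraction R I r \<one>"
    by (rule local_fraction_hom_self[OF assms])
  show ?thesis
    using that L.quotient_by_max_ideal unfolding residue_field_def L.max_ideal_eq by blast
qed

lemma (in cring) ring_hom_of_integer:
  assumes "cring T" and h: "h \<in> ring_hom R T"
  shows "h \<guillemotleft>n\<guillemotright> = \<guillemotleft>n\<guillemotright>\<^bsub>T\<^esub>"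
proof -
  interpret H: ring_hom_cring R T h
    by (intro ring_hom_cring.intro ring_hom_cring_axioms.intro cring_axioms assms)
  show ?thesis
  proof (induction n rule: int_induct[where k = 0])
    case (step1 n)
    then show ?case by (simp only: of_int_add H.S.of_int_add of_int_1 H.S.of_int_1 H.hom_add
          of_int_closed one_closed H.hom_one)
  next
    case (step2 n)
    have "h (\<guillemotleft>n\<guillemotright> \<ominus> \<one>) = h \<guillemotleft>n\<guillemotright> \<ominus>\<^bsub>T\<^esub> \<one>\<^bsub>T\<^esub>"
      by (simp add: minus_eq H.S.minus_eq)
    then show ?case using step2
      by (simp only: of_int_diff H.S.of_int_diff of_int_1 H.S.of_int_1)
  qed simp
qed

lemma of_integer_int: "\<guillemotleft>n\<guillemotright>\<^bsub>\<Z>\<^esub> = n"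
proof -
  note Z = cring.axioms(1)[OF int_is_cring]
  show ?thesis
  proof (induction n rule: int_induct[where k = 0])
    case base
    then show ?case using ring.of_int_0[OF Z] by simp
  next
    case (step1 n)
    then show ?case using ring.of_int_add[OF Z, of n 1] ring.of_int_1[OF Z] by simp
  next
    case (step2 n)
    have "\<guillemotleft>n\<guillemotright>\<^bsub>\<Z>\<^esub> = \<guillemotleft>n - 1\<guillemotright>\<^bsub>\<Z>\<^esub> + 1" using ring.of_int_add[OF Z, of "n - 1" 1] ring.of_int_1[OF Z] by simp
    then show ?case using step2 by simp
  qed
qed

text \<open>These facts are what the fibre uses about its residue field: elements are quotients of
  integers, and an integer vanishes exactly when it lies in \<open>\<pp>\<close>. They cover
  characteristic zero and \<open>p\<close> alike.\<close>

lemma residue_field_int: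
  assumes "primeideal \<pp> \<Z>"
  defines "K \<equiv> residue_field \<Z> \<pp>"
  shows "cring K"
    and "t \<in> carrier K \<Longrightarrow> \<exists>m n. n \<notin> \<pp> \<and> \<guillemotleft>n\<guillemotright>\<^bsub>K\<^esub> \<otimes>\<^bsub>K\<^esub> t = \<guillemotleft>m\<guillemotright>\<^bsub>K\<^esub>"
    and "\<guillemotleft>n\<guillemotright>\<^bsub>K\<^esub> = \<zero>\<^bsub>K\<^esub> \<longleftrightarrow> n \<in> \<pp>"
proof -
  interpret Z: cring \<Z> by (rule int_is_cring)
  obtain h where h: "local_fraction_hom \<Z> K \<pp> h" "\<And>r. r \<in> \<pp> \<Longrightarrow> h r = \<zero>\<^bsub>K\<^esub>"
    using primeideal.residue_field_hom[OF assms(1) int_is_cring] unfolding K_def by blast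
  interpret L: local_fraction_hom \<Z> K \<pp> h by (rule h(1))
  show K: "cring K" by (rule L.T.cring_axioms)
  have eq: "h n = \<guillemotleft>n\<guillemotright>\<^bsub>K\<^esub>" for n
    using cring.ring_hom_of_integer[OF int_is_cring K L.hom, of n] by (simp add: of_integer_int)
  show "\<exists>m n. n \<notin> \<pp> \<and> \<guillemotleft>n\<guillemotright>\<^bsub>K\<^esub> \<otimes>\<^bsub>K\<^esub> t = \<guillemotleft>m\<guillemotright>\<^bsub>K\<^esub>" if "t \<in> carrier K"
    using L.denominators[OF that] by (auto simp: eq)
  show "\<guillemotleft>n\<guillemotright>\<^bsub>K\<^esub> = \<zero>\<^bsub>K\<^esub> \<longleftrightarrow> n \<in> \<pp>"
    using L.kernel[of n] h(2)[of n] by (auto simp: eq)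
qed

subsection \<open>Extending functions on a monoid linearly\<close>

text \<open>The analogue of \<open>lin\<close> with values in another ring, needed for functionals
  on a tensor product with a residue field.\<close>

definition lin_ext ::
    "('a, 'm) ring_scheme \<Rightarrow> ('b, 'n) pointed_monoid_scheme \<Rightarrow> ('b \<Rightarrow> 'a) \<Rightarrow> ('b \<Rightarrow> int) \<Rightarrow> 'a" where
  "lin_ext R G w f = (\<Oplus>\<^bsub>R\<^esub>b\<in>supp G f. \<guillemotleft>f b\<guillemotright>\<^bsub>R\<^esub> \<otimes>\<^bsub>R\<^esub> w b)"

context cring
begin

lemma lin_ext_superset:
  assumes "finite F" "supp G f \<subseteq> F" "F \<subseteq> nonzero G" "w \<in> nonzero G \<rightarrow> carrier R"
  shows "lin_ext R G w f = (\<Oplus>b\<in>F. \<guillemotleft>f b\<guillemotright> \<otimes> w b)"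
  unfolding lin_ext_def using assms
  by (intro add.finprod_mono_neutral_cong_left) (auto simp: supp_def subset_iff Pi_iff)

lemma lin_ext_closed:
  assumes "w \<in> nonzero G \<rightarrow> carrier R"
  shows "lin_ext R G w f \<in> carrier R"
  unfolding lin_ext_def using assms by (intro finsum_closed) (auto simp: supp_def)

lemma lin_ext_add:
  assumes "f \<in> carrier (monoid_ring \<Z> G)" "g \<in> carrier (monoid_ring \<Z> G)"
    and w: "w \<in> nonzero G \<rightarrow> carrier R"
  shows "lin_ext R G w (f \<oplus>\<^bsub>monoid_ring \<Z> G\<^esub> g) = lin_ext R G w f \<oplus> lin_ext R G w g"
proof -
  let ?F = "supp G f \<union> supp G g"
  have F: "finite ?F" "?F \<subseteq> nonzero G"
    using assms by (auto simp: monoid_ring_carrier supp_def)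
  have s: "supp G (f \<oplus>\<^bsub>monoid_ring \<Z> G\<^esub> g) \<subseteq> ?F"
    by (auto simp: monoid_ring_add supp_def)
  have c: "w b \<in> carrier R" if "b \<in> ?F" for b using w F(2) that by auto
  have "(\<Oplus>b\<in>?F. \<guillemotleft>(f \<oplus>\<^bsub>monoid_ring \<Z> G\<^esub> g) b\<guillemotright> \<otimes> w b) =
      (\<Oplus>b\<in>?F. \<guillemotleft>f b\<guillemotright> \<otimes> w b \<oplus> \<guillemotleft>g b\<guillemotright> \<otimes> w b)"
    using F(2) c by (intro finsum_cong') (auto simp: monoid_ring_add l_distr)
  also have "\<dots> = (\<Oplus>b\<in>?F. \<guillemotleft>f b\<guillemotright> \<otimes> w b) \<oplus> (\<Oplus>b\<in>?F. \<guillemotleft>g b\<guillemotright> \<otimes> w b)"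
    using c by (intro finsum_addf) auto
  finally show ?thesis
    unfolding lin_ext_superset[OF F(1) s F(2) w] lin_ext_superset[OF F(1) Un_upper1 F(2) w]
      lin_ext_superset[OF F(1) Un_upper2 F(2) w] .
qed

lemma lin_ext_single:
  assumes "a \<in> nonzero G" "w \<in> nonzero G \<rightarrow> carrier R"
  shows "lin_ext R G w (single G a) = w a"
proof -
  have "lin_ext R G w (single G a) = (\<Oplus>b\<in>{a}. \<guillemotleft>single G a b\<guillemotright> \<otimes> w b)"
    using supp_single[of G a] assms by (intro lin_ext_superset) auto
  also have "\<dots> = w a"
    using assms by (subst finsum_insert) (auto simp: single_apply Pi_iff)
  finally show ?thesis .
qed

lemma lin_ext_a_inv:
  assumes f: "f \<in> carrier (monoid_ring \<Z> G)" and w: "w \<in> nonzero G \<rightarrow> carrier R"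
  shows "lin_ext R G w (\<ominus>\<^bsub>monoid_ring \<Z> G\<^esub> f) = \<ominus> lin_ext R G w f"
proof -
  interpret S: abelian_group "monoid_ring \<Z> G" by (rule abelian_group_monoid_ring)
  interpret H: group_hom "add_monoid (monoid_ring \<Z> G)" "add_monoid R" "lin_ext R G w"
    using lin_ext_closed[OF w] lin_ext_add[OF _ _ w]
    by (intro group_hom_addI S.abelian_group_axioms abelian_group_axioms) auto
  show ?thesis using H.hom_inv[of f] f by (simp add: a_inv_def)
qed

lemma lin_ext_minus:
  assumes "f \<in> carrier (monoid_ring \<Z> G)" "g \<in> carrier (monoid_ring \<Z> G)"
    and w: "w \<in> nonzero G \<rightarrow> carrier R"
  shows "lin_ext R G w (f \<ominus>\<^bsub>monoid_ring \<Z> G\<^esub> g) = lin_ext R G w f \<ominus> lin_ext R G w g"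
proof -
  interpret S: abelian_group "monoid_ring \<Z> G" by (rule abelian_group_monoid_ring)
  show ?thesis
    using assms by (simp add: S.minus_eq minus_eq lin_ext_add lin_ext_a_inv)
qed

end

subsection \<open>Tensor products and fibres\<close>

lemma adjoin_zero_simps:
  "carrier (adjoin_zero G) = insert None (Some ` carrier G)"
  "Some a \<otimes>\<^bsub>adjoin_zero G\<^esub> Some b = Some (a \<otimes>\<^bsub>G\<^esub> b)"
  "None \<otimes>\<^bsub>adjoin_zero G\<^esub> v = None" "u \<otimes>\<^bsub>adjoin_zero G\<^esub> None = None"
  "\<one>\<^bsub>adjoin_zero G\<^esub> = Some \<one>\<^bsub>G\<^esub>" "pzero (adjoin_zero G) = None"
  "nonzero (adjoin_zero G) = Some ` carrier G"
  by (auto simp: adjoin_zero_def nonzero_def split: option.split)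

lemma pointed_comm_monoid_adjoin_zero:
  assumes "comm_monoid G"
  shows "pointed_comm_monoid (adjoin_zero G)"
proof -
  interpret comm_monoid G by fact
  have "comm_monoid (adjoin_zero G)"
    by (rule comm_monoidI) (auto simp: adjoin_zero_simps m_assoc intro: m_comm)
  then show ?thesis
    by (intro pointed_comm_monoid.intro pointed_comm_monoid_axioms.intro)
      (auto simp: adjoin_zero_simps)
qed

lemma (in group_hom) hom_preimage_subgroup:
  "subgroup K H \<Longrightarrow> subgroup {x \<in> carrier G. h x \<in> K} G"
  by (rule subgroup.intro) (auto intro: subgroup.m_closed subgroup.one_closed subgroup.m_inv_closed)

locale tensor_product = S: cring S + T: cring T for S and T
begin

abbreviation "F \<equiv> free_tensor_ring S T"
abbreviation "B \<equiv> adjoin_zero (S \<times>\<times> T)"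

lemma comm_monoid_prod: "comm_monoid (S \<times>\<times> T)"
  by (rule comm_monoidI)
    (auto simp: DirProd_def S.m_assoc T.m_assoc intro: S.m_comm T.m_comm)

sublocale B: pointed_comm_monoid B
  by (rule pointed_comm_monoid_adjoin_zero[OF comm_monoid_prod])

sublocale F: cring F
  unfolding free_tensor_ring_def by (rule B.cring_monoid_ring)

lemma nonzero_B: "nonzero B = Some ` (carrier S \<times> carrier T)"
  by (simp add: adjoin_zero_simps DirProd_def)

lemma free_tensor_eq: "free_tensor S T s t = single B (Some (s, t))"
  by (simp add: free_tensor_def single_def)

lemma free_tensor_closed: "free_tensor S T s t \<in> carrier F"
  unfolding free_tensor_eq free_tensor_ring_def by (rule single_closed)

lemma free_tensor_mult:
  assumes "s \<in> carrier S" "s' \<in> carrier S" "t \<in> carrier T" "t' \<in> carrier T"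
  shows "free_tensor S T s t \<otimes>\<^bsub>F\<^esub> free_tensor S T s' t' =
    free_tensor S T (s \<otimes>\<^bsub>S\<^esub> s') (t \<otimes>\<^bsub>T\<^esub> t')"
  unfolding free_tensor_eq free_tensor_ring_def using assms
  by (subst B.single_mult) (auto simp: nonzero_B adjoin_zero_simps DirProd_def)

lemma one_F: "\<one>\<^bsub>F\<^esub> = free_tensor S T \<one>\<^bsub>S\<^esub> \<one>\<^bsub>T\<^esub>"
  by (simp add: free_tensor_ring_def monoid_ring_one free_tensor_eq single_def adjoin_zero_simps
      DirProd_def)

lemma relations_ideal: "ideal (tensor_relations S T) F"
  unfolding tensor_relations_def using free_tensor_closed by (intro F.genideal_ideal) auto

sublocale I: ideal "tensor_relations S T" F by (rule relations_ideal)

sublocale P: cring "tensor_ring S T"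
  unfolding tensor_ring_def by (rule I.quotient_is_cring[OF F.cring_axioms])

sublocale \<pi>: ring_hom_ring F "tensor_ring S T" "(+>\<^bsub>F\<^esub>) (tensor_relations S T)"
  unfolding tensor_ring_def by (rule I.rcos_ring_hom_ring)

lemma tensor_closed: "tensor S T s t \<in> carrier (tensor_ring S T)"
  unfolding tensor_def using free_tensor_closed by (rule \<pi>.hom_closed)

lemma tensor_mult:
  assumes "s \<in> carrier S" "s' \<in> carrier S" "t \<in> carrier T" "t' \<in> carrier T"
  shows "tensor S T s t \<otimes>\<^bsub>tensor_ring S T\<^esub> tensor S T s' t' =
    tensor S T (s \<otimes>\<^bsub>S\<^esub> s') (t \<otimes>\<^bsub>T\<^esub> t')"
  unfolding tensor_def free_tensor_mult[OF assms, symmetric]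
  by (simp add: free_tensor_closed)

lemma tensor_one: "tensor S T \<one>\<^bsub>S\<^esub> \<one>\<^bsub>T\<^esub> = \<one>\<^bsub>tensor_ring S T\<^esub>"
  unfolding tensor_def one_F[symmetric] by (rule \<pi>.hom_one)

lemma coset_eq_zero: "f \<in> carrier F \<Longrightarrow>
    tensor_relations S T +>\<^bsub>F\<^esub> f = \<zero>\<^bsub>tensor_ring S T\<^esub> \<longleftrightarrow> f \<in> tensor_relations S T"
proof -
  assume f: "f \<in> carrier F"
  have "\<zero>\<^bsub>tensor_ring S T\<^esub> = tensor_relations S T"
    by (simp only: tensor_ring_def FactRing_def ring.select_convs)
  then show ?thesis
    using F.a_rcos_zero[OF relations_ideal] I.rcos_const_imp_mem[OF f] by metis
qed

lemma tensor_add_left: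
  assumes "s \<in> carrier S" "s' \<in> carrier S" "t \<in> carrier T"
  shows "tensor S T (s \<oplus>\<^bsub>S\<^esub> s') t = tensor S T s t \<oplus>\<^bsub>tensor_ring S T\<^esub> tensor S T s' t"
proof -
  have "free_tensor S T (s \<oplus>\<^bsub>S\<^esub> s') t \<ominus>\<^bsub>F\<^esub> (free_tensor S T s t \<oplus>\<^bsub>F\<^esub> free_tensor S T s' t)
      \<in> tensor_relations S T"
    unfolding tensor_relations_def
    by (rule subsetD[OF F.genideal_self]) (use assms free_tensor_closed in auto)
  then have "tensor_relations S T +>\<^bsub>F\<^esub> (free_tensor S T (s \<oplus>\<^bsub>S\<^esub> s') t) =
      tensor_relations S T +>\<^bsub>F\<^esub> (free_tensor S T s t \<oplus>\<^bsub>F\<^esub> free_tensor S T s' t)"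
    by (intro F.quotient_eq_iff_same_a_r_cos[OF relations_ideal, THEN iffD1])
      (auto simp: free_tensor_closed)
  then show ?thesis unfolding tensor_def by (simp add: free_tensor_closed)
qed

lemma tensor_add_right:
  assumes "s \<in> carrier S" "t \<in> carrier T" "t' \<in> carrier T"
  shows "tensor S T s (t \<oplus>\<^bsub>T\<^esub> t') = tensor S T s t \<oplus>\<^bsub>tensor_ring S T\<^esub> tensor S T s t'"
proof -
  have "free_tensor S T s (t \<oplus>\<^bsub>T\<^esub> t') \<ominus>\<^bsub>F\<^esub> (free_tensor S T s t \<oplus>\<^bsub>F\<^esub> free_tensor S T s t')
      \<in> tensor_relations S T"
    unfolding tensor_relations_def
    by (rule subsetD[OF F.genideal_self]) (use assms free_tensor_closed in auto)
  then have "tensor_relations S T +>\<^bsub>F\<^esub> (free_tensor S T s (t \<oplus>\<^bsub>T\<^esub> t')) =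
      tensor_relations S T +>\<^bsub>F\<^esub> (free_tensor S T s t \<oplus>\<^bsub>F\<^esub> free_tensor S T s t')"
    by (intro F.quotient_eq_iff_same_a_r_cos[OF relations_ideal, THEN iffD1])
      (auto simp: free_tensor_closed)
  then show ?thesis unfolding tensor_def by (simp add: free_tensor_closed)
qed

lemma tensor_generates:
  assumes H: "additive_subgroup H (tensor_ring S T)"
    and t: "\<And>s t. s \<in> carrier S \<Longrightarrow> t \<in> carrier T \<Longrightarrow> tensor S T s t \<in> H"
    and w: "w \<in> carrier (tensor_ring S T)"
  shows "w \<in> H"
proof -
  have "w \<in> a_rcosets\<^bsub>F\<^esub> (tensor_relations S T)"
    using w by (simp only: tensor_ring_def FactRing_def partial_object.select_convs)
  then obtain f where f: "f \<in> carrier F" "w = tensor_relations S T +>\<^bsub>F\<^esub> f"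
    unfolding A_RCOSETS_def' by blast
  interpret G: group_hom "add_monoid F" "add_monoid (tensor_ring S T)" "(+>\<^bsub>F\<^esub>) (tensor_relations S T)"
    by (intro group_hom_addI) (auto simp: F.abelian_group_axioms P.abelian_group_axioms)
  let ?H = "{f \<in> carrier F. tensor_relations S T +>\<^bsub>F\<^esub> f \<in> H}"
  have "subgroup ?H (add_monoid F)"
    using G.hom_preimage_subgroup[OF additive_subgroup.a_subgroup[OF H]] by simp
  then have "additive_subgroup ?H (monoid_ring \<Z> B)"
    unfolding free_tensor_ring_def by (rule additive_subgroup.intro)
  then have "f \<in> ?H"
  proof (rule additive_subgroup_monoid_ring_eq)
    fix a assume "a \<in> nonzero B"
    then obtain s u where "s \<in> carrier S" "u \<in> carrier T" "a = Some (s, u)"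
      by (auto simp: nonzero_B)
    then show "single B a \<in> ?H"
      using t[of s u] free_tensor_closed[of s u] by (simp add: tensor_def free_tensor_eq)
  qed (use f in \<open>simp add: free_tensor_ring_def\<close>)
  then show ?thesis using f by simp
qed

lemma tensor_left_hom: "(\<lambda>s. tensor S T s \<one>\<^bsub>T\<^esub>) \<in> ring_hom S (tensor_ring S T)"
  by (rule ring_hom_memI) (auto simp: tensor_closed tensor_mult tensor_add_left tensor_one)

lemma tensor_right_hom: "(\<lambda>t. tensor S T \<one>\<^bsub>S\<^esub> t) \<in> ring_hom T (tensor_ring S T)"
  by (rule ring_hom_memI) (auto simp: tensor_closed tensor_mult tensor_add_right tensor_one)

text \<open>Integer scalars pass through the tensor sign because the inclusions of both factors are
  ring homomorphisms, which preserve the images of the integers.\<close>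

lemma tensor_int_left:
  assumes "s \<in> carrier S" "t \<in> carrier T"
  shows "tensor S T (\<guillemotleft>n\<guillemotright>\<^bsub>S\<^esub> \<otimes>\<^bsub>S\<^esub> s) t = \<guillemotleft>n\<guillemotright>\<^bsub>tensor_ring S T\<^esub> \<otimes>\<^bsub>tensor_ring S T\<^esub> tensor S T s t"
  unfolding S.ring_hom_of_integer[OF P.cring_axioms tensor_left_hom, symmetric]
  using assms by (simp add: tensor_mult)

lemma tensor_int_right:
  assumes "s \<in> carrier S" "t \<in> carrier T"
  shows "tensor S T s (\<guillemotleft>n\<guillemotright>\<^bsub>T\<^esub> \<otimes>\<^bsub>T\<^esub> t) = \<guillemotleft>n\<guillemotright>\<^bsub>tensor_ring S T\<^esub> \<otimes>\<^bsub>tensor_ring S T\<^esub> tensor S T s t"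
  unfolding T.ring_hom_of_integer[OF P.cring_axioms tensor_right_hom, symmetric]
  using assms by (simp add: tensor_mult)

definition additive :: "('a \<Rightarrow> int) \<Rightarrow> bool" where
  "additive d \<longleftrightarrow> (\<forall>s\<in>carrier S. \<forall>s'\<in>carrier S. d (s \<oplus>\<^bsub>S\<^esub> s') = d s + d s')"

definition weight :: "('a \<Rightarrow> int) \<Rightarrow> ('a \<times> 'c) option \<Rightarrow> 'c" where
  "weight d b = (case b of None \<Rightarrow> \<zero>\<^bsub>T\<^esub> | Some (s, t) \<Rightarrow> \<guillemotleft>d s\<guillemotright>\<^bsub>T\<^esub> \<otimes>\<^bsub>T\<^esub> t)"

lemma weight_closed: "weight d \<in> nonzero B \<rightarrow> carrier T"
  by (auto simp: weight_def nonzero_B)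

text \<open>The additive map \<open>s \<otimes> t \<mapsto> d(s) t\<close> from the tensor product to \<open>T\<close>.\<close>

lemma lin_ext_relations:
  assumes f: "f \<in> tensor_relations S T" and d: "additive d"
  shows "lin_ext T B (weight d) f = \<zero>\<^bsub>T\<^esub>"
proof -
  \<comment> \<open>Vanishing is demanded for all additive \<open>d\<close> at once: multiplying by
    \<open>s \<otimes> t\<close> replaces \<open>d\<close> by \<open>\<lambda>x. d (s x)\<close>, so
    a single \<open>d\<close> would in general only give a subgroup and not an ideal.\<close>
  let ?N = "{f \<in> carrier F. \<forall>d. additive d \<longrightarrow> lin_ext T B (weight d) f = \<zero>\<^bsub>T\<^esub>}"
  have Fc: "carrier F = carrier (monoid_ring \<Z> B)" by (simp add: free_tensor_ring_def)
  note add = T.lin_ext_add[OF _ _ weight_closed, folded free_tensor_ring_def]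
    and inv = T.lin_ext_a_inv[OF _ weight_closed, folded free_tensor_ring_def]
    and minus = T.lin_ext_minus[OF _ _ weight_closed, folded free_tensor_ring_def]
    and closed = T.lin_ext_closed[OF weight_closed]
  have tensor: "lin_ext T B (weight d) (free_tensor S T s t) = \<guillemotleft>d s\<guillemotright>\<^bsub>T\<^esub> \<otimes>\<^bsub>T\<^esub> t"
    if "s \<in> carrier S" "t \<in> carrier T" for d s t
    unfolding free_tensor_eq using that
    by (subst T.lin_ext_single[OF _ weight_closed]) (auto simp: nonzero_B weight_def)
  have group: "additive_subgroup ?N F"
  proof (intro additive_subgroup.intro, unfold_locales, goal_cases)
    case (2 x y)
    then show ?case by (auto simp: add)
  next
    case 3
    have "\<zero>\<^bsub>F\<^esub> = \<zero>\<^bsub>F\<^esub> \<oplus>\<^bsub>F\<^esub> \<zero>\<^bsub>F\<^esub>" by simp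
    then have "lin_ext T B (weight d) \<zero>\<^bsub>F\<^esub> = lin_ext T B (weight d) \<zero>\<^bsub>F\<^esub> \<oplus>\<^bsub>T\<^esub> lin_ext T B (weight d) \<zero>\<^bsub>F\<^esub>"
      for d using add[of "\<zero>\<^bsub>F\<^esub>" "\<zero>\<^bsub>F\<^esub>" d] by simp
    then have "lin_ext T B (weight d) \<zero>\<^bsub>F\<^esub> = \<zero>\<^bsub>T\<^esub>" for d
      using T.add.l_cancel_one'[OF closed closed] by metis
    then show ?case by simp
  next
    case (4 x)
    then show ?case unfolding a_inv_def[symmetric] by (auto simp: inv)
  qed auto
  have tensor_mult: "free_tensor S T s t \<otimes>\<^bsub>F\<^esub> f \<in> ?N"
    if s: "s \<in> carrier S" and t: "t \<in> carrier T" and f: "f \<in> ?N" for s t f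
  proof -
    have "lin_ext T B (weight d) (free_tensor S T s t \<otimes>\<^bsub>F\<^esub> f) = \<zero>\<^bsub>T\<^esub>" if d: "additive d" for d
    proof -
      have d': "additive (\<lambda>x. d (s \<otimes>\<^bsub>S\<^esub> x))"
        using d s by (simp add: additive_def S.r_distr)
      have fc: "f \<in> carrier F" using f by simp
      have "lin_ext T B (weight d) (free_tensor S T s t \<otimes>\<^bsub>F\<^esub> f) =
          t \<otimes>\<^bsub>T\<^esub> lin_ext T B (weight (\<lambda>x. d (s \<otimes>\<^bsub>S\<^esub> x))) f"
      proof (rule additive_ext_monoid_ring[OF T.abelian_group_axioms _ _ _ _ _ fc[unfolded Fc], folded Fc],
          goal_cases)
        case (2 g h)
        then have "g \<in> carrier F" "h \<in> carrier F" by (simp_all add: Fc)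
        then show ?case unfolding free_tensor_ring_def[symmetric]
          by (simp add: F.r_distr free_tensor_closed add)
      next
        case (4 g h)
        then have "g \<in> carrier F" "h \<in> carrier F" by (simp_all add: Fc)
        then show ?case unfolding free_tensor_ring_def[symmetric]
          using t by (simp add: T.r_distr closed add)
      next
        case (5 a)
        then obtain x y where a: "x \<in> carrier S" "y \<in> carrier T" "a = Some (x, y)"
          by (auto simp: nonzero_B)
        have "lin_ext T B (weight d) (free_tensor S T s t \<otimes>\<^bsub>F\<^esub> free_tensor S T x y) =
          t \<otimes>\<^bsub>T\<^esub> lin_ext T B (weight (\<lambda>x. d (s \<otimes>\<^bsub>S\<^esub> x))) (free_tensor S T x y)"
          using s t a(1,2) by (simp add: free_tensor_mult tensor T.m_ac)
        then show ?case by (simp add: a(3) free_tensor_eq)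
      qed (use t closed in auto)
      then show ?thesis using f d' t by simp
    qed
    then show ?thesis using f free_tensor_closed by simp
  qed
  have mult: "g \<otimes>\<^bsub>F\<^esub> f \<in> ?N" if g: "g \<in> carrier F" and f: "f \<in> ?N" for f g
  proof -
    have fc: "f \<in> carrier F" using f by blast
    interpret N: additive_subgroup ?N F by (rule group)
    interpret M: group_hom "add_monoid F" "add_monoid F" "\<lambda>g. g \<otimes>\<^bsub>F\<^esub> f"
      by (rule group_hom_addI[OF F.abelian_group_axioms F.abelian_group_axioms])
        (use fc F.m_closed F.l_distr in blast)+
    have "subgroup {g \<in> carrier F. g \<otimes>\<^bsub>F\<^esub> f \<in> ?N} (add_monoid F)"
      using M.hom_preimage_subgroup[OF N.a_subgroup] by (simp only: partial_object.select_convs)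
    then have "additive_subgroup {g \<in> carrier F. g \<otimes>\<^bsub>F\<^esub> f \<in> ?N} (monoid_ring \<Z> B)"
      unfolding free_tensor_ring_def by (rule additive_subgroup.intro)
    then have "g \<in> {g \<in> carrier F. g \<otimes>\<^bsub>F\<^esub> f \<in> ?N}"
    proof (rule additive_subgroup_monoid_ring_eq)
      fix a assume "a \<in> nonzero B"
      then obtain s t where st: "s \<in> carrier S" "t \<in> carrier T" and a: "a = Some (s, t)"
        by (auto simp: nonzero_B)
      have "free_tensor S T s t \<in> {g \<in> carrier F. g \<otimes>\<^bsub>F\<^esub> f \<in> ?N}"
        using tensor_mult[OF st f] free_tensor_closed by blast
      then show "single B a \<in> {g \<in> carrier F. g \<otimes>\<^bsub>F\<^esub> f \<in> ?N}"
        unfolding a free_tensor_eq .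
    qed (use g in \<open>simp only: Fc\<close>)
    then show ?thesis by blast
  qed
  have N: "ideal ?N F"
  proof (rule idealI[OF F.ring_axioms])
    show "subgroup ?N (add_monoid F)" using group by (rule additive_subgroup.a_subgroup)
    show "x \<otimes>\<^bsub>F\<^esub> a \<in> ?N" "a \<otimes>\<^bsub>F\<^esub> x \<in> ?N" if "a \<in> ?N" "x \<in> carrier F" for a x
    proof -
      show "x \<otimes>\<^bsub>F\<^esub> a \<in> ?N" using mult that by blast
      moreover have "a \<otimes>\<^bsub>F\<^esub> x = x \<otimes>\<^bsub>F\<^esub> a" using that by (intro F.m_comm) auto
      ultimately show "a \<otimes>\<^bsub>F\<^esub> x \<in> ?N" by simp
    qed
  qed
  have "tensor_relations S T \<subseteq> ?N"
    unfolding tensor_relations_def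
  proof (rule F.genideal_minimal[OF N], safe)
    fix s s' t d assume st: "s \<in> carrier S" "s' \<in> carrier S" "t \<in> carrier T"
    let ?f = "free_tensor S T (s \<oplus>\<^bsub>S\<^esub> s') t \<ominus>\<^bsub>F\<^esub> (free_tensor S T s t \<oplus>\<^bsub>F\<^esub> free_tensor S T s' t)"
    show "?f \<in> carrier F" by (simp add: free_tensor_closed)
    show "lin_ext T B (weight d) ?f = \<zero>\<^bsub>T\<^esub>" if "additive d"
      using that st by (simp add: minus add free_tensor_closed tensor additive_def T.l_distr
          T.minus_eq T.r_neg)
  next
    fix s t t' d assume st: "s \<in> carrier S" "t \<in> carrier T" "t' \<in> carrier T"
    let ?f = "free_tensor S T s (t \<oplus>\<^bsub>T\<^esub> t') \<ominus>\<^bsub>F\<^esub> (free_tensor S T s t \<oplus>\<^bsub>F\<^esub> free_tensor S T s t')"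
    show "?f \<in> carrier F" by (simp add: free_tensor_closed)
    show "lin_ext T B (weight d) ?f = \<zero>\<^bsub>T\<^esub>" if "additive d"
      using that st by (simp add: minus add free_tensor_closed tensor additive_def T.r_distr
          T.minus_eq T.r_neg)
  qed
  then show ?thesis using f d by blast
qed

text \<open>Every additive \<open>d\<close> on \<open>S\<close> detects elements of the form
  \<open>s \<otimes> 1\<close>. This bounds the kernel of the map from \<open>S\<close> to the
  tensor product from above, so the fibre cannot collapse.\<close>

lemma tensor_eq_zeroD:
  assumes "s \<in> carrier S" "tensor S T s \<one>\<^bsub>T\<^esub> = \<zero>\<^bsub>tensor_ring S T\<^esub>" "additive d"
  shows "\<guillemotleft>d s\<guillemotright>\<^bsub>T\<^esub> = \<zero>\<^bsub>T\<^esub>"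
proof -
  have "free_tensor S T s \<one>\<^bsub>T\<^esub> \<in> tensor_relations S T"
    using assms(2) unfolding tensor_def coset_eq_zero[OF free_tensor_closed] .
  from lin_ext_relations[OF this assms(3)]
  have "weight d (Some (s, \<one>\<^bsub>T\<^esub>)) = \<zero>\<^bsub>T\<^esub>"
    unfolding free_tensor_eq using assms(1)
    by (subst (asm) T.lin_ext_single[OF _ weight_closed]) (auto simp: nonzero_B)
  then show ?thesis by (simp add: weight_def)
qed

text \<open>The elements with an integer denominator form a subgroup, as denominators outside
  \<open>P\<close> can be multiplied. Pure tensors belong to it: if \<open>n t = m\<close>, then
  \<open>n (s \<otimes> t) = s \<otimes> m = m s \<otimes> 1\<close>.\<close>

lemma tensor_denominators:
  assumes P: "\<And>m n. m \<notin> P \<Longrightarrow> n \<notin> P \<Longrightarrow> m * n \<notin> (P :: int set)"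
    and T: "\<And>t. t \<in> carrier T \<Longrightarrow> \<exists>m n. n \<notin> P \<and> \<guillemotleft>n\<guillemotright>\<^bsub>T\<^esub> \<otimes>\<^bsub>T\<^esub> t = \<guillemotleft>m\<guillemotright>\<^bsub>T\<^esub>"
    and w: "w \<in> carrier (tensor_ring S T)"
  shows "\<exists>s\<in>carrier S. \<exists>n. n \<notin> P \<and>
    \<guillemotleft>n\<guillemotright>\<^bsub>tensor_ring S T\<^esub> \<otimes>\<^bsub>tensor_ring S T\<^esub> w = tensor S T s \<one>\<^bsub>T\<^esub>"
proof -
  let ?P = "tensor_ring S T"
  let ?H = "{w \<in> carrier ?P. \<exists>s\<in>carrier S. \<exists>n. n \<notin> P \<and> \<guillemotleft>n\<guillemotright>\<^bsub>?P\<^esub> \<otimes>\<^bsub>?P\<^esub> w = tensor S T s \<one>\<^bsub>T\<^esub>}"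
  interpret \<iota>: ring_hom_cring S ?P "\<lambda>s. tensor S T s \<one>\<^bsub>T\<^esub>"
    by (intro ring_hom_cring.intro ring_hom_cring_axioms.intro S.cring_axioms P.cring_axioms
        tensor_left_hom)
  have int: "tensor S T \<guillemotleft>n\<guillemotright>\<^bsub>S\<^esub> \<one>\<^bsub>T\<^esub> = \<guillemotleft>n\<guillemotright>\<^bsub>?P\<^esub>" for n
    by (rule S.ring_hom_of_integer[OF P.cring_axioms tensor_left_hom])
  have "subgroup ?H (add_monoid ?P)"
  proof (unfold_locales, goal_cases)
    case (2 x y)
    then obtain s n s' n' where s: "s \<in> carrier S" "n \<notin> P" "\<guillemotleft>n\<guillemotright>\<^bsub>?P\<^esub> \<otimes>\<^bsub>?P\<^esub> x = tensor S T s \<one>\<^bsub>T\<^esub>"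
      and s': "s' \<in> carrier S" "n' \<notin> P" "\<guillemotleft>n'\<guillemotright>\<^bsub>?P\<^esub> \<otimes>\<^bsub>?P\<^esub> y = tensor S T s' \<one>\<^bsub>T\<^esub>"
      and xy: "x \<in> carrier ?P" "y \<in> carrier ?P" by blast
    have "\<guillemotleft>n * n'\<guillemotright>\<^bsub>?P\<^esub> \<otimes>\<^bsub>?P\<^esub> (x \<oplus>\<^bsub>?P\<^esub> y) =
        \<guillemotleft>n'\<guillemotright>\<^bsub>?P\<^esub> \<otimes>\<^bsub>?P\<^esub> (\<guillemotleft>n\<guillemotright>\<^bsub>?P\<^esub> \<otimes>\<^bsub>?P\<^esub> x) \<oplus>\<^bsub>?P\<^esub> \<guillemotleft>n\<guillemotright>\<^bsub>?P\<^esub> \<otimes>\<^bsub>?P\<^esub> (\<guillemotleft>n'\<guillemotright>\<^bsub>?P\<^esub> \<otimes>\<^bsub>?P\<^esub> y)"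
      using xy by (simp add: P.r_distr P.m_ac)
    also have "\<dots> = tensor S T (\<guillemotleft>n'\<guillemotright>\<^bsub>S\<^esub> \<otimes>\<^bsub>S\<^esub> s \<oplus>\<^bsub>S\<^esub> \<guillemotleft>n\<guillemotright>\<^bsub>S\<^esub> \<otimes>\<^bsub>S\<^esub> s') \<one>\<^bsub>T\<^esub>"
      unfolding s(3) s'(3) using s(1) s'(1) by (simp add: int)
    finally have "\<exists>s\<in>carrier S. \<exists>n. n \<notin> P \<and> \<guillemotleft>n\<guillemotright>\<^bsub>?P\<^esub> \<otimes>\<^bsub>?P\<^esub> (x \<oplus>\<^bsub>?P\<^esub> y) = tensor S T s \<one>\<^bsub>T\<^esub>"
      using P[OF s(2) s'(2)] s(1) s'(1)
      by (intro bexI[of _ "\<guillemotleft>n'\<guillemotright>\<^bsub>S\<^esub> \<otimes>\<^bsub>S\<^esub> s \<oplus>\<^bsub>S\<^esub> \<guillemotleft>n\<guillemotright>\<^bsub>S\<^esub> \<otimes>\<^bsub>S\<^esub> s'"] exI[of _ "n * n'"] conjI)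
        simp_all
    then show ?case using xy by simp
  next
    case 3
    obtain m n where "n \<notin> P" using T[OF T.zero_closed] by blast
    then show ?case using \<iota>.hom_zero by (auto intro!: bexI[of _ "\<zero>\<^bsub>S\<^esub>"] exI[of _ n])
  next
    case (4 x)
    then obtain s n where s: "s \<in> carrier S" "n \<notin> P" "\<guillemotleft>n\<guillemotright>\<^bsub>?P\<^esub> \<otimes>\<^bsub>?P\<^esub> x = tensor S T s \<one>\<^bsub>T\<^esub>"
      and x: "x \<in> carrier ?P" by blast
    have "\<guillemotleft>n\<guillemotright>\<^bsub>?P\<^esub> \<otimes>\<^bsub>?P\<^esub> (\<ominus>\<^bsub>?P\<^esub> x) = tensor S T (\<ominus>\<^bsub>S\<^esub> s) \<one>\<^bsub>T\<^esub>"
      using s x by (simp add: P.r_minus)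
    then show ?case
      unfolding a_inv_def[symmetric] using s x by (auto intro!: bexI[of _ "\<ominus>\<^bsub>S\<^esub> s"] exI[of _ n])
  qed auto
  then have H: "additive_subgroup ?H ?P" by (rule additive_subgroup.intro)
  have "tensor S T s t \<in> ?H" if st: "s \<in> carrier S" "t \<in> carrier T" for s t
  proof -
    obtain m n where n: "n \<notin> P" "\<guillemotleft>n\<guillemotright>\<^bsub>T\<^esub> \<otimes>\<^bsub>T\<^esub> t = \<guillemotleft>m\<guillemotright>\<^bsub>T\<^esub>" using T[OF st(2)] by blast
    have "\<guillemotleft>n\<guillemotright>\<^bsub>?P\<^esub> \<otimes>\<^bsub>?P\<^esub> tensor S T s t = tensor S T s (\<guillemotleft>m\<guillemotright>\<^bsub>T\<^esub> \<otimes>\<^bsub>T\<^esub> \<one>\<^bsub>T\<^esub>)"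
      unfolding tensor_int_right[OF st, symmetric] n(2) by simp
    also have "\<dots> = \<guillemotleft>m\<guillemotright>\<^bsub>?P\<^esub> \<otimes>\<^bsub>?P\<^esub> tensor S T s \<one>\<^bsub>T\<^esub>"
      by (rule tensor_int_right[OF st(1) T.one_closed])
    also have "\<dots> = tensor S T (\<guillemotleft>m\<guillemotright>\<^bsub>S\<^esub> \<otimes>\<^bsub>S\<^esub> s) \<one>\<^bsub>T\<^esub>"
      by (rule tensor_int_left[OF st(1) T.one_closed, symmetric])
    finally show ?thesis
      using n(1) st(1) tensor_closed by (auto intro!: bexI[of _ "\<guillemotleft>m\<guillemotright>\<^bsub>S\<^esub> \<otimes>\<^bsub>S\<^esub> s"] exI[of _ n])
  qed
  from tensor_generates[OF H this w] show ?thesis by simp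
qed

end

text \<open>The fibre of an affine scheme with coordinate ring \<open>S\<close> over \<open>\<pp>\<close>, near a point \<open>Q\<close> that is
  given by a retraction \<open>\<epsilon>\<close> of \<open>S\<close> onto \<open>\<int>\<close>.\<close>

lemma fibre_fraction_hom:
  fixes S (structure)
  assumes S: "cring S" and \<pp>: "primeideal \<pp> \<Z>" and Q: "primeideal Q S"
    and \<epsilon>: "\<And>s s'. s \<in> carrier S \<Longrightarrow> s' \<in> carrier S \<Longrightarrow> \<epsilon> (s \<oplus> s') = \<epsilon> s + (\<epsilon> s' :: int)"
      "\<And>n. \<epsilon> \<guillemotleft>n\<guillemotright> = n"
    and Q_eq: "Q = {s \<in> carrier S. \<epsilon> s \<in> \<pp>}"
  defines "\<iota> \<equiv> \<lambda>s. tensor S (residue_field \<Z> \<pp>) s \<one>\<^bsub>residue_field \<Z> \<pp>\<^esub>"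
  shows "fraction_hom S (fibre S \<pp>) Q \<iota>"
    and "\<And>n. n \<in> \<pp> \<Longrightarrow> \<iota> \<guillemotleft>n\<guillemotright> = \<zero>\<^bsub>fibre S \<pp>\<^esub>"
    and "\<And>s d. s \<in> carrier S \<Longrightarrow> \<iota> s = \<zero>\<^bsub>fibre S \<pp>\<^esub> \<Longrightarrow>
      (\<And>s s'. s \<in> carrier S \<Longrightarrow> s' \<in> carrier S \<Longrightarrow> d (s \<oplus> s') = d s + d s') \<Longrightarrow> d s \<in> \<pp>"
proof -
  interpret S: cring S by fact
  let ?K = "residue_field \<Z> \<pp>"
  note K = residue_field_int[OF \<pp>]
  interpret K: cring ?K by (rule K(1))
  interpret TP: tensor_product S ?K by (intro tensor_product.intro S K(1))
  have int: "\<iota> \<guillemotleft>n\<guillemotright> = \<guillemotleft>n\<guillemotright>\<^bsub>fibre S \<pp>\<^esub>" for n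
    using S.ring_hom_of_integer[OF TP.P.cring_axioms TP.tensor_left_hom]
    by (simp add: \<iota>_def fibre_def)
  have P: "m * n \<notin> \<pp>" if "m \<notin> \<pp>" "n \<notin> \<pp>" for m n
    using primeideal.I_prime[OF \<pp>, of m n] that by auto
  show ker: "d s \<in> \<pp>" if "s \<in> carrier S" "\<iota> s = \<zero>\<^bsub>fibre S \<pp>\<^esub>"
    "\<And>s s'. s \<in> carrier S \<Longrightarrow> s' \<in> carrier S \<Longrightarrow> d (s \<oplus> s') = d s + d s'" for s d
    using TP.tensor_eq_zeroD[of s d] that K(3)
    by (simp add: \<iota>_def fibre_def TP.additive_def)
  show "fraction_hom S (fibre S \<pp>) Q \<iota>"
  proof (intro fraction_hom.intro fraction_hom_axioms.intro S Q)
    show "cring (fibre S \<pp>)" unfolding fibre_def by (rule TP.P.cring_axioms)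
    show "\<iota> \<in> ring_hom S (fibre S \<pp>)" unfolding fibre_def \<iota>_def by (rule TP.tensor_left_hom)
    fix w assume "w \<in> carrier (fibre S \<pp>)"
    then have w: "w \<in> carrier (tensor_ring S ?K)" by (simp only: fibre_def)
    have "\<exists>s\<in>carrier S. \<exists>n. n \<notin> \<pp> \<and> \<guillemotleft>n\<guillemotright>\<^bsub>fibre S \<pp>\<^esub> \<otimes>\<^bsub>fibre S \<pp>\<^esub> w = \<iota> s"
      unfolding fibre_def \<iota>_def
      by (rule TP.tensor_denominators, rule P, assumption+, rule K(2), assumption, rule w)
    then obtain s n where "s \<in> carrier S" "n \<notin> \<pp>" "\<guillemotleft>n\<guillemotright>\<^bsub>fibre S \<pp>\<^esub> \<otimes>\<^bsub>fibre S \<pp>\<^esub> w = \<iota> s"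
      by (elim bexE exE conjE)
    \<comment> \<open>The retraction shows that an integer outside \<open>\<pp>\<close> stays
      outside \<open>Q\<close>, so it is an admissible denominator.\<close>
    moreover from this have "\<guillemotleft>n\<guillemotright> \<in> carrier S - Q" by (simp add: Q_eq \<epsilon>)
    ultimately show "\<exists>s\<in>carrier S. \<exists>u\<in>carrier S - Q. \<iota> u \<otimes>\<^bsub>fibre S \<pp>\<^esub> w = \<iota> s"
      unfolding int[symmetric] by blast
  next
    fix s assume "s \<in> carrier S" "\<iota> s = \<zero>\<^bsub>fibre S \<pp>\<^esub>"
    then show "s \<in> Q" using ker[of s \<epsilon>] by (simp add: Q_eq \<epsilon>)
  qed
  show "\<iota> \<guillemotleft>n\<guillemotright> = \<zero>\<^bsub>fibre S \<pp>\<^esub>" if n: "n \<in> \<pp>" for n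
  proof -
    \<comment> \<open>The integer is moved into the residue field, where it vanishes.\<close>
    have "\<iota> \<guillemotleft>n\<guillemotright> = tensor S ?K \<one> \<guillemotleft>n\<guillemotright>\<^bsub>?K\<^esub>"
      using TP.tensor_int_left[of \<one> "\<one>\<^bsub>?K\<^esub>" n] TP.tensor_int_right[of \<one> "\<one>\<^bsub>?K\<^esub>" n]
      by (simp add: \<iota>_def)
    also have "\<dots> = \<zero>\<^bsub>fibre S \<pp>\<^esub>"
      using K(3)[of n] n ring_hom_zero[OF TP.tensor_right_hom] TP.P.ring_axioms K.ring_axioms
      by (simp add: fibre_def)
    finally show ?thesis .
  qed
qed

subsection \<open>Finitely generated torsionfree groups\<close>

text \<open>The elementary step of integral elimination: multiplying one generator by a power of
  another is compensated by changing the exponent of the latter.\<close>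

lemma (in comm_group) finprod_change_generator:
  fixes h :: "'i \<Rightarrow> int"
  assumes "finite I" "i \<in> I" "j \<in> I" "i \<noteq> j" and g: "\<And>k. k \<in> I \<Longrightarrow> g k \<in> carrier G"
  shows "(\<Otimes>k\<in>I. (g(j := g j \<otimes> g i [^] \<sigma>)) k [^] (h(i := h i - \<sigma> * h j)) k) =
    (\<Otimes>k\<in>I. g k [^] h k)"
proof -
  let ?J = "I - {i, j}"
  have I: "I = insert i (insert j ?J)" using assms by auto
  have gi: "g i \<in> carrier G" "g j \<in> carrier G" using assms by auto
  have rest: "(\<Otimes>k\<in>?J. (g(j := g j \<otimes> g i [^] \<sigma>)) k [^] (h(i := h i - \<sigma> * h j)) k) =
      (\<Otimes>k\<in>?J. g k [^] h k)"
    using g by (intro finprod_cong') auto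
  have c: "(\<Otimes>k\<in>?J. g k [^] h k) \<in> carrier G" using g by (intro finprod_closed) auto
  have "g i [^] (h i - \<sigma> * h j) \<otimes> (g j \<otimes> g i [^] \<sigma>) [^] h j =
      g i [^] (h i - \<sigma> * h j) \<otimes> (g j [^] h j \<otimes> g i [^] (\<sigma> * h j))"
    using gi by (simp add: int_pow_distrib int_pow_pow)
  also have "\<dots> = (g i [^] (h i - \<sigma> * h j) \<otimes> g i [^] (\<sigma> * h j)) \<otimes> g j [^] h j"
    using gi by (simp add: m_ac)
  also have "\<dots> = g i [^] h i \<otimes> g j [^] h j"
    using gi by (simp flip: int_pow_mult)
  finally have ij: "g i [^] (h i - \<sigma> * h j) \<otimes> (g j \<otimes> g i [^] \<sigma>) [^] h j = g i [^] h i \<otimes> g j [^] h j" .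
  have "(\<Otimes>k\<in>I. (g(j := g j \<otimes> g i [^] \<sigma>)) k [^] (h(i := h i - \<sigma> * h j)) k) =
      g i [^] (h i - \<sigma> * h j) \<otimes> ((g j \<otimes> g i [^] \<sigma>) [^] h j \<otimes> (\<Otimes>k\<in>?J. g k [^] h k))"
    using assms gi rest c
    by (subst I, subst finprod_insert, simp, simp, force, force, subst finprod_insert, simp, simp, force, force) simp
  also have "\<dots> = g i [^] h i \<otimes> (g j [^] h j \<otimes> (\<Otimes>k\<in>?J. g k [^] h k))"
    using gi c ij by (simp add: m_assoc[symmetric])
  also have "\<dots> = (\<Otimes>k\<in>I. g k [^] h k)"
    using assms gi c
    by (subst I, subst finprod_insert, simp, simp, force, force, subst finprod_insert, simp, simp, force, force) simp
  finally show ?thesis .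
qed

text \<open>Among the smallest generating families and their nontrivial relations one with least sum of
  absolute values of the exponents would still be improved by a step of Euclid's algorithm.\<close>

lemma (in comm_group) torsion_free_basis:
  assumes S: "finite S" "S \<subseteq> carrier G"
      "\<And>u. u \<in> carrier G \<Longrightarrow> \<exists>h :: 'a \<Rightarrow> int. u = (\<Otimes>s\<in>S. s [^] h s)"
    and tf: "\<And>u n. u \<in> carrier G \<Longrightarrow> 1 \<le> n \<Longrightarrow> u [^] (n :: nat) = \<one> \<Longrightarrow> u = \<one>"
  obtains I :: "'a set" and g where "finite I" "g \<in> I \<rightarrow> carrier G"
    "\<And>u. u \<in> carrier G \<Longrightarrow> \<exists>h :: 'a \<Rightarrow> int. u = (\<Otimes>i\<in>I. g i [^] h i)"
    "\<And>h i. (\<Otimes>i\<in>I. g i [^] (h i :: int)) = \<one> \<Longrightarrow> i \<in> I \<Longrightarrow> h i = 0"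
proof -
  define P where "P = (\<lambda>(I :: 'a set) g (h :: 'a \<Rightarrow> int). \<Otimes>i\<in>I. g i [^] h i)"
  define gens where "gens = (\<lambda>I g. finite I \<and> (\<forall>i\<in>I. g i \<in> carrier G) \<and> (\<forall>u\<in>carrier G. \<exists>h. u = P I g h))"
  have "gens S (\<lambda>s. s)" using S by (auto simp: gens_def P_def)
  then have "\<exists>I g. gens I g" by blast
  then obtain I where I: "\<exists>g. gens I g" and I_min: "\<And>J g. gens J g \<Longrightarrow> card I \<le> card J"
    using ex_has_least_nat[of "\<lambda>I. \<exists>g. gens I g" _ card] by blast
  define rel where "rel = (\<lambda>(g, h). gens I g \<and> P I g h = \<one> \<and> (\<exists>i\<in>I. h i \<noteq> 0))"
  have "\<not> rel x" for x
  proof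
    assume "rel x"
    then obtain g h where gh: "rel (g, h)"
      and min: "\<And>g' h'. rel (g', h') \<Longrightarrow> (\<Sum>i\<in>I. nat \<bar>h i\<bar>) \<le> (\<Sum>i\<in>I. nat \<bar>h' i\<bar>)"
      using ex_has_least_nat[of rel x "\<lambda>(g, h). \<Sum>i\<in>I. nat \<bar>h i\<bar>"] by auto
    have fin: "finite I" and g: "\<And>i. i \<in> I \<Longrightarrow> g i \<in> carrier G" and gen: "gens I g"
      and one: "P I g h = \<one>"
      using gh by (auto simp: rel_def gens_def)
    obtain i where i: "i \<in> I" "h i \<noteq> 0" using gh by (auto simp: rel_def)
    show False
    proof (cases "\<exists>j\<in>I. j \<noteq> i \<and> h j \<noteq> 0")
      \<comment> \<open>A relation in a single generator makes it a torsion element, hence trivial,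
        so a smaller family would generate the group.\<close>
      case False
      have split: "P I g f = g i [^] f i \<otimes> P (I - {i}) g f" for f
        unfolding P_def using fin g i
        by (subst insert_Diff[OF i(1), symmetric], subst finprod_insert) auto
      have "P (I - {i}) g h = \<one>"
        unfolding P_def using False by (intro finprod_one_eqI) auto
      then have gi: "g i [^] h i = \<one>" using split[of h] one g i by simp
      have "g i [^] nat \<bar>h i\<bar> = \<one>"
      proof (cases "h i")
        case (nonneg n)
        then show ?thesis using gi by (simp add: int_pow_int)
      next
        case (neg n)
        then have "inv (g i [^] Suc n) = \<one>"
          using gi g i by (simp only: int_pow_neg int_pow_int)
        then have "g i [^] Suc n = \<one>" using g i by (metis inv_inv inv_one nat_pow_closed)
        then show ?thesis using neg by (simp only: abs_minus_cancel abs_of_nat nat_int)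
      qed
      then have "g i = \<one>" using tf[of "g i" "nat \<bar>h i\<bar>"] g i by simp
      then have "P I g f = P (I - {i}) g f" for f
        using split[of f] g by (simp add: P_def Pi_iff)
      then have "gens (I - {i}) g" using gen by (auto simp: gens_def)
      then have "card I \<le> card (I - {i})" by (rule I_min)
      then show False using card_Diff1_less[OF fin i(1)] by simp
    next
      case True
      then obtain j where j: "j \<in> I" "j \<noteq> i" "h j \<noteq> 0" by blast
      obtain a b where ab: "a \<in> I" "b \<in> I" "a \<noteq> b" "h b \<noteq> 0" "\<bar>h b\<bar> \<le> \<bar>h a\<bar>"
        using i j by (metis linear)
      \<comment> \<open>With this sign, \<open>\<bar>h a - \<sigma> * h b\<bar> = \<bar>h a\<bar> -
        \<bar>h b\<bar>\<close>, which is smaller than \<open>\<bar>h a\<bar>\<close> as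
        \<open>h b\<close> is nonzero.\<close>
      define \<sigma> where "\<sigma> = sgn (h a) * sgn (h b)"
      define g' where "g' = g(b := g b \<otimes> g a [^] \<sigma>)"
      have P': "P I g' (f(a := f a - \<sigma> * f b)) = P I g f" for f
        unfolding P_def g'_def using finprod_change_generator[OF fin ab(1,2,3) g] .
      have "gens I g'"
        unfolding gens_def
      proof (intro conjI ballI)
        show "finite I" by (rule fin)
        show "g' k \<in> carrier G" if "k \<in> I" for k using g ab that by (simp add: g'_def)
        show "\<exists>f. u = P I g' f" if "u \<in> carrier G" for u
          using gen that P' unfolding gens_def by metis
      qed
      moreover have "P I g' (h(a := h a - \<sigma> * h b)) = \<one>" using P' one by simp
      \<comment> \<open>The exponent at \<open>b\<close> is unchanged, so the new relation is still
        nontrivial.\<close>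
      moreover have "(h(a := h a - \<sigma> * h b)) b \<noteq> 0" using ab by simp
      ultimately have "rel (g', h(a := h a - \<sigma> * h b))" unfolding rel_def using ab(2) by blast
      from min[OF this] have le: "(\<Sum>i\<in>I. nat \<bar>h i\<bar>) \<le> (\<Sum>i\<in>I. nat \<bar>(h(a := h a - \<sigma> * h b)) i\<bar>)" .
      have "nat \<bar>h a - \<sigma> * h b\<bar> < nat \<bar>h a\<bar>"
        using ab by (auto simp: \<sigma>_def sgn_if split: if_splits)
      then have "(\<Sum>i\<in>I. nat \<bar>(h(a := h a - \<sigma> * h b)) i\<bar>) < (\<Sum>i\<in>I. nat \<bar>h i\<bar>)"
        using fin ab(1) by (intro sum_strict_mono_ex1) auto
      then show False using le by simp
    qed
  qed
  then have "\<And>g h i. gens I g \<Longrightarrow> P I g h = \<one> \<Longrightarrow> i \<in> I \<Longrightarrow> h i = 0"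
    unfolding rel_def by blast
  moreover obtain g where "gens I g" using I by blast
  ultimately show ?thesis
    by (intro that[of I g]) (auto simp: gens_def P_def)
qed

subsection \<open>Binomial coefficients of integers\<close>

text \<open>The generalized binomial coefficient \<open>h gchoose e\<close>, but with values in the
  integers so that it can be tested for membership in an ideal of \<open>\<int>\<close>. For any
  integer \<open>h\<close> it is the coefficient of \<open>(g - 1) ^ e\<close> in the expansion of
  \<open>g ^ h\<close> at \<open>g = 1\<close>. In the second branch
  \<open>nat (- h) \<ge> 1\<close>, so the subtraction is not truncated.\<close>

definition int_binomial :: "int \<Rightarrow> nat \<Rightarrow> int" where
  "int_binomial h e = (if 0 \<le> h then int (nat h choose e)
    else (- 1) ^ e * int ((nat (- h) + e - 1) choose e))"

lemma of_int_binomial: "(of_int (int_binomial h e) :: rat) = of_int h gchoose e"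
proof (cases "0 \<le> h")
  case True
  then have "(of_int h :: rat) = of_nat (nat h)" by simp
  then show ?thesis using True by (simp add: int_binomial_def binomial_gbinomial)
next
  case False
  define n where "n = nat (- h)"
  have n: "h = - int n" "n > 0" using False by (auto simp: n_def)
  then have "(of_int h gchoose e :: rat) = (- 1) ^ e * (of_nat n + of_nat e - 1 gchoose e)"
    by (simp add: gbinomial_minus)
  also have "(of_nat n + of_nat e - 1 :: rat) = of_nat (n + e - 1)"
    using n(2) by (simp add: of_nat_diff)
  finally show ?thesis
    using False by (simp add: int_binomial_def binomial_gbinomial n_def)
qed

lemma int_binomial_0 [simp]: "int_binomial h 0 = 1"
  by (simp add: int_binomial_def)

lemma int_binomial_0_left: "int_binomial 0 (Suc e) = 0"
  by (simp add: int_binomial_def)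

lemma int_binomial_Suc_Suc: "int_binomial (h + 1) (Suc e) = int_binomial h (Suc e) + int_binomial h e"
proof -
  have "(of_int (int_binomial (h + 1) (Suc e)) :: rat) =
      of_int (int_binomial h (Suc e) + int_binomial h e)"
    unfolding of_int_add of_int_binomial using gbinomial_Suc_Suc[of "of_int h :: rat" e] by simp
  then show ?thesis by (simp only: of_int_eq_iff)
qed

lemma int_binomial_Vandermonde:
  "int_binomial (h + d) e = (\<Sum>j\<le>e. int_binomial h j * int_binomial d (e - j))"
proof -
  have "(of_int (int_binomial (h + d) e) :: rat) =
      of_int (\<Sum>j\<le>e. int_binomial h j * int_binomial d (e - j))"
    by (simp add: of_int_binomial gbinomial_Vandermonde flip: atLeast0AtMost)
  then show ?thesis by (simp only: of_int_eq_iff)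
qed

text \<open>The coefficient of \<open>\<Prod>i\<in>I. (g i - 1) ^ e i\<close> in the expansion of
  the Laurent monomial with exponents \<open>h\<close>.\<close>

definition multi_binomial :: "'i set \<Rightarrow> ('i \<Rightarrow> int) \<Rightarrow> ('i \<Rightarrow> nat) \<Rightarrow> int" where
  "multi_binomial I h e = (\<Prod>i\<in>I. int_binomial (h i) (e i))"

lemma multi_binomial_cong:
  "(\<And>i. i \<in> I \<Longrightarrow> h i = h' i) \<Longrightarrow> (\<And>i. i \<in> I \<Longrightarrow> e i = e' i) \<Longrightarrow>
    multi_binomial I h e = multi_binomial I h' e'"
  unfolding multi_binomial_def by (intro prod.cong) auto

lemma multi_binomial_0_right: "(\<And>i. i \<in> I \<Longrightarrow> e i = 0) \<Longrightarrow> multi_binomial I h e = 1"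
  by (simp add: multi_binomial_def)

lemma multi_binomial_0_left:
  assumes "finite I" "i \<in> I" "e i \<noteq> 0" "\<And>i. i \<in> I \<Longrightarrow> h i = 0"
  shows "multi_binomial I h e = 0"
proof -
  obtain n where "e i = Suc n" using assms not0_implies_Suc by blast
  then have "int_binomial (h i) (e i) = 0" using assms by (simp add: int_binomial_0_left)
  then show ?thesis unfolding multi_binomial_def using assms by (auto intro: prod_zero)
qed

text \<open>For Laurent monomials this is the Leibniz rule for the Taylor coefficients of a
  product.\<close>

lemma multi_binomial_Vandermonde:
  assumes "finite I"
  shows "multi_binomial I (\<lambda>i. h i + d i) e =
    (\<Sum>f\<in>PiE I (\<lambda>i. {..e i}). multi_binomial I d (\<lambda>i. e i - f i) * multi_binomial I h f)"
  unfolding multi_binomial_def int_binomial_Vandermonde using assms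
  by (subst prod_sum_PiE) (auto simp: prod.distrib mult.commute)

text \<open>Pascal's rule in one variable: multiplying by \<open>g i - 1\<close> is a difference
  operator and lowers the index \<open>e i\<close> by one.\<close>

lemma multi_binomial_Suc:
  assumes "finite I" "i \<in> I"
  shows "multi_binomial I (h(i := h i + 1)) e =
    multi_binomial I h e + (if e i = 0 then 0 else multi_binomial I h (e(i := e i - 1)))"
proof -
  have split: "multi_binomial I f g = int_binomial (f i) (g i) * multi_binomial (I - {i}) f g" for f g
    unfolding multi_binomial_def using assms by (rule prod.remove)
  have rest: "multi_binomial (I - {i}) (h(i := x)) f = multi_binomial (I - {i}) h f"
    "multi_binomial (I - {i}) h (f(i := y)) = multi_binomial (I - {i}) h f" for x y f
    by (rule multi_binomial_cong; auto)+
  show ?thesis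
  proof (cases "e i")
    case 0
    then show ?thesis by (simp add: split rest)
  next
    case (Suc n)
    then show ?thesis
      using int_binomial_Suc_Suc[of "h i" n] by (simp add: split rest distrib_right)
  qed
qed

subsection \<open>The units of a toric monoid\<close>

text \<open>Finite generation of \<open>A\<close> is tested against submonoids, hence the form of
  the statement; the integer exponents already include the inverses.\<close>

lemma (in comm_monoid) finprod_int_pow_generators:
  assumes "comm_group G" "finite S" "S \<subseteq> carrier G"
  shows "submonoid {u. \<exists>h :: 'a \<Rightarrow> int. u = (\<Otimes>s\<in>S. s [^] h s)} G"
    and "S \<subseteq> {u. \<exists>h :: 'a \<Rightarrow> int. u = (\<Otimes>s\<in>S. s [^] h s)}"
proof -
  interpret G: comm_group G by fact
  have c: "s [^] (k :: int) \<in> carrier G" if "s \<in> S" for s k using assms that by auto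
  show "submonoid {u. \<exists>h :: 'a \<Rightarrow> int. u = (\<Otimes>s\<in>S. s [^] h s)} G"
  proof (unfold_locales, goal_cases)
    case 1
    then show ?case using c by (auto intro!: finprod_closed)
  next
    case (2 x y)
    then obtain h h' :: "'a \<Rightarrow> int" where "x = (\<Otimes>s\<in>S. s [^] h s)" "y = (\<Otimes>s\<in>S. s [^] h' s)"
      by blast
    then have "x \<otimes> y = (\<Otimes>s\<in>S. s [^] h s \<otimes> s [^] h' s)"
      using c by (simp add: finprod_multf Pi_iff)
    also have "\<dots> = (\<Otimes>s\<in>S. s [^] (h s + h' s))"
      using assms c by (intro finprod_cong') (auto simp: G.int_pow_mult subset_iff)
    finally show ?case by (intro CollectI exI[of _ "\<lambda>s. h s + h' s"])
  next
    case 3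
    have "\<one> = (\<Otimes>s\<in>S. s [^] (0 :: int))" by (simp add: finprod_one_eqI)
    then show ?case by (intro CollectI exI[of _ "\<lambda>_. 0"])
  qed
  show "S \<subseteq> {u. \<exists>h :: 'a \<Rightarrow> int. u = (\<Otimes>s\<in>S. s [^] h s)}"
  proof
    fix t assume t: "t \<in> S"
    have "(\<Otimes>s\<in>S. s [^] (if s = t then 1 else 0 :: int)) = (\<Otimes>s\<in>S. if t = s then s else \<one>)"
      using assms by (intro finprod_cong') (auto simp: subset_iff)
    also have "\<dots> = t" using assms t by (intro finprod_singleton) auto
    finally have "t = (\<Otimes>s\<in>S. s [^] (if s = t then 1 else 0 :: int))" ..
    then show "t \<in> {u. \<exists>h :: 'a \<Rightarrow> int. u = (\<Otimes>s\<in>S. s [^] h s)}"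
      by (intro CollectI exI[of _ "\<lambda>s. if s = t then 1 else 0"])
  qed
qed

context toric_monoid
begin

text \<open>If \<open>a \<otimes> b\<close> were zero it would equal
  \<open>a \<otimes> pzero A\<close>, and \<open>a\<close> could be cancelled.\<close>

lemma mult_nonzero: "a \<in> nonzero A \<Longrightarrow> b \<in> nonzero A \<Longrightarrow> a \<otimes> b \<in> nonzero A"
  using cancellative[of a b "pzero A"] pzero_closed pzero_absorbing[of a] by (auto simp: nonzero_def)

lemma nonzero_cancel:
  "a \<in> nonzero A \<Longrightarrow> b \<in> carrier A \<Longrightarrow> c \<in> carrier A \<Longrightarrow> a \<otimes> b = a \<otimes> c \<Longrightarrow> b = c"
  using cancellative[of a b c] by (auto simp: nonzero_def)

lemma nonzero_carrier: "a \<in> nonzero A \<Longrightarrow> a \<in> carrier A"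
  by (simp add: nonzero_def)

end

locale nontrivial_toric_monoid = toric_monoid +
  assumes one_neq_pzero: "\<one> \<noteq> pzero A"
begin

lemma Units_nonzero: "u \<in> Units A \<Longrightarrow> u \<in> nonzero A"
  using one_neq_pzero pzero_absorbing[of "inv u"] Units_l_inv[of u] pzero_closed
  by (auto simp: nonzero_def)

lemma one_nonzero': "\<one> \<in> nonzero A"
  using one_neq_pzero by (simp add: nonzero_def)

lemma nonunit_mult: "a \<in> carrier A - Units A \<Longrightarrow> b \<in> carrier A \<Longrightarrow> a \<otimes> b \<in> carrier A - Units A"
  using unit_factor[of a b] by auto

text \<open>A factor of a unit is a unit, so those generators of \<open>A\<close> that are units
  generate the group of units: the group they generate and all nonunits together form a submonoid
  that contains every generator. Torsionfreeness of \<open>A\<close>, compared with powers of one,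
  then provides a basis.\<close>

lemma units_basis:
  obtains I :: "'a set" and g where "finite I" "g \<in> I \<rightarrow> Units A"
    "\<And>u. u \<in> Units A \<Longrightarrow> \<exists>h :: 'a \<Rightarrow> int. u = finprod (units_of A) (\<lambda>i. g i [^]\<^bsub>units_of A\<^esub> h i) I"
    "\<And>h i. finprod (units_of A) (\<lambda>i. g i [^]\<^bsub>units_of A\<^esub> (h i :: int)) I = \<one> \<Longrightarrow> i \<in> I \<Longrightarrow> h i = 0"
proof -
  interpret U: comm_group "units_of A" by (rule units_comm_group)
  obtain S where S: "finite S" "S \<subseteq> carrier A"
    and gen': "\<forall>H. submonoid H A \<and> pzero A \<in> H \<and> S \<subseteq> H \<longrightarrow> H = carrier A"
    using finitely_generated by (elim exE conjE)
  have gen: "H = carrier A" if "submonoid H A" "pzero A \<in> H" "S \<subseteq> H" for H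
    using gen' that by simp
  let ?S = "S \<inter> Units A"
  define P where "P = {u. \<exists>h :: 'a \<Rightarrow> int. u = finprod (units_of A) (\<lambda>s. s [^]\<^bsub>units_of A\<^esub> h s) ?S}"
  have P: "submonoid P (units_of A)" "?S \<subseteq> P"
    using U.finprod_int_pow_generators[OF U.comm_group_axioms, of ?S] S
    by (auto simp: P_def units_of_carrier)
  have PU: "P \<subseteq> Units A" using submonoid.subset[OF P(1)] by (simp add: units_of_carrier)
  let ?H = "(carrier A - Units A) \<union> P"
  have "?H = carrier A"
  proof (rule gen)
    show "submonoid ?H A"
    proof (unfold_locales, goal_cases)
      case 1
      then show ?case using PU by auto
    next
      case (2 x y)
      show ?case
      proof (cases "x \<in> P \<and> y \<in> P")
        case True
        then show ?thesis using submonoid.m_closed[OF P(1)] by (simp add: units_of_mult)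
      next
        case False
        have "x \<in> carrier A" "y \<in> carrier A" using 2 PU by auto
        with False have "x \<otimes> y \<in> carrier A - Units A"
          using 2 PU nonunit_mult[of x y] nonunit_mult[of y x] m_comm[of x y] by auto
        then show ?thesis by blast
      qed
    next
      case 3
      then show ?case using submonoid.one_closed[OF P(1)] by (simp add: units_of_one)
    qed
    show "pzero A \<in> ?H" using Units_nonzero[of "pzero A"] pzero_closed by (auto simp: nonzero_def)
    show "S \<subseteq> ?H" using S P by blast
  qed
  then have "Units A \<subseteq> P" by blast
  then have gen_U: "\<exists>h :: 'a \<Rightarrow> int. u = finprod (units_of A) (\<lambda>s. s [^]\<^bsub>units_of A\<^esub> h s) ?S"
    if "u \<in> carrier (units_of A)" for u
    using that by (auto simp: P_def units_of_carrier)
  have tf: "u = \<one>\<^bsub>units_of A\<^esub>"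
    if "u \<in> carrier (units_of A)" "1 \<le> n" "u [^]\<^bsub>units_of A\<^esub> (n :: nat) = \<one>\<^bsub>units_of A\<^esub>" for u n
  proof -
    have u: "u \<in> Units A" using that by (simp add: units_of_carrier)
    then have "u [^] n = \<one> [^] n" using that by (simp add: units_of_pow units_of_one)
    then show ?thesis using torsionfree[of u \<one> n] u that(2) by (simp add: units_of_one Units_closed)
  qed
  have "finite ?S" "?S \<subseteq> carrier (units_of A)" using S by (auto simp: units_of_carrier)
  show ?thesis
  proof (rule U.torsion_free_basis)
    show "finite ?S" "?S \<subseteq> carrier (units_of A)" by fact+
    show "\<exists>h :: 'a \<Rightarrow> int. u = finprod (units_of A) (\<lambda>s. s [^]\<^bsub>units_of A\<^esub> h s) ?S"
      if "u \<in> carrier (units_of A)" for u using that by (rule gen_U)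
    show "u = \<one>\<^bsub>units_of A\<^esub>"
      if "u \<in> carrier (units_of A)" "1 \<le> n" "u [^]\<^bsub>units_of A\<^esub> (n :: nat) = \<one>\<^bsub>units_of A\<^esub>" for u n
      using that by (rule tf)
    fix I :: "'a set" and g
    assume "finite I" "g \<in> I \<rightarrow> carrier (units_of A)"
      "\<And>u. u \<in> carrier (units_of A) \<Longrightarrow>
        \<exists>h :: 'a \<Rightarrow> int. u = finprod (units_of A) (\<lambda>i. g i [^]\<^bsub>units_of A\<^esub> h i) I"
      "\<And>h i. finprod (units_of A) (\<lambda>i. g i [^]\<^bsub>units_of A\<^esub> (h i :: int)) I = \<one>\<^bsub>units_of A\<^esub> \<Longrightarrow>
        i \<in> I \<Longrightarrow> h i = 0"
    then show thesis
      unfolding units_of_carrier units_of_one by (rule that)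
  qed
qed

text \<open>The powers of the maximal ideal of the monoid, without zero.\<close>

primrec nonunit_power :: "nat \<Rightarrow> 'a set" where
  "nonunit_power 0 = nonzero A"
| "nonunit_power (Suc m) = {a \<otimes> b | a b. a \<in> nonzero A - Units A \<and> b \<in> nonunit_power m}"

lemma nonunit_power_nonzero: "a \<in> nonunit_power m \<Longrightarrow> a \<in> nonzero A"
  by (induction m arbitrary: a) (auto intro: mult_nonzero)

lemma nonunit_power_mult:
  assumes "a \<in> nonzero A" "b \<in> nonunit_power m"
  shows "a \<otimes> b \<in> nonunit_power m"
  using assms(2)
proof (induction m arbitrary: b)
  case 0
  then show ?case using assms by (auto intro: mult_nonzero)
next
  case (Suc m)
  then obtain c d where cd: "c \<in> nonzero A - Units A" "d \<in> nonunit_power m" "b = c \<otimes> d" by auto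
  have "a \<otimes> b = c \<otimes> (a \<otimes> d)"
    using cd assms(1) nonunit_power_nonzero[OF cd(2)] by (simp add: m_lcomm nonzero_carrier)
  then show ?case using Suc.IH[OF cd(2)] cd(1) by auto
qed

text \<open>An element outside \<open>nonunit_power m\<close> is, up to a unit, a product of fewer
  than \<open>m\<close> generators: a nonunit is divisible by a generator that is a nonunit, and the
  cofactor is treated by induction. This makes the number of indices finite.\<close>

lemma finite_classes:
  "\<exists>C. finite C \<and> C \<subseteq> nonzero A \<and>
    (\<forall>a\<in>nonzero A. a \<in> nonunit_power m \<or> (\<exists>c\<in>C. \<exists>u\<in>Units A. a = c \<otimes> u))"
proof -
  obtain S where S: "finite S" "S \<subseteq> carrier A"
    and gen': "\<forall>H. submonoid H A \<and> pzero A \<in> H \<and> S \<subseteq> H \<longrightarrow> H = carrier A"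
    using finitely_generated by (elim exE conjE)
  have gen: "H = carrier A" if "submonoid H A" "pzero A \<in> H" "S \<subseteq> H" for H
    using gen' that by simp
  let ?S = "S \<inter> nonzero A - Units A"
  \<comment> \<open>Zero, the units and the multiples of nonunit generators are closed under
    products and contain all generators, so they exhaust \<open>A\<close>.\<close>
  let ?H = "{pzero A} \<union> Units A \<union> {s \<otimes> b | s b. s \<in> ?S \<and> b \<in> nonzero A}"
  have sub: "?H \<subseteq> carrier A" using S pzero_closed by (auto simp: nonzero_carrier)
  have "?H = carrier A"
  proof (rule gen)
    show "submonoid ?H A"
    proof (unfold_locales, goal_cases)
      case 1
      then show ?case by (rule sub)
    next
      case (2 x y)
      have xy: "x \<in> carrier A" "y \<in> carrier A" using 2 sub by auto
      consider "x = pzero A \<or> y = pzero A" | "x \<in> Units A" "y \<in> Units A"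
        | s b where "x = s \<otimes> b" "s \<in> ?S" "b \<in> nonzero A" "y \<in> nonzero A"
        | s b where "y = s \<otimes> b" "s \<in> ?S" "b \<in> nonzero A" "x \<in> nonzero A"
        using 2 Units_nonzero xy unfolding nonzero_def by blast
      then show ?case
      proof cases
        case 1
        then have "x \<otimes> y = pzero A"
          using pzero_absorbing[of x] pzero_absorbing[of y] m_comm[of x y] xy by auto
        then show ?thesis by blast
      next
        case 2
        then show ?thesis by blast
      next
        case (3 s b)
        then have "x \<otimes> y = s \<otimes> (b \<otimes> y)" "b \<otimes> y \<in> nonzero A"
          by (auto simp: m_assoc nonzero_carrier intro: mult_nonzero)
        then show ?thesis using 3 by blast
      next
        case (4 s b)
        then have "x \<otimes> y = s \<otimes> (x \<otimes> b)" "x \<otimes> b \<in> nonzero A"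
          by (auto simp: m_lcomm nonzero_carrier intro: mult_nonzero)
        then show ?thesis using 4 by blast
      qed
    qed auto
    show "pzero A \<in> ?H" by blast
    show "S \<subseteq> ?H"
    proof
      fix s assume "s \<in> S"
      then have "s \<in> ?S \<or> s \<in> {pzero A} \<union> Units A" using S by (auto simp: nonzero_def)
      moreover have "s = s \<otimes> \<one>" using \<open>s \<in> S\<close> S by auto
      ultimately show "s \<in> ?H" using one_nonzero' by blast
    qed
  qed
  then have factor: "a \<in> Units A \<or> (\<exists>s\<in>?S. \<exists>b\<in>nonzero A. a = s \<otimes> b)" if "a \<in> nonzero A" for a
    using that unfolding nonzero_def by blast
  show ?thesis
  proof (induction m)
    case 0
    then show ?case by auto
  next
    case (Suc m)
    then obtain C where C: "finite C" "C \<subseteq> nonzero A"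
      "\<And>a. a \<in> nonzero A \<Longrightarrow> a \<in> nonunit_power m \<or> (\<exists>c\<in>C. \<exists>u\<in>Units A. a = c \<otimes> u)" by blast
    let ?C = "insert \<one> ((\<lambda>(s, c). s \<otimes> c) ` (?S \<times> C))"
    have "a \<in> nonunit_power (Suc m) \<or> (\<exists>c\<in>?C. \<exists>u\<in>Units A. a = c \<otimes> u)" if a: "a \<in> nonzero A" for a
    proof (cases "a \<in> Units A")
      case True
      then show ?thesis by (intro disjI2 bexI[of _ \<one>] bexI[of _ a]) auto
    next
      case False
      then obtain s b where s: "s \<in> ?S" "b \<in> nonzero A" "a = s \<otimes> b" using factor[OF a] by blast
      show ?thesis
      proof (cases "b \<in> nonunit_power m")
        case True
        then show ?thesis using s by auto
      next
        case False
        then obtain c u where "c \<in> C" "u \<in> Units A" "b = c \<otimes> u" using C(3)[OF s(2)] by blast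
        then show ?thesis
          using s C(2) by (intro disjI2 bexI[of _ "s \<otimes> c"] bexI[of _ u]) (auto simp: m_assoc subset_iff nonzero_carrier)
      qed
    qed
    moreover have "finite ?C" "?C \<subseteq> nonzero A"
      using C S one_nonzero' by (auto intro!: mult_nonzero)
    ultimately show ?case by blast
  qed
qed

end

lemma int_idealD:
  assumes "ideal P \<Z>"
  shows "\<And>m n. m \<in> P \<Longrightarrow> n \<in> P \<Longrightarrow> m + n \<in> P" "\<And>m n. n \<in> P \<Longrightarrow> m * n \<in> P" "0 \<in> P"
    "\<And>n. n \<in> P \<Longrightarrow> - n \<in> P"
    "\<And>m n. m - n \<in> P \<Longrightarrow> m \<in> P \<Longrightarrow> n \<in> P" "\<And>m n. m - n \<in> P \<Longrightarrow> n \<in> P \<Longrightarrow> m \<in> P"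
proof -
  interpret P: ideal P \<Z> by fact
  show add: "\<And>m n. m \<in> P \<Longrightarrow> n \<in> P \<Longrightarrow> m + n \<in> P" using P.a_closed by simp
  show mult: "\<And>m n. n \<in> P \<Longrightarrow> m * n \<in> P" using P.I_l_closed by simp
  show "0 \<in> P" using additive_subgroup.zero_closed[OF P.additive_subgroup_axioms] by simp
  show neg: "\<And>n. n \<in> P \<Longrightarrow> - n \<in> P" using mult[of _ "- 1"] by simp
  show "n \<in> P" if "m - n \<in> P" "m \<in> P" for m n
    using add[OF that(2) neg[OF that(1)]] by simp
  show "m \<in> P" if "m - n \<in> P" "n \<in> P" for m n
    using add[OF that] by simp
qed

subsection \<open>Coordinates on a toric monoid\<close>

locale toric_coordinates = nontrivial_toric_monoid +
  fixes I :: "'a set" and g :: "'a \<Rightarrow> 'a"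
  assumes finite_I: "finite I" and basis_units: "g \<in> I \<rightarrow> Units A"
    and basis_generates: "u \<in> Units A \<Longrightarrow>
      \<exists>h :: 'a \<Rightarrow> int. u = finprod (units_of A) (\<lambda>i. g i [^]\<^bsub>units_of A\<^esub> h i) I"
    and basis_independent: "finprod (units_of A) (\<lambda>i. g i [^]\<^bsub>units_of A\<^esub> (h i :: int)) I = \<one> \<Longrightarrow>
      i \<in> I \<Longrightarrow> h i = 0"
begin

sublocale U: comm_group "units_of A"
  rewrites "carrier (units_of A) = Units A" and "monoid.mult (units_of A) = monoid.mult A" and "one (units_of A) = one A"
  by (rule units_comm_group) (simp_all add: units_of_carrier units_of_mult units_of_one)

definition unit :: "('a \<Rightarrow> int) \<Rightarrow> 'a" where
  "unit h = finprod (units_of A) (\<lambda>i. g i [^]\<^bsub>units_of A\<^esub> h i) I"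

lemma unit_Units: "unit h \<in> Units A"
  unfolding unit_def using basis_units by (intro U.finprod_closed) auto

lemma unit_nonzero: "unit h \<in> nonzero A"
  using unit_Units by (rule Units_nonzero)

lemma unit_closed [simp]: "unit h \<in> carrier A"
  using unit_Units by (rule Units_closed)

lemma unit_cong: "(\<And>i. i \<in> I \<Longrightarrow> h i = h' i) \<Longrightarrow> unit h = unit h'"
  unfolding unit_def using basis_units by (intro U.finprod_cong') auto

lemma unit_add: "unit (\<lambda>i. h i + h' i) = unit h \<otimes> unit h'"
proof -
  have "unit (\<lambda>i. h i + h' i) =
      finprod (units_of A) (\<lambda>i. g i [^]\<^bsub>units_of A\<^esub> h i \<otimes> g i [^]\<^bsub>units_of A\<^esub> h' i) I"
    unfolding unit_def using basis_units by (intro U.finprod_cong') (auto intro!: U.int_pow_mult)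
  then show ?thesis
    unfolding unit_def using basis_units by (subst (asm) U.finprod_multf) auto
qed

lemma unit_0: "unit (\<lambda>_. 0) = \<one>"
  unfolding unit_def by (intro U.finprod_one_eqI) (simp add: units_of_one)

lemma unit_basis:
  assumes "i \<in> I"
  shows "unit (\<lambda>k. if k = i then 1 else 0) = g i"
proof -
  have "unit (\<lambda>k. if k = i then 1 else 0) = finprod (units_of A) (\<lambda>k. if i = k then g k else \<one>) I"
    unfolding unit_def using basis_units
    by (intro U.finprod_cong') (auto simp: units_of_one U.int_pow_1 Pi_iff)
  also have "\<dots> = g i"
    using U.finprod_singleton[OF assms finite_I, of g] basis_units by simp
  finally show ?thesis .
qed

lemma unit_step:
  assumes "i \<in> I"
  shows "unit (h(i := h i + 1)) = unit h \<otimes> g i"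
proof -
  have "unit (h(i := h i + 1)) = unit (\<lambda>k. h k + (if k = i then 1 else 0))"
    by (rule unit_cong) auto
  then show ?thesis using unit_add unit_basis[OF assms] by simp
qed

lemma unit_inj:
  assumes "unit h = unit h'" "i \<in> I"
  shows "h i = h' i"
proof -
  have "unit (\<lambda>i. (h i - h' i) + h' i) = unit (\<lambda>i. h i - h' i) \<otimes> unit h'" by (rule unit_add)
  then have "unit h' \<otimes> unit (\<lambda>i. h i - h' i) = unit h' \<otimes> \<one>" using assms(1) by (simp add: m_comm)
  then have "unit (\<lambda>i. h i - h' i) = \<one>" by (rule nonzero_cancel[OF unit_nonzero, rotated 2]) auto
  from basis_independent[OF this[unfolded unit_def] assms(2)] show ?thesis by simp
qed

definition rep :: "'a \<Rightarrow> 'a" where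
  "rep a = (SOME c. c \<in> nonzero A \<and> (\<exists>h. a = c \<otimes> unit h))"

text \<open>Only the values on \<open>I\<close> are determined; outside \<open>I\<close> they are an
  arbitrary part of the choice.\<close>

definition height :: "'a \<Rightarrow> 'a \<Rightarrow> int" where
  "height a = (SOME h. a = rep a \<otimes> unit h)"

lemma rep:
  assumes "a \<in> nonzero A"
  shows "rep a \<in> nonzero A" "a = rep a \<otimes> unit (height a)"
proof -
  have "a = a \<otimes> unit (\<lambda>_. 0)" using assms by (simp add: unit_0 nonzero_carrier)
  then have "\<exists>c. c \<in> nonzero A \<and> (\<exists>h. a = c \<otimes> unit h)" using assms by blast
  from someI_ex[OF this] have *: "rep a \<in> nonzero A" "\<exists>h. a = rep a \<otimes> unit h"
    by (auto simp: rep_def)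
  show "rep a \<in> nonzero A" by (rule *(1))
  show "a = rep a \<otimes> unit (height a)" unfolding height_def using *(2) by (rule someI_ex)
qed

text \<open>The property from which \<open>rep\<close> is chosen depends on the orbit only, so both
  choices are made from the same set and agree.\<close>

lemma rep_mult_unit:
  assumes "a \<in> nonzero A"
  shows "rep (a \<otimes> unit d) = rep a"
proof -
  have c: "a \<in> carrier A" using assms by (rule nonzero_carrier)
  have "(\<exists>h. a \<otimes> unit d = c \<otimes> unit h) \<longleftrightarrow> (\<exists>h. a = c \<otimes> unit h)" if cc: "c \<in> nonzero A" for c
  proof
    assume "\<exists>h. a \<otimes> unit d = c \<otimes> unit h"
    then obtain h where h: "a \<otimes> unit d = c \<otimes> unit h" by blast
    have "unit d \<otimes> unit (\<lambda>i. - d i) = \<one>"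
      using unit_add[of d "\<lambda>i. - d i"] unit_0 by simp
    then have "a = (a \<otimes> unit d) \<otimes> unit (\<lambda>i. - d i)" using c by (simp add: m_assoc)
    also have "\<dots> = c \<otimes> unit (\<lambda>i. h i + - d i)"
      unfolding h unit_add using cc by (simp add: m_assoc nonzero_carrier)
    finally show "\<exists>h. a = c \<otimes> unit h" by blast
  next
    assume "\<exists>h. a = c \<otimes> unit h"
    then obtain h where "a = c \<otimes> unit h" by blast
    then have "a \<otimes> unit d = c \<otimes> unit (\<lambda>i. h i + d i)"
      unfolding unit_add using cc by (simp add: m_assoc nonzero_carrier)
    then show "\<exists>h. a \<otimes> unit d = c \<otimes> unit h" by blast
  qed
  then have "(\<lambda>c. c \<in> nonzero A \<and> (\<exists>h. a \<otimes> unit d = c \<otimes> unit h)) =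
      (\<lambda>c. c \<in> nonzero A \<and> (\<exists>h. a = c \<otimes> unit h))" by blast
  then show ?thesis unfolding rep_def by (rule arg_cong)
qed

lemma rep_rep: "a \<in> nonzero A \<Longrightarrow> rep (rep a) = rep a"
  using rep_mult_unit[OF rep(1), of a "height a"] rep(2)[of a] by simp

lemma rep_eqD:
  assumes "a \<in> nonzero A" "b \<in> nonzero A" "rep a = rep b"
  obtains d where "b = a \<otimes> unit d"
proof -
  have c: "rep a \<in> carrier A" using rep(1)[OF assms(1)] by (rule nonzero_carrier)
  have "b = rep a \<otimes> unit (\<lambda>i. height a i + (height b i - height a i))"
    using rep(2)[OF assms(2)] assms(3) by simp
  also have "\<dots> = rep a \<otimes> (unit (height a) \<otimes> unit (\<lambda>i. height b i - height a i))"
    by (simp only: unit_add)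
  also have "\<dots> = a \<otimes> unit (\<lambda>i. height b i - height a i)"
    using rep(2)[OF assms(1)] c by (simp add: m_assoc[symmetric])
  finally show ?thesis by (rule that)
qed

lemma height_unique:
  assumes "a \<in> nonzero A" "a = rep a \<otimes> unit h" "i \<in> I"
  shows "height a i = h i"
proof -
  have "rep a \<otimes> unit (height a) = rep a \<otimes> unit h" using rep(2)[OF assms(1)] assms(2) by simp
  then have "unit (height a) = unit h"
    by (rule nonzero_cancel[OF rep(1)[OF assms(1)], rotated 2]) auto
  then show ?thesis using assms(3) by (rule unit_inj)
qed

lemma height_mult_unit:
  assumes "a \<in> nonzero A" "i \<in> I"
  shows "height (a \<otimes> unit d) i = height a i + d i"
proof (rule height_unique[OF _ _ assms(2)])
  show "a \<otimes> unit d \<in> nonzero A" using assms unit_nonzero by (intro mult_nonzero)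
  have "a \<otimes> unit d = (rep a \<otimes> unit (height a)) \<otimes> unit d" using rep(2)[OF assms(1)] by simp
  also have "\<dots> = rep a \<otimes> unit (\<lambda>i. height a i + d i)"
    unfolding unit_add using rep(1)[OF assms(1)] by (simp add: m_assoc nonzero_carrier)
  finally show "a \<otimes> unit d = rep (a \<otimes> unit d) \<otimes> unit (\<lambda>i. height a i + d i)"
    unfolding rep_mult_unit[OF assms(1)] .
qed

lemma height_rep: "a \<in> nonzero A \<Longrightarrow> i \<in> I \<Longrightarrow> height (rep a) i = 0"
  using height_unique[OF rep(1), of a "\<lambda>_. 0" i] rep(1)[of a]
  by (simp add: rep_rep unit_0 nonzero_carrier)

lemma Units_mult_rep:
  assumes "u \<in> Units A" "a \<in> nonzero A"
  shows "rep (u \<otimes> a) = rep a"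
proof -
  obtain d where "u = unit d" using basis_generates[OF assms(1)] unfolding unit_def by blast
  then have "u \<otimes> a = a \<otimes> unit d" using assms by (simp add: m_comm nonzero_carrier)
  then show ?thesis using rep_mult_unit[OF assms(2)] by simp
qed

subsection \<open>Order of vanishing of monomials\<close>

text \<open>Truncated, as an element may be a product of arbitrarily many elements that are no units.\<close>

definition vanishing :: "nat \<Rightarrow> 'a \<Rightarrow> nat" where
  "vanishing l a = Max {m. m \<le> Suc l \<and> a \<in> nonunit_power m}"

lemma vanishing_ge:
  assumes "a \<in> nonunit_power m" "m \<le> Suc l"
  shows "m \<le> vanishing l a"
  unfolding vanishing_def using assms by (intro Max_ge) auto

lemma vanishing_mem:
  assumes "a \<in> nonzero A"
  shows "a \<in> nonunit_power (vanishing l a)" "vanishing l a \<le> Suc l"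
proof -
  have "vanishing l a \<in> {m. m \<le> Suc l \<and> a \<in> nonunit_power m}"
    unfolding vanishing_def
  proof (rule Max_in)
    have "0 \<in> {m. m \<le> Suc l \<and> a \<in> nonunit_power m}" using assms by simp
    then show "{m. m \<le> Suc l \<and> a \<in> nonunit_power m} \<noteq> {}" by blast
  qed simp
  then show "a \<in> nonunit_power (vanishing l a)" "vanishing l a \<le> Suc l" by auto
qed

lemma vanishing_mult:
  assumes "a \<in> nonzero A" "b \<in> nonzero A"
  shows "vanishing l b \<le> vanishing l (a \<otimes> b)"
  using vanishing_mem[OF assms(2)] assms by (intro vanishing_ge nonunit_power_mult)

text \<open>One more nonunit factor raises the order by at least one. The bound \<open>l\<close>
  excludes the truncated value \<open>Suc l\<close>, at which no further increase is
  recorded.\<close>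

lemma vanishing_nonunit_mult:
  assumes "a \<in> nonzero A" "a \<notin> Units A" "b \<in> nonzero A" "vanishing l (a \<otimes> b) \<le> l"
  shows "vanishing l b < vanishing l (a \<otimes> b)"
proof -
  have "vanishing l b \<le> l" using vanishing_mult[OF assms(1,3)] assms(4) by (rule order_trans)
  moreover have "a \<otimes> b \<in> nonunit_power (Suc (vanishing l b))"
    using assms vanishing_mem(1)[OF assms(3)] by auto
  ultimately have "Suc (vanishing l b) \<le> vanishing l (a \<otimes> b)" by (intro vanishing_ge) auto
  then show ?thesis by simp
qed

lemma vanishing_rep:
  assumes "a \<in> nonzero A"
  shows "vanishing l (rep a) = vanishing l a"
proof (rule antisym)
  have c: "rep a \<in> carrier A" using rep(1)[OF assms] by (rule nonzero_carrier)
  have "vanishing l (rep a) \<le> vanishing l (unit (height a) \<otimes> rep a)"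
    using unit_nonzero rep(1)[OF assms] by (rule vanishing_mult)
  also have "unit (height a) \<otimes> rep a = a" using rep(2)[OF assms] c by (simp add: m_comm)
  finally show "vanishing l (rep a) \<le> vanishing l a" .
  obtain d where "rep a = a \<otimes> unit d" using rep_eqD[OF assms rep(1)[OF assms]] rep_rep[OF assms] by metis
  then have "rep a = unit d \<otimes> a" using assms by (simp add: m_comm nonzero_carrier)
  then show "vanishing l a \<le> vanishing l (rep a)"
    using vanishing_mult[OF unit_nonzero assms] by metis
qed

definition degree :: "nat \<Rightarrow> 'a \<times> ('a \<Rightarrow> nat) \<Rightarrow> nat" where
  "degree l t = vanishing l (fst t) + (\<Sum>i\<in>I. snd t i)"

text \<open>Orbits enter through their chosen representatives, and exponents are extensional on
  \<open>I\<close>, so that nothing is counted twice.\<close>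

definition indices :: "('a \<times> ('a \<Rightarrow> nat)) set" where
  "indices = {(c, e). c \<in> nonzero A \<and> rep c = c \<and> e \<in> PiE I (\<lambda>_. UNIV)}"

definition indices_upto :: "nat \<Rightarrow> ('a \<times> ('a \<Rightarrow> nat)) set" where
  "indices_upto l = {t \<in> indices. degree l t \<le> l}"

text \<open>An orbit of order at most \<open>l\<close> lies outside
  \<open>nonunit_power (Suc l)\<close>, which leaves finitely many orbits, and each exponent is at
  most \<open>l\<close>.\<close>

lemma finite_indices_upto: "finite (indices_upto l)"
proof -
  obtain C where C: "finite C" "C \<subseteq> nonzero A"
    "\<And>a. a \<in> nonzero A \<Longrightarrow> a \<in> nonunit_power (Suc l) \<or> (\<exists>c\<in>C. \<exists>u\<in>Units A. a = c \<otimes> u)"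
    using finite_classes[of "Suc l"] by blast
  have "indices_upto l \<subseteq> (rep ` C) \<times> PiE I (\<lambda>_. {..l})"
  proof
    fix t assume "t \<in> indices_upto l"
    then obtain c e where t: "t = (c, e)" "c \<in> nonzero A" "rep c = c" "e \<in> PiE I (\<lambda>_. UNIV)"
      "vanishing l c + (\<Sum>i\<in>I. e i) \<le> l"
      by (auto simp: indices_upto_def indices_def degree_def)
    have "c \<notin> nonunit_power (Suc l)" using vanishing_ge[of c "Suc l" l] t(5) by auto
    then obtain b u where b: "b \<in> C" "u \<in> Units A" "c = b \<otimes> u" using C(3)[OF t(2)] by blast
    have "c = u \<otimes> b" using b C(2) m_comm[of b u] nonzero_carrier by auto
    then have "c = rep b" using Units_mult_rep[OF b(2), of b] b(1) C(2) t(3) by auto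
    moreover have "e i \<le> l" if "i \<in> I" for i
      using member_le_sum[of i I e] that finite_I t(5) by simp
    ultimately show "t \<in> (rep ` C) \<times> PiE I (\<lambda>_. {..l})"
      using t(1,4) b(1) by (auto simp: PiE_iff)
  qed
  moreover have "finite ((rep ` C) \<times> PiE I (\<lambda>_. {..l}))"
    using C(1) finite_I by (intro finite_cartesian_product finite_imageI finite_PiE) auto
  ultimately show ?thesis by (rule finite_subset)
qed

subsection \<open>Taylor coefficients\<close>

text \<open>On the coset of \<open>c\<close>, a Laurent polynomial in the \<open>g i\<close>, the functional with index \<open>(c, e)\<close>
  is the coefficient of \<open>\<Prod>\<^sub>i (g i - 1)\<^bsup>e i\<^esup>\<close> in the Taylor expansion at \<open>g = 1\<close>.\<close>

definition weight :: "'a \<times> ('a \<Rightarrow> nat) \<Rightarrow> 'a \<Rightarrow> int" where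
  "weight t a = (if a \<in> nonzero A \<and> rep a = fst t then multi_binomial I (height a) (snd t) else 0)"

definition taylor :: "'a \<times> ('a \<Rightarrow> nat) \<Rightarrow> ('a \<Rightarrow> int) \<Rightarrow> int" where
  "taylor t = lin A (weight t)"

text \<open>Evaluation at the distinguished point, described in terms of \<open>A\<close>
  alone.\<close>

definition augmentation :: "('a \<Rightarrow> int) \<Rightarrow> int" where
  "augmentation = lin A (\<lambda>a. if a \<in> Units A then 1 else 0)"

lemma weight_pzero: "weight t (pzero A) = 0"
  by (simp add: weight_def nonzero_def)

text \<open>By cancellation \<open>a\<close> carries at most one orbit into that of
  \<open>c\<close>, here the orbit of \<open>b0\<close>. On it the heights of
  \<open>a \<otimes> b\<close> and of \<open>b\<close> differ by a constant vector, and
  Vandermonde's identity separates this constant.\<close>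

lemma weight_mult:
  assumes a: "a \<in> nonzero A" and b: "b \<in> nonzero A" and b0: "b0 \<in> nonzero A"
    and c: "rep (a \<otimes> b0) = c"
  shows "weight (c, e) (a \<otimes> b) = (\<Sum>f\<in>PiE I (\<lambda>i. {..e i}).
    multi_binomial I (height (a \<otimes> rep b0)) (\<lambda>i. e i - f i) * weight (rep b0, f) b)"
proof (cases "rep b = rep b0")
  case True
  have ac: "a \<in> carrier A" "rep b0 \<in> carrier A" "rep b0 \<in> nonzero A"
    using a rep(1)[OF b0] by (auto simp: nonzero_carrier)
  have "b = rep b0 \<otimes> unit (height b)" using rep(2)[OF b] True by simp
  from arg_cong[OF this, of "\<lambda>x. a \<otimes> x"]
  have "a \<otimes> b = a \<otimes> (rep b0 \<otimes> unit (height b))" .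
  then have ab: "a \<otimes> b = (a \<otimes> rep b0) \<otimes> unit (height b)" using ac by (simp add: m_assoc)
  have nz: "a \<otimes> rep b0 \<in> nonzero A" using a ac by (intro mult_nonzero)
  have "rep (a \<otimes> rep b0) = c"
  proof -
    from arg_cong[OF rep(2)[OF b0], of "\<lambda>x. a \<otimes> x"]
    have "a \<otimes> b0 = a \<otimes> (rep b0 \<otimes> unit (height b0))" .
    then have "a \<otimes> b0 = (a \<otimes> rep b0) \<otimes> unit (height b0)" using ac by (simp add: m_assoc)
    then show ?thesis using rep_mult_unit[OF nz] c by simp
  qed
  then have "rep (a \<otimes> b) = c" unfolding ab rep_mult_unit[OF nz] .
  moreover have "a \<otimes> b \<in> nonzero A" using a b by (rule mult_nonzero)
  ultimately have "weight (c, e) (a \<otimes> b) = multi_binomial I (height (a \<otimes> b)) e"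
    by (simp add: weight_def)
  also have "\<dots> = multi_binomial I (\<lambda>i. height b i + height (a \<otimes> rep b0) i) e"
    by (rule multi_binomial_cong) (simp_all add: ab height_mult_unit[OF nz])
  also have "\<dots> = (\<Sum>f\<in>PiE I (\<lambda>i. {..e i}).
      multi_binomial I (height (a \<otimes> rep b0)) (\<lambda>i. e i - f i) * multi_binomial I (height b) f)"
    by (rule multi_binomial_Vandermonde[OF finite_I])
  finally show ?thesis using True b by (simp add: weight_def)
next
  case False
  have "rep (a \<otimes> b) \<noteq> c"
  proof
    assume "rep (a \<otimes> b) = c"
    then have "rep (a \<otimes> b0) = rep (a \<otimes> b)" using c by simp
    then obtain d where d: "a \<otimes> b = (a \<otimes> b0) \<otimes> unit d"
      using rep_eqD[OF mult_nonzero[OF a b0] mult_nonzero[OF a b]] by blast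
    then have "a \<otimes> b = a \<otimes> (b0 \<otimes> unit d)"
      using a b0 by (simp add: m_assoc nonzero_carrier)
    then have "b = b0 \<otimes> unit d"
      using b b0 nonzero_cancel[OF a, of b "b0 \<otimes> unit d"] by (simp add: nonzero_carrier)
    then show False using False rep_mult_unit[OF b0] by simp
  qed
  then show ?thesis using False by (simp add: weight_def)
qed

abbreviation "S \<equiv> monoid_ring \<Z> A"

sublocale S: cring S by (rule cring_monoid_ring)

lemma taylor_add:
  "f \<in> carrier S \<Longrightarrow> f' \<in> carrier S \<Longrightarrow> taylor t (f \<oplus>\<^bsub>S\<^esub> f') = taylor t f + taylor t f'"
  unfolding taylor_def by (rule lin_add)

lemma augmentation_add:
  "f \<in> carrier S \<Longrightarrow> f' \<in> carrier S \<Longrightarrow>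
    augmentation (f \<oplus>\<^bsub>S\<^esub> f') = augmentation f + augmentation f'"
  unfolding augmentation_def by (rule lin_add)

lemma augmentation_single: "a \<in> nonzero A \<Longrightarrow> augmentation (single A a) = (if a \<in> Units A then 1 else 0)"
  unfolding augmentation_def by (rule lin_single)

text \<open>The action of \<open>a\<close> on Taylor coefficients is triangular with respect to the
  degree, with the value of \<open>a\<close> at the point on the diagonal. For a nonunit all
  contributing coefficients belong to an orbit of smaller order; for a unit the orbit is the same,
  and the exponents other than \<open>e\<close> have a smaller sum.\<close>

lemma taylor_single_mult:
  assumes P: "ideal P \<Z>"
    and t: "t \<in> indices_upto l" and a: "a \<in> nonzero A" and f: "f \<in> carrier S"
    and low: "\<And>t'. t' \<in> indices_upto l \<Longrightarrow> degree l t' < degree l t \<Longrightarrow> taylor t' f \<in> P"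
  shows "taylor t (single A a \<otimes>\<^bsub>S\<^esub> f) - augmentation (single A a) * taylor t f \<in> P"
proof -
  note P = int_idealD[OF P]
  obtain c e where ce: "t = (c, e)" "c \<in> nonzero A" "rep c = c" "e \<in> PiE I (\<lambda>_. UNIV)"
    and deg: "vanishing l c + (\<Sum>i\<in>I. e i) \<le> l"
    using t by (auto simp: indices_upto_def indices_def degree_def)
  have lin: "taylor t (single A a \<otimes>\<^bsub>S\<^esub> f) = lin A (\<lambda>b. weight t (a \<otimes> b)) f"
    unfolding taylor_def by (rule lin_single_mult[where w = "weight t", OF a weight_pzero f])
  show ?thesis
  proof (cases "\<exists>b0\<in>nonzero A. rep (a \<otimes> b0) = c")
    \<comment> \<open>No translate reaches the orbit of \<open>c\<close>. A unit would preserve that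
      orbit, so \<open>a\<close> is a nonunit and has the value zero.\<close>
    case False
    then have "lin A (\<lambda>b. weight t (a \<otimes> b)) f = lin A (\<lambda>_. 0) f"
      by (intro lin_cong) (auto simp: weight_def ce(1))
    then have 0: "taylor t (single A a \<otimes>\<^bsub>S\<^esub> f) = 0" unfolding lin by (simp add: lin_def)
    have "a \<notin> Units A" using False Units_mult_rep[of a c] ce(2,3) by auto
    then show ?thesis using 0 P(3) by (simp add: augmentation_single a)
  next
    case True
    then obtain b0 where b0: "b0 \<in> nonzero A" "rep (a \<otimes> b0) = c" by blast
    let ?c = "rep b0" and ?E = "PiE I (\<lambda>i. {..e i})"
    define k where "k = (\<lambda>f. multi_binomial I (height (a \<otimes> rep b0)) (\<lambda>i. e i - f i))"
    have "lin A (\<lambda>b. weight t (a \<otimes> b)) f = lin A (\<lambda>b. \<Sum>f\<in>?E. k f * weight (?c, f) b) f"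
      unfolding ce(1) k_def by (intro lin_cong weight_mult a b0)
    then have sum: "taylor t (single A a \<otimes>\<^bsub>S\<^esub> f) = (\<Sum>d\<in>?E. k d * taylor (?c, d) f)"
      using lin by (simp add: lin_sum_left taylor_def)
    have index: "(?c, d) \<in> indices" if "d \<in> ?E" for d
      using rep(1)[OF b0(1)] rep_rep[OF b0(1)] that by (auto simp: indices_def)
    have van: "vanishing l (a \<otimes> b0) = vanishing l c"
      using vanishing_rep[OF mult_nonzero[OF a b0(1)]] b0(2) by simp
    have van': "vanishing l ?c = vanishing l b0" by (rule vanishing_rep[OF b0(1)])
    have le: "(\<Sum>i\<in>I. d i) \<le> (\<Sum>i\<in>I. e i)" if "d \<in> ?E" for d
      using that by (intro sum_mono) auto
    have PS: "(\<Sum>d\<in>D. k d * taylor (?c, d) f) \<in> P"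
      if "\<And>d. d \<in> D \<Longrightarrow> taylor (?c, d) f \<in> P" "finite D" for D
      using that(2,1) by (induction D rule: finite_induct) (auto intro: P)
    have fin: "finite ?E" using finite_I by (intro finite_PiE) auto
    show ?thesis
    proof (cases "a \<in> Units A")
      case False
      have "vanishing l ?c < vanishing l c"
        using vanishing_nonunit_mult[OF a False b0(1), of l] deg by (simp add: van van')
      then have "taylor (?c, d) f \<in> P" if "d \<in> ?E" for d
        using le[OF that] deg index[OF that]
        by (intro low) (auto simp: degree_def ce(1) indices_upto_def)
      then show ?thesis using PS[OF _ fin] False by (simp add: sum augmentation_single a)
    next
      case True
      have c: "?c = c" using Units_mult_rep[OF True b0(1)] b0(2) by simp
      have eE: "e \<in> ?E" using ce(4) by auto
      \<comment> \<open>The diagonal entry: at \<open>e\<close> all lower indices of the binomial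
        coefficients are zero.\<close>
      have k_e: "k e = 1" unfolding k_def by (rule multi_binomial_0_right) simp
      have "taylor (c, d) f \<in> P" if d: "d \<in> ?E - {e}" for d
      proof (intro low)
        have "\<exists>i\<in>I. d i < e i"
        proof (rule ccontr)
          assume "\<not> (\<exists>i\<in>I. d i < e i)"
          then have "d i = e i" if "i \<in> I" for i using d that by (auto simp: PiE_iff le_antisym not_less)
          then have "d = e" using d eE by (intro PiE_ext[of d I "\<lambda>i. {..e i}"]) auto
          then show False using d by simp
        qed
        then have "(\<Sum>i\<in>I. d i) < (\<Sum>i\<in>I. e i)"
          using d finite_I by (intro sum_strict_mono_ex1) auto
        then show "degree l (c, d) < degree l t" by (simp add: degree_def ce(1))
        then show "(c, d) \<in> indices_upto l"
          using index[of d] d t unfolding c by (auto simp: indices_upto_def)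
      qed
      then have "(\<Sum>d\<in>?E - {e}. k d * taylor (?c, d) f) \<in> P" using fin by (intro PS) (auto simp: c)
      moreover have "taylor t (single A a \<otimes>\<^bsub>S\<^esub> f) - augmentation (single A a) * taylor t f =
          (\<Sum>d\<in>?E - {e}. k d * taylor (?c, d) f)"
        unfolding sum using sum.remove[OF fin eE, of "\<lambda>d. k d * taylor (?c, d) f"] True
        by (simp add: augmentation_single a k_e c ce(1))
      ultimately show ?thesis by simp
    qed
  qed
qed

end

lemma int_zero_ideal: "primeideal {0} \<Z>"
proof -
  have "domain \<Z>" by (intro domain.intro domain_axioms.intro int_is_cring) auto
  then show ?thesis using domain.zeroprimeideal by fastforce
qed

lemma lin_int_mult:
  fixes A (structure)
  assumes "cring (monoid_ring \<Z> A)" and f: "f \<in> carrier (monoid_ring \<Z> A)"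
  shows "lin A w (\<guillemotleft>n\<guillemotright>\<^bsub>monoid_ring \<Z> A\<^esub> \<otimes>\<^bsub>monoid_ring \<Z> A\<^esub> f) = n * lin A w f"
proof -
  interpret S: cring "monoid_ring \<Z> A" by fact
  show ?thesis
  proof (induction n rule: int_induct[where k = 0])
    case base
    then show ?case using f by (simp add: lin_zero)
  next
    case (step1 n)
    then show ?case using f by (simp add: S.l_distr lin_add distrib_right)
  next
    case (step2 n)
    have "lin A w (\<guillemotleft>n - 1\<guillemotright>\<^bsub>monoid_ring \<Z> A\<^esub> \<otimes>\<^bsub>monoid_ring \<Z> A\<^esub> f) =
        lin A w (\<guillemotleft>n\<guillemotright>\<^bsub>monoid_ring \<Z> A\<^esub> \<otimes>\<^bsub>monoid_ring \<Z> A\<^esub> f) - lin A w f"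
      using f by (simp add: S.minus_eq S.l_distr S.l_minus lin_add lin_a_inv)
    then show ?case using step2 by (simp add: left_diff_distrib)
  qed
qed

section \<open>Taylor coefficients of products and of powers of the distinguished ideals\<close>

context toric_coordinates
begin

lemma taylor_int_mult: "f \<in> carrier S \<Longrightarrow> taylor t (\<guillemotleft>n\<guillemotright>\<^bsub>S\<^esub> \<otimes>\<^bsub>S\<^esub> f) = n * taylor t f"
  unfolding taylor_def by (rule lin_int_mult[OF S.cring_axioms])

lemma taylor_minus:
  "f \<in> carrier S \<Longrightarrow> f' \<in> carrier S \<Longrightarrow> taylor t (f \<ominus>\<^bsub>S\<^esub> f') = taylor t f - taylor t f'"
  unfolding taylor_def by (rule lin_minus)

lemma taylor_a_inv: "f \<in> carrier S \<Longrightarrow> taylor t (\<ominus>\<^bsub>S\<^esub> f) = - taylor t f"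
  unfolding taylor_def by (rule lin_a_inv)

lemma taylor_zero: "taylor t \<zero>\<^bsub>S\<^esub> = 0"
  unfolding taylor_def by (rule lin_zero)

text \<open>Once the coefficients of lower degree are zero modulo \<open>P\<close>, all of
  \<open>S\<close> acts on the next coefficient through its value at the point. This is what makes
  the successive vanishing conditions define ideals.\<close>

lemma taylor_mult:
  assumes P: "ideal P \<Z>" and t: "t \<in> indices_upto l" and u: "u \<in> carrier S" and f: "f \<in> carrier S"
    and low: "\<And>t'. t' \<in> indices_upto l \<Longrightarrow> degree l t' < degree l t \<Longrightarrow> taylor t' f \<in> P"
  shows "taylor t (u \<otimes>\<^bsub>S\<^esub> f) - augmentation u * taylor t f \<in> P"
proof -
  note P' = int_idealD[OF P]
  let ?D = "\<lambda>u. taylor t (u \<otimes>\<^bsub>S\<^esub> f) - augmentation u * taylor t f"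
  have add: "?D (u \<oplus>\<^bsub>S\<^esub> v) = ?D u + ?D v" if "u \<in> carrier S" "v \<in> carrier S" for u v
    using that f by (simp add: S.l_distr taylor_add augmentation_add distrib_right)
  have inv: "?D (\<ominus>\<^bsub>S\<^esub> u) = - ?D u" if "u \<in> carrier S" for u
    using that f by (simp add: S.l_minus taylor_a_inv augmentation_def lin_a_inv)
  have "subgroup {u \<in> carrier S. ?D u \<in> P} (add_monoid S)"
  proof (unfold_locales, goal_cases)
    case (2 x y)
    then show ?case using add[of x y] P'(1) by simp
  next
    case 3
    show ?case using f P'(3) by (simp add: taylor_zero augmentation_def lin_zero)
  next
    case (4 x)
    then show ?case unfolding a_inv_def[symmetric] using inv[of x] P'(4)[of "?D x"] by simp
  qed auto
  then have "additive_subgroup {u \<in> carrier S. ?D u \<in> P} S" by (rule additive_subgroup.intro)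
  then have "u \<in> {u \<in> carrier S. ?D u \<in> P}"
  proof (rule additive_subgroup_monoid_ring_eq[OF _ _ u])
    fix a assume "a \<in> nonzero A"
    then show "single A a \<in> {u \<in> carrier S. ?D u \<in> P}"
      using taylor_single_mult[OF P t _ f low] by (simp add: single_closed)
  qed
  then show ?thesis by simp
qed

text \<open>A product in \<open>A\<close> is a unit exactly when both factors are, so sending
  nonunits to zero is multiplicative.\<close>

lemma augmentation_mult:
  assumes f: "f \<in> carrier S" and f': "f' \<in> carrier S"
  shows "augmentation (f \<otimes>\<^bsub>S\<^esub> f') = augmentation f * augmentation f'"
proof (rule additive_ext_monoid_ring[where A = A and T = \<Z>, OF _ _ _ _ _ _ f])
  show "augmentation (single A a \<otimes>\<^bsub>S\<^esub> f') = augmentation (single A a) * augmentation f'"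
    if a: "a \<in> nonzero A" for a
  proof -
    have ab: "a \<otimes> b \<in> Units A \<longleftrightarrow> a \<in> Units A \<and> b \<in> Units A" if "b \<in> nonzero A" for b
      using that a unit_factor[of a b] unit_factor[of b a] m_comm[of a b] by (auto simp: nonzero_carrier)
    have "augmentation (single A a \<otimes>\<^bsub>S\<^esub> f') =
        lin A (\<lambda>b. if a \<otimes> b \<in> Units A then 1 else 0) f'"
      unfolding augmentation_def using Units_nonzero[of "pzero A"]
      by (intro lin_single_mult[where w = "\<lambda>b. if b \<in> Units A then 1 else 0", OF a _ f'])
        (auto simp: nonzero_def)
    also have "\<dots> = augmentation (single A a) * augmentation f'"
    proof (cases "a \<in> Units A")
      case True
      then have "lin A (\<lambda>b. if a \<otimes> b \<in> Units A then 1 else 0) f' = augmentation f'"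
        unfolding augmentation_def by (intro lin_cong) (simp add: ab)
      then show ?thesis using True by (simp add: augmentation_single a)
    next
      case False
      then have "lin A (\<lambda>b. if a \<otimes> b \<in> Units A then 1 else 0) f' = lin A (\<lambda>_. 0) f'"
        by (intro lin_cong) (simp add: ab)
      then show ?thesis using False by (simp add: augmentation_single a lin_def)
    qed
    finally show ?thesis .
  qed
  show "abelian_group \<Z>" by (rule ring.axioms(1)[OF cring.axioms(1)[OF int_is_cring]])
qed (use f' in \<open>auto simp: S.l_distr augmentation_add distrib_right\<close>)

lemma augmentation_hom: "augmentation \<in> ring_hom S \<Z>"
  using augmentation_single[OF one_nonzero']
  by (intro ring_hom_memI) (auto simp: augmentation_mult augmentation_add monoid_ring_one single_def)

lemma augmentation_of_integer: "augmentation \<guillemotleft>n\<guillemotright>\<^bsub>S\<^esub> = n"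
  using S.ring_hom_of_integer[OF int_is_cring augmentation_hom] by (simp add: of_integer_int)

text \<open>The prime of the distinguished point over \<open>P\<close>, described in
  \<open>\<int>[A]\<close> itself; \<open>distinguished_point\<close> is later shown to equal
  it.\<close>

definition point :: "int set \<Rightarrow> ('a \<Rightarrow> int) set" where
  "point P = {f \<in> carrier S. augmentation f \<in> P}"

lemma point_prime:
  assumes "primeideal P \<Z>"
  shows "primeideal (point P) S"
proof -
  interpret P: primeideal P \<Z> by fact
  interpret H: ring_hom_ring S \<Z> augmentation
    by (rule ring_hom_ringI2[OF S.ring_axioms cring.axioms(1)[OF int_is_cring] augmentation_hom])
  have "ideal (point P) S" unfolding point_def by (rule H.ideal_vimage[OF P.is_ideal])
  moreover have "1 \<notin> P" using P.compl_one by simp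
  then have "carrier S \<noteq> point P"
    using augmentation_of_integer[of 1] unfolding point_def by force
  moreover have "f \<in> point P \<or> f' \<in> point P"
    if "f \<in> carrier S" "f' \<in> carrier S" "f \<otimes>\<^bsub>S\<^esub> f' \<in> point P" for f f'
    using that P.I_prime[of "augmentation f" "augmentation f'"] by (auto simp: point_def augmentation_mult)
  ultimately show ?thesis by (intro primeidealI S.cring_axioms) auto
qed

lemma not_point: "u \<in> carrier S - point P \<Longrightarrow> augmentation u \<notin> P"
  by (simp add: point_def)

lemma of_integer_not_point: "n \<notin> P \<Longrightarrow> \<guillemotleft>n\<guillemotright>\<^bsub>S\<^esub> \<in> carrier S - point P"
  by (simp add: point_def augmentation_of_integer)

lemma point_mono: "P \<subseteq> P' \<Longrightarrow> point P \<subseteq> point P'"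
  by (auto simp: point_def)

text \<open>Each factor from the ideal raises the order of vanishing by one. In a product of
  \<open>j\<close> and \<open>i\<close> the coefficients of \<open>i\<close> of smaller degree are
  in \<open>P\<close> by induction, so by triangularity only \<open>augmentation j\<close>, which is
  in \<open>P\<close>, times a coefficient of \<open>i\<close> remains.\<close>

lemma taylor_point_pow:
  assumes P: "ideal P \<Z>" and Q: "ideal (point P) S"
    and "f \<in> point P [^]\<^bsub>ideals_set S\<^esub> (m :: nat)" "t \<in> indices_upto l" "degree l t < m"
  shows "taylor t f \<in> P"
  using assms(3-)
proof (induction m arbitrary: f t)
  case (Suc m)
  note P' = int_idealD[OF P]
  have c: "x \<in> carrier S" if "x \<in> point P [^]\<^bsub>ideals_set S\<^esub> n" for x and n :: nat
    using ideal.Icarr[OF S.ideals_pow_ideal[OF Q] that] .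
  have "taylor t x \<in> P" if "x \<in> ideal_prod S (point P [^]\<^bsub>ideals_set S\<^esub> m) (point P)" for x
    using that
  proof induction
    case (prod i j)
    have i: "i \<in> carrier S" using c[OF prod(1)] .
    have j: "j \<in> carrier S" "augmentation j \<in> P" using prod(2) by (auto simp: point_def)
    have "taylor t (j \<otimes>\<^bsub>S\<^esub> i) - augmentation j * taylor t i \<in> P"
      by (rule taylor_mult[OF P Suc.prems(2) j(1) i]) (use Suc prod in auto)
    from P'(1)[OF this P'(2)[OF j(2), of "taylor t i"]]
    show ?case using i j by (simp add: mult.commute S.m_comm)
  next
    case (sum x y)
    have "x \<in> carrier S" "y \<in> carrier S"
      using sum S.ideal_prod_in_carrier[OF S.ideals_pow_ideal[OF Q] Q] by auto
    then show ?case using sum P'(1) by (simp add: taylor_add)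
  qed
  then show ?case using Suc.prems(1) unfolding ideals_pow_Suc by blast
qed simp

subsection \<open>The basis dual to the Taylor coefficients\<close>

definition dual :: "'a \<times> ('a \<Rightarrow> nat) \<Rightarrow> 'a \<Rightarrow> int" where
  "dual t = single A (fst t) \<otimes>\<^bsub>S\<^esub>
    finprod S (\<lambda>i. (single A (g i) \<ominus>\<^bsub>S\<^esub> \<one>\<^bsub>S\<^esub>) [^]\<^bsub>S\<^esub> snd t i) I"

lemma dual_closed: "dual t \<in> carrier S"
  unfolding dual_def by (intro S.m_closed S.finprod_closed) (auto simp: single_closed)

lemma dual_step:
  assumes i: "i \<in> I"
  shows "dual (c, e(i := Suc (e i))) = (single A (g i) \<ominus>\<^bsub>S\<^esub> \<one>\<^bsub>S\<^esub>) \<otimes>\<^bsub>S\<^esub> dual (c, e)"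
proof -
  define z where "z = (\<lambda>i. single A (g i) \<ominus>\<^bsub>S\<^esub> \<one>\<^bsub>S\<^esub>)"
  have z: "z k \<in> carrier S" for k by (simp add: z_def single_closed)
  let ?J = "I - {i}"
  have split: "finprod S (\<lambda>k. z k [^]\<^bsub>S\<^esub> f k) I = z i [^]\<^bsub>S\<^esub> f i \<otimes>\<^bsub>S\<^esub> finprod S (\<lambda>k. z k [^]\<^bsub>S\<^esub> f k) ?J"
    for f :: "'a \<Rightarrow> nat"
    using S.finprod_insert[of ?J i "\<lambda>k. z k [^]\<^bsub>S\<^esub> f k"] z finite_I insert_Diff[OF i] by auto
  have rest: "finprod S (\<lambda>k. z k [^]\<^bsub>S\<^esub> (e(i := Suc (e i))) k) ?J = finprod S (\<lambda>k. z k [^]\<^bsub>S\<^esub> e k) ?J"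
    using z by (intro S.finprod_cong') auto
  have c: "finprod S (\<lambda>k. z k [^]\<^bsub>S\<^esub> e k) ?J \<in> carrier S" using z by (intro S.finprod_closed) auto
  have "single A c \<otimes>\<^bsub>S\<^esub> (z i [^]\<^bsub>S\<^esub> e i \<otimes>\<^bsub>S\<^esub> z i \<otimes>\<^bsub>S\<^esub> finprod S (\<lambda>k. z k [^]\<^bsub>S\<^esub> e k) ?J) =
      z i \<otimes>\<^bsub>S\<^esub> (single A c \<otimes>\<^bsub>S\<^esub> (z i [^]\<^bsub>S\<^esub> e i \<otimes>\<^bsub>S\<^esub> finprod S (\<lambda>k. z k [^]\<^bsub>S\<^esub> e k) ?J))"
    using z c by (simp add: single_closed S.m_ac)
  note comm = this
  have dual: "dual (c, f) = single A c \<otimes>\<^bsub>S\<^esub> finprod S (\<lambda>k. z k [^]\<^bsub>S\<^esub> f k) I" for f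
    by (simp add: dual_def z_def)
  have "dual (c, e(i := Suc (e i))) = z i \<otimes>\<^bsub>S\<^esub> dual (c, e)"
    by (simp only: dual split rest fun_upd_same S.nat_pow_Suc comm)
  then show ?thesis by (simp only: z_def)
qed

lemma dual_0:
  assumes "\<And>i. i \<in> I \<Longrightarrow> e i = 0"
  shows "dual (c, e) = single A c"
proof -
  have "finprod S (\<lambda>i. (single A (g i) \<ominus>\<^bsub>S\<^esub> \<one>\<^bsub>S\<^esub>) [^]\<^bsub>S\<^esub> e i) I = \<one>\<^bsub>S\<^esub>"
    using assms by (intro S.finprod_one_eqI) simp
  then show ?thesis by (simp add: dual_def single_closed)
qed

text \<open>Exponents stay extensional on \<open>I\<close>, so the induction starts at
  \<open>\<lambda>i\<in>I. 0\<close> and raises one exponent within \<open>I\<close> at a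
  time.\<close>

lemma exponent_induct [consumes 1, case_names zero step]:
  assumes "e \<in> PiE I (\<lambda>_. UNIV)"
    and zero: "Q (\<lambda>i\<in>I. 0)"
    and step: "\<And>e i. e \<in> PiE I (\<lambda>_. UNIV) \<Longrightarrow> i \<in> I \<Longrightarrow> Q e \<Longrightarrow> Q (e(i := Suc (e i)))"
  shows "Q (e :: 'a \<Rightarrow> nat)"
  using assms(1)
proof (induction "\<Sum>i\<in>I. e i" arbitrary: e)
  case 0
  then have "\<And>i. i \<in> I \<Longrightarrow> e i = 0" using finite_I by simp
  then have e: "e = (\<lambda>i\<in>I. 0)" using 0(2) by (auto simp: fun_eq_iff PiE_iff extensional_def)
  show ?case unfolding e by (rule zero)
next
  case (Suc n)
  then obtain i where i: "i \<in> I" "e i \<noteq> 0" by (metis sum.neutral nat.simps(3))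
  let ?e = "e(i := e i - 1)"
  have "(\<Sum>k\<in>I. e k) = e i + (\<Sum>k\<in>I - {i}. e k)" "(\<Sum>k\<in>I. ?e k) = (e i - 1) + (\<Sum>k\<in>I - {i}. e k)"
    using finite_I i(1) by (simp_all add: sum.remove)
  then have "n = (\<Sum>k\<in>I. ?e k)" using Suc(2) i(2) by simp
  moreover have e': "?e \<in> PiE I (\<lambda>_. UNIV)" using Suc.prems i(1) by (auto simp: PiE_iff extensional_def)
  ultimately have "Q ?e" by (rule Suc.hyps(1))
  from step[OF e' i(1) this] show ?case using i(2) by simp
qed

text \<open>By Pascal's rule, multiplying the argument by \<open>g i - 1\<close> turns the
  functional with exponents \<open>e'\<close> into the one with \<open>e' i\<close> lowered by one,
  so raising an exponent of the basis element matches lowering one of the functional. At the start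
  only \<open>c\<close> itself is left, of height zero, where the binomial coefficients vanish
  unless all exponents of the functional are zero.\<close>

lemma taylor_dual:
  assumes t: "(c, e) \<in> indices" and t': "t' \<in> indices"
  shows "taylor t' (dual (c, e)) = (if (c, e) = t' then 1 else 0)"
proof -
  have c: "c \<in> nonzero A" "rep c = c" and e: "e \<in> PiE I (\<lambda>_. UNIV)" using t by (auto simp: indices_def)
  show ?thesis
    using e t'
  proof (induction e arbitrary: t' rule: exponent_induct)
    case zero
    obtain c' e' where t': "t' = (c', e')" by (cases t')
    have "taylor t' (dual (c, \<lambda>i\<in>I. 0)) = weight t' c"
      unfolding taylor_def by (subst dual_0) (auto simp: lin_single c)
    also have "\<dots> = (if (c, \<lambda>i\<in>I. 0) = t' then 1 else 0)"
    proof (cases "c' = c")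
      case True
      have h: "height c i = 0" if "i \<in> I" for i using height_rep[OF c(1) that] c(2) by simp
      show ?thesis
      proof (cases "\<exists>i\<in>I. e' i \<noteq> 0")
        case True
        then obtain i where i: "i \<in> I" "e' i \<noteq> 0" by blast
        then have "(\<lambda>i\<in>I. 0) \<noteq> e'" by auto
        then show ?thesis
          using multi_binomial_0_left[of I i e' "height c"] finite_I i h by (simp add: weight_def t')
      next
        case False
        then have "e' = (\<lambda>i\<in>I. 0)"
          using zero t' by (auto simp: indices_def fun_eq_iff PiE_iff extensional_def)
        then show ?thesis
          using \<open>c' = c\<close> c multi_binomial_0_right[of I e' "height c"] False by (simp add: weight_def t')
      qed
    qed (use c in \<open>simp add: weight_def t'\<close>)
    finally show ?case .
  next
    case (step e i)
    obtain c' e' where t': "t' = (c', e')" by (cases t')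
    let ?t = "(c', e'(i := e' i - 1))"
    have gi: "g i \<in> Units A" using basis_units step(2) by auto
    then have gi': "g i \<in> nonzero A" by (rule Units_nonzero)
    have w: "weight t' (g i \<otimes> b) - weight t' b = (if e' i = 0 then 0 else weight ?t b)"
      if b: "b \<in> nonzero A" for b
    proof (cases "rep b = c'")
      case True
      have gb: "g i \<otimes> b \<in> nonzero A" using gi' b by (rule mult_nonzero)
      have e: "g i \<otimes> b = b \<otimes> unit (\<lambda>k. if k = i then 1 else 0)"
        using unit_basis[OF step(2)] b gi' by (simp add: m_comm nonzero_carrier)
      have "multi_binomial I (height (g i \<otimes> b)) e' =
          multi_binomial I ((height b)(i := height b i + 1)) e'"
        unfolding e by (rule multi_binomial_cong) (auto simp: height_mult_unit[OF b])
      then show ?thesis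
        using True b gb Units_mult_rep[OF gi b] multi_binomial_Suc[OF finite_I step(2), of "height b" e']
        by (simp add: weight_def t')
    qed (use b Units_mult_rep[OF gi b] in \<open>simp add: weight_def t'\<close>)
    have "taylor t' (dual (c, e(i := Suc (e i)))) =
        taylor t' (single A (g i) \<otimes>\<^bsub>S\<^esub> dual (c, e)) - taylor t' (dual (c, e))"
      using step(2) by (simp add: dual_step dual_closed single_closed S.minus_eq S.l_distr S.l_minus
          taylor_add taylor_a_inv)
    also have "\<dots> = lin A (\<lambda>b. weight t' (g i \<otimes> b) - weight t' b) (dual (c, e))"
      unfolding taylor_def lin_single_mult[where w = "weight t'", OF gi' weight_pzero dual_closed]
      by (simp add: lin_def right_diff_distrib sum_subtractf)
    also have "\<dots> = lin A (\<lambda>b. if e' i = 0 then 0 else weight ?t b) (dual (c, e))"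
      by (rule lin_cong) (rule w)
    also have "\<dots> = (if e' i = 0 then 0 else taylor ?t (dual (c, e)))"
      by (simp add: taylor_def lin_def)
    also have "\<dots> = (if e' i = 0 then 0 else if (c, e) = ?t then 1 else 0)"
    proof -
      \<comment> \<open>This includes the case \<open>e' i = 0\<close>, in which the truncated
        subtraction leaves \<open>e'\<close> as it is and the value has already been set to
        zero.\<close>
      have "?t \<in> indices" using step(4) step(2) by (auto simp: indices_def t' PiE_iff extensional_def)
      then show ?thesis using step(3)[of ?t] by simp
    qed
    also have "\<dots> = (if (c, e(i := Suc (e i))) = t' then 1 else 0)"
    proof (cases "e' i")
      case 0
      then have "e(i := Suc (e i)) \<noteq> e'" by (metis fun_upd_same nat.distinct(1))
      then show ?thesis using 0 by (simp add: t')
    next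
      case (Suc n)
      then have "e = e'(i := n) \<longleftrightarrow> e(i := Suc (e i)) = e'" by (auto simp: fun_eq_iff split: if_splits)
      then show ?thesis using Suc by (simp add: t')
    qed
    finally show ?case .
  qed
qed

subsection \<open>The expansion of a function up to a given order\<close>

text \<open>Expansions are made modulo powers of the ideal over zero, with integer coefficients, and
  can then be read modulo any prime \<open>P\<close>.\<close>

abbreviation "Q0 \<equiv> point {0}"

lemma Q0_ideal: "ideal Q0 S"
  using point_prime[OF int_zero_ideal] by (rule primeideal.axioms)

lemma Q0_pow_ideal: "ideal (Q0 [^]\<^bsub>ideals_set S\<^esub> (m :: nat)) S"
  by (rule S.ideals_pow_ideal[OF Q0_ideal])

lemma Q0_pow_Suc:
  assumes "i \<in> Q0 [^]\<^bsub>ideals_set S\<^esub> (m :: nat)" "j \<in> Q0"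
  shows "j \<otimes>\<^bsub>S\<^esub> i \<in> Q0 [^]\<^bsub>ideals_set S\<^esub> Suc m"
proof -
  have "i \<in> carrier S" "j \<in> carrier S"
    using assms ideal.Icarr[OF Q0_pow_ideal] ideal.Icarr[OF Q0_ideal] by auto
  then have "j \<otimes>\<^bsub>S\<^esub> i = i \<otimes>\<^bsub>S\<^esub> j" by (rule S.m_comm[rotated])
  then show ?thesis unfolding ideals_pow_Suc using ideal_prod.prod[OF assms, of S] by simp
qed

lemma single_Q0_pow: "a \<in> nonunit_power m \<Longrightarrow> single A a \<in> Q0 [^]\<^bsub>ideals_set S\<^esub> m"
proof (induction m arbitrary: a)
  case 0
  then show ?case by (simp add: ideals_one single_closed)
next
  case (Suc m)
  then obtain b c where bc: "b \<in> nonzero A" "b \<notin> Units A" "c \<in> nonunit_power m" "a = b \<otimes> c" by auto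
  have "single A b \<in> Q0" using bc by (simp add: point_def single_closed augmentation_single)
  from Q0_pow_Suc[OF Suc.IH[OF bc(3)] this] show ?case
    using bc nonunit_power_nonzero[OF bc(3)] by (simp only: single_mult)
qed

text \<open>The orbit representative contributes as many factors in \<open>Q0\<close> as its order
  of vanishing, and every \<open>g i - 1\<close> contributes one more.\<close>

lemma dual_Q0_pow:
  assumes "t \<in> indices"
  shows "dual t \<in> Q0 [^]\<^bsub>ideals_set S\<^esub> degree l t"
proof -
  obtain c e where t: "t = (c, e)" and c: "c \<in> nonzero A" and e: "e \<in> PiE I (\<lambda>_. UNIV)"
    using assms by (auto simp: indices_def)
  have "dual (c, e) \<in> Q0 [^]\<^bsub>ideals_set S\<^esub> (vanishing l c + (\<Sum>i\<in>I. e i))"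
    using e
  proof (induction e rule: exponent_induct)
    case zero
    then show ?case using single_Q0_pow[OF vanishing_mem(1)[OF c], of l] by (simp add: dual_0)
  next
    case (step e i)
    have gi: "g i \<in> Units A" using basis_units step(2) by auto
    have "single A (g i) \<ominus>\<^bsub>S\<^esub> \<one>\<^bsub>S\<^esub> \<in> Q0"
      using gi Units_nonzero[OF gi] augmentation_of_integer[of 1] unfolding point_def
      by (simp add: single_closed augmentation_def lin_minus)
        (simp add: augmentation_single flip: augmentation_def)
    from Q0_pow_Suc[OF step(3) this]
    have "dual (c, e(i := Suc (e i))) \<in> Q0 [^]\<^bsub>ideals_set S\<^esub> Suc (vanishing l c + (\<Sum>i\<in>I. e i))"
      by (simp only: dual_step[OF step(2)])
    moreover have "(\<Sum>k\<in>I. (e(i := Suc (e i))) k) = Suc (\<Sum>k\<in>I. e k)"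
      using finite_I step(2) by (simp add: sum.remove)
    ultimately show ?case by (simp only: add_Suc_right)
  qed
  then show ?thesis by (simp add: t degree_def)
qed

lemma dual_Q0_pow_large:
  assumes "t \<in> indices" "t \<notin> indices_upto l"
  shows "dual t \<in> Q0 [^]\<^bsub>ideals_set S\<^esub> Suc l"
  using dual_Q0_pow[OF assms(1), of l] assms(2)
    S.ideals_pow_antimono[OF Q0_ideal, of "Suc l" "degree l t"]
  by (auto simp: indices_upto_def assms(1) not_le simp del: nat_pow_Suc)

definition expandable :: "nat \<Rightarrow> ('a \<Rightarrow> int) set" where
  "expandable l = {f \<in> carrier S. \<exists>n. f \<ominus>\<^bsub>S\<^esub> (\<Oplus>\<^bsub>S\<^esub>t\<in>indices_upto l. \<guillemotleft>n t\<guillemotright>\<^bsub>S\<^esub> \<otimes>\<^bsub>S\<^esub> dual t)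
    \<in> Q0 [^]\<^bsub>ideals_set S\<^esub> Suc l}"

lemma dual_sum_closed:
  "(\<Oplus>\<^bsub>S\<^esub>t\<in>indices_upto l. \<guillemotleft>n t\<guillemotright>\<^bsub>S\<^esub> \<otimes>\<^bsub>S\<^esub> dual t) \<in> carrier S"
  by (intro S.finsum_closed) (auto simp: dual_closed)

lemma Q0_pow_expandable: "Q0 [^]\<^bsub>ideals_set S\<^esub> Suc l \<subseteq> expandable l"
proof
  fix f assume f: "f \<in> Q0 [^]\<^bsub>ideals_set S\<^esub> Suc l"
  then have fc: "f \<in> carrier S" by (rule ideal.Icarr[OF Q0_pow_ideal])
  have "(\<Oplus>\<^bsub>S\<^esub>t\<in>indices_upto l. \<guillemotleft>0\<guillemotright>\<^bsub>S\<^esub> \<otimes>\<^bsub>S\<^esub> dual t) = \<zero>\<^bsub>S\<^esub>"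
    by (intro S.add.finprod_one_eqI) (simp add: dual_closed)
  then have "f \<ominus>\<^bsub>S\<^esub> (\<Oplus>\<^bsub>S\<^esub>t\<in>indices_upto l. \<guillemotleft>0\<guillemotright>\<^bsub>S\<^esub> \<otimes>\<^bsub>S\<^esub> dual t) = f" using fc by (simp only: S.minus_0_r)
  then have "f \<ominus>\<^bsub>S\<^esub> (\<Oplus>\<^bsub>S\<^esub>t\<in>indices_upto l. \<guillemotleft>0\<guillemotright>\<^bsub>S\<^esub> \<otimes>\<^bsub>S\<^esub> dual t) \<in> Q0 [^]\<^bsub>ideals_set S\<^esub> Suc l"
    using f by (simp only:)
  then show "f \<in> expandable l"
    unfolding expandable_def by (intro CollectI conjI fc exI[of _ "\<lambda>_. 0"])
qed

lemma expandable_add: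
  assumes "f \<in> expandable l" "f' \<in> expandable l"
  shows "f \<oplus>\<^bsub>S\<^esub> f' \<in> expandable l"
proof -
  let ?s = "\<lambda>n. \<Oplus>\<^bsub>S\<^esub>t\<in>indices_upto l. \<guillemotleft>n t\<guillemotright>\<^bsub>S\<^esub> \<otimes>\<^bsub>S\<^esub> dual t"
  obtain n n' where f: "f \<in> carrier S" "f \<ominus>\<^bsub>S\<^esub> ?s n \<in> Q0 [^]\<^bsub>ideals_set S\<^esub> Suc l"
    and f': "f' \<in> carrier S" "f' \<ominus>\<^bsub>S\<^esub> ?s n' \<in> Q0 [^]\<^bsub>ideals_set S\<^esub> Suc l"
    using assms unfolding expandable_def by blast
  have "?s (\<lambda>t. n t + n' t) = (\<Oplus>\<^bsub>S\<^esub>t\<in>indices_upto l. \<guillemotleft>n t\<guillemotright>\<^bsub>S\<^esub> \<otimes>\<^bsub>S\<^esub> dual t \<oplus>\<^bsub>S\<^esub> \<guillemotleft>n' t\<guillemotright>\<^bsub>S\<^esub> \<otimes>\<^bsub>S\<^esub> dual t)"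
    by (intro S.finsum_cong') (auto simp: dual_closed S.l_distr)
  also have "\<dots> = ?s n \<oplus>\<^bsub>S\<^esub> ?s n'"
    by (intro S.finsum_addf) (auto simp: dual_closed)
  finally have s: "?s (\<lambda>t. n t + n' t) = ?s n \<oplus>\<^bsub>S\<^esub> ?s n'" .
  define x y where "x = ?s n" and "y = ?s n'"
  have xy: "x \<in> carrier S" "y \<in> carrier S" unfolding x_def y_def by (rule dual_sum_closed)+
  have "(f \<oplus>\<^bsub>S\<^esub> f') \<ominus>\<^bsub>S\<^esub> (x \<oplus>\<^bsub>S\<^esub> y) = (f \<ominus>\<^bsub>S\<^esub> x) \<oplus>\<^bsub>S\<^esub> (f' \<ominus>\<^bsub>S\<^esub> y)"
    using f(1) f'(1) xy by (simp add: S.minus_eq S.minus_add S.a_ac)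
  also have "\<dots> \<in> Q0 [^]\<^bsub>ideals_set S\<^esub> Suc l"
    using f(2) f'(2) unfolding x_def[symmetric] y_def[symmetric]
    by (rule additive_subgroup.a_closed[OF ideal.axioms(1)[OF Q0_pow_ideal]])
  finally have "(f \<oplus>\<^bsub>S\<^esub> f') \<ominus>\<^bsub>S\<^esub> ?s (\<lambda>t. n t + n' t) \<in> Q0 [^]\<^bsub>ideals_set S\<^esub> Suc l"
    unfolding s x_def y_def .
  moreover have "f \<oplus>\<^bsub>S\<^esub> f' \<in> carrier S" using f f' by simp
  ultimately show ?thesis unfolding expandable_def by (intro CollectI conjI exI[of _ "\<lambda>t. n t + n' t"])
qed

lemma expandable_a_inv:
  assumes "f \<in> expandable l"
  shows "\<ominus>\<^bsub>S\<^esub> f \<in> expandable l"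
proof -
  let ?s = "\<lambda>n. \<Oplus>\<^bsub>S\<^esub>t\<in>indices_upto l. \<guillemotleft>n t\<guillemotright>\<^bsub>S\<^esub> \<otimes>\<^bsub>S\<^esub> dual t"
  obtain n where f: "f \<in> carrier S" "f \<ominus>\<^bsub>S\<^esub> ?s n \<in> Q0 [^]\<^bsub>ideals_set S\<^esub> Suc l"
    using assms unfolding expandable_def by blast
  have "?s (\<lambda>t. - n t) = (\<Oplus>\<^bsub>S\<^esub>t\<in>indices_upto l. (\<ominus>\<^bsub>S\<^esub> \<one>\<^bsub>S\<^esub>) \<otimes>\<^bsub>S\<^esub> (\<guillemotleft>n t\<guillemotright>\<^bsub>S\<^esub> \<otimes>\<^bsub>S\<^esub> dual t))"
    by (intro S.finsum_cong') (auto simp: dual_closed S.l_minus)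
  also have "\<dots> = (\<ominus>\<^bsub>S\<^esub> \<one>\<^bsub>S\<^esub>) \<otimes>\<^bsub>S\<^esub> ?s n"
    using finite_indices_upto by (intro S.finsum_rdistr[symmetric]) (auto simp: dual_closed)
  finally have s: "?s (\<lambda>t. - n t) = (\<ominus>\<^bsub>S\<^esub> \<one>\<^bsub>S\<^esub>) \<otimes>\<^bsub>S\<^esub> ?s n" .
  define x where "x = ?s n"
  have x: "x \<in> carrier S" unfolding x_def by (rule dual_sum_closed)
  have "(\<ominus>\<^bsub>S\<^esub> f) \<ominus>\<^bsub>S\<^esub> ((\<ominus>\<^bsub>S\<^esub> \<one>\<^bsub>S\<^esub>) \<otimes>\<^bsub>S\<^esub> x) = (\<ominus>\<^bsub>S\<^esub> \<one>\<^bsub>S\<^esub>) \<otimes>\<^bsub>S\<^esub> (f \<ominus>\<^bsub>S\<^esub> x)"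
    using f(1) x by (simp add: S.minus_eq S.r_distr S.l_minus S.r_minus)
  also have "\<dots> \<in> Q0 [^]\<^bsub>ideals_set S\<^esub> Suc l"
    using f(2) unfolding x_def[symmetric] by (rule ideal.I_l_closed[OF Q0_pow_ideal]) simp
  finally have "(\<ominus>\<^bsub>S\<^esub> f) \<ominus>\<^bsub>S\<^esub> ?s (\<lambda>t. - n t) \<in> Q0 [^]\<^bsub>ideals_set S\<^esub> Suc l"
    unfolding s x_def .
  moreover have "\<ominus>\<^bsub>S\<^esub> f \<in> carrier S" using f by simp
  ultimately show ?thesis unfolding expandable_def by (intro CollectI conjI exI[of _ "\<lambda>t. - n t"])
qed

lemma expandable_minus:
  "f \<in> expandable l \<Longrightarrow> f' \<in> expandable l \<Longrightarrow> f \<ominus>\<^bsub>S\<^esub> f' \<in> expandable l"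
  unfolding S.minus_eq by (intro expandable_add expandable_a_inv)

lemma dual_expandable:
  assumes t: "t \<in> indices"
  shows "dual t \<in> expandable l"
proof (cases "t \<in> indices_upto l")
  case True
  have "(\<Oplus>\<^bsub>S\<^esub>s\<in>indices_upto l. \<guillemotleft>if s = t then 1 else 0\<guillemotright>\<^bsub>S\<^esub> \<otimes>\<^bsub>S\<^esub> dual s) =
      (\<Oplus>\<^bsub>S\<^esub>s\<in>indices_upto l. if t = s then dual s else \<zero>\<^bsub>S\<^esub>)"
    by (intro S.finsum_cong') (auto simp: dual_closed)
  also have "\<dots> = dual t"
    using True finite_indices_upto by (intro S.add.finprod_singleton) (auto simp: dual_closed)
  finally have "dual t \<ominus>\<^bsub>S\<^esub> (\<Oplus>\<^bsub>S\<^esub>s\<in>indices_upto l. \<guillemotleft>if s = t then 1 else 0\<guillemotright>\<^bsub>S\<^esub> \<otimes>\<^bsub>S\<^esub> dual s) = \<zero>\<^bsub>S\<^esub>"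
    using dual_closed[of t] by (simp only: S.minus_eq S.r_neg)
  then have "dual t \<ominus>\<^bsub>S\<^esub> (\<Oplus>\<^bsub>S\<^esub>s\<in>indices_upto l. \<guillemotleft>if s = t then 1 else 0\<guillemotright>\<^bsub>S\<^esub> \<otimes>\<^bsub>S\<^esub> dual s)
      \<in> Q0 [^]\<^bsub>ideals_set S\<^esub> Suc l"
    using additive_subgroup.zero_closed[OF ideal.axioms(1)[OF Q0_pow_ideal[of "Suc l"]]] by (simp only:)
  then show ?thesis
    unfolding expandable_def
    by (intro CollectI conjI dual_closed exI[of _ "\<lambda>s. if s = t then 1 else 0"])
next
  case False
  then show ?thesis using dual_Q0_pow_large[OF t] Q0_pow_expandable by blast
qed

lemma indices_step:
  "(c, e) \<in> indices \<Longrightarrow> i \<in> I \<Longrightarrow> (c, e(i := Suc (e i))) \<in> indices"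
  by (auto simp: indices_def PiE_iff extensional_def)

text \<open>This is \<open>g i = 1 + (g i - 1)\<close>, multiplied by a monomial and a basis
  element. It is read in both directions, to raise or to lower the exponent of
  \<open>g i\<close>.\<close>

lemma single_step_dual:
  assumes h: "i \<in> I" and t: "(c, e) \<in> indices"
  shows "single A (unit (h(i := h i + 1))) \<otimes>\<^bsub>S\<^esub> dual (c, e) =
    single A (unit h) \<otimes>\<^bsub>S\<^esub> dual (c, e) \<oplus>\<^bsub>S\<^esub> single A (unit h) \<otimes>\<^bsub>S\<^esub> dual (c, e(i := Suc (e i)))"
proof -
  have gi: "g i \<in> nonzero A" using basis_units h by (auto intro: Units_nonzero)
  define x y d where "x = single A (unit h)" and "y = single A (g i)" and "d = dual (c, e)"
  have c: "x \<in> carrier S" "y \<in> carrier S" "d \<in> carrier S"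
    by (simp_all add: x_def y_def d_def single_closed dual_closed)
  have "single A (unit (h(i := h i + 1))) = x \<otimes>\<^bsub>S\<^esub> y"
    unfolding x_def y_def unit_step[OF h] single_mult[OF unit_nonzero gi] ..
  moreover have "dual (c, e(i := Suc (e i))) = (y \<ominus>\<^bsub>S\<^esub> \<one>\<^bsub>S\<^esub>) \<otimes>\<^bsub>S\<^esub> d"
    unfolding dual_step[OF h] y_def d_def ..
  moreover have "x \<otimes>\<^bsub>S\<^esub> y \<otimes>\<^bsub>S\<^esub> d = x \<otimes>\<^bsub>S\<^esub> d \<oplus>\<^bsub>S\<^esub> x \<otimes>\<^bsub>S\<^esub> ((y \<ominus>\<^bsub>S\<^esub> \<one>\<^bsub>S\<^esub>) \<otimes>\<^bsub>S\<^esub> d)"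
    using c by algebra
  ultimately show ?thesis by (simp only: x_def d_def)
qed

text \<open>Negative exponents are the difficulty, since the inverse of \<open>g i\<close> has no
  finite expansion in powers of \<open>g i - 1\<close>. Modulo a power of \<open>Q0\<close> the
  geometric series stops. This takes the form of solving \<open>single_step_dual\<close> for the
  monomial with the smaller exponent, at the cost of a basis element of higher degree.\<close>

lemma unit_dual_expandable: "t \<in> indices \<Longrightarrow> single A (unit h) \<otimes>\<^bsub>S\<^esub> dual t \<in> expandable l"
proof -
  define E where "E = (\<lambda>h. \<forall>t\<in>indices. single A (unit h) \<otimes>\<^bsub>S\<^esub> dual t \<in> expandable l)"
  have zero: "E (\<lambda>_. 0)"
  proof -
    have "single A (unit (\<lambda>_. 0)) = \<one>\<^bsub>S\<^esub>" by (simp add: unit_0 monoid_ring_one single_def)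
    then show ?thesis unfolding E_def using dual_expandable dual_closed by (metis S.l_one)
  qed
  have up: "E (h(i := h i + 1))" if "E h" "i \<in> I" for h i
    unfolding E_def
  proof
    fix t assume t: "t \<in> indices"
    obtain c e where ce: "t = (c, e)" by (cases t)
    show "single A (unit (h(i := h i + 1))) \<otimes>\<^bsub>S\<^esub> dual t \<in> expandable l"
      unfolding ce single_step_dual[OF that(2) t[unfolded ce]]
      using that(1) t indices_step[OF t[unfolded ce] that(2)] unfolding E_def ce
      by (intro expandable_add) auto
  qed
  have down: "E h" if up: "E (h(i := h i + 1))" and i: "i \<in> I" for h i
    unfolding E_def
  proof
    fix t assume "t \<in> indices"
    then show "single A (unit h) \<otimes>\<^bsub>S\<^esub> dual t \<in> expandable l"
    \<comment> \<open>Descending induction on the degree: the correction term has degree one more,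
      and beyond \<open>l\<close> everything lies in the power of \<open>Q0\<close>.\<close>
    proof (induction "Suc l - degree l t" arbitrary: t rule: less_induct)
      case less
      obtain c e where ce: "t = (c, e)" by (cases t)
      note t = less.prems
      show ?case
      proof (cases "t \<in> indices_upto l")
        case False
        have "single A (unit h) \<otimes>\<^bsub>S\<^esub> dual t \<in> Q0 [^]\<^bsub>ideals_set S\<^esub> Suc l"
          by (rule ideal.I_l_closed[OF Q0_pow_ideal dual_Q0_pow_large[OF t False] single_closed])
        then show ?thesis using Q0_pow_expandable by blast
      next
        case True
        let ?t = "(c, e(i := Suc (e i)))"
        define x d d' where "x = single A (unit h)" and "d = dual t" and "d' = dual ?t"
        have c: "x \<in> carrier S" "d \<in> carrier S" "d' \<in> carrier S"
          by (simp_all add: x_def d_def d'_def single_closed dual_closed)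
        have "(\<Sum>k\<in>I. (e(i := Suc (e i))) k) = Suc (\<Sum>k\<in>I. e k)"
          using finite_I i by (simp add: sum.remove)
        then have "degree l ?t = Suc (degree l t)" by (simp only: degree_def ce fst_conv snd_conv add_Suc_right)
        then have "Suc l - degree l ?t < Suc l - degree l t"
          using True by (auto simp: indices_upto_def)
        from less.hyps[OF this indices_step[OF t[unfolded ce] i]]
        have 1: "x \<otimes>\<^bsub>S\<^esub> d' \<in> expandable l" by (simp only: x_def d'_def)
        have "single A (unit (h(i := h i + 1))) \<otimes>\<^bsub>S\<^esub> d \<in> expandable l"
          using up t unfolding E_def d_def by blast
        then have "x \<otimes>\<^bsub>S\<^esub> d \<oplus>\<^bsub>S\<^esub> x \<otimes>\<^bsub>S\<^esub> d' \<in> expandable l"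
          unfolding d_def ce single_step_dual[OF i t[unfolded ce]] x_def d'_def .
        from expandable_minus[OF this 1] have "(x \<otimes>\<^bsub>S\<^esub> d \<oplus>\<^bsub>S\<^esub> x \<otimes>\<^bsub>S\<^esub> d') \<ominus>\<^bsub>S\<^esub> x \<otimes>\<^bsub>S\<^esub> d' \<in> expandable l" .
        moreover have "(x \<otimes>\<^bsub>S\<^esub> d \<oplus>\<^bsub>S\<^esub> x \<otimes>\<^bsub>S\<^esub> d') \<ominus>\<^bsub>S\<^esub> x \<otimes>\<^bsub>S\<^esub> d' = x \<otimes>\<^bsub>S\<^esub> d"
          using c by (simp add: S.minus_eq S.a_assoc S.r_neg)
        ultimately show ?thesis by (simp only: x_def d_def)
      qed
    qed
  qed
  \<comment> \<open>\<open>J\<close> contains the places in \<open>I\<close> where \<open>h\<close>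
    may be nonzero; each exponent there is moved from zero to its value by unit steps up or
    down.\<close>
  have "E h" if "finite J" "J \<subseteq> I" "\<And>i. i \<in> I - J \<Longrightarrow> h i = 0" for J h
    using that
  proof (induction J arbitrary: h rule: finite_induct)
    case empty
    then have "unit h = unit (\<lambda>_. 0)" by (intro unit_cong) auto
    then show ?case using zero by (simp add: E_def)
  next
    case (insert i J)
    have "E (h(i := k))" for k :: int
    proof (induction k rule: int_induct[where k = 0])
      case base
      show ?case by (rule insert.IH) (use insert.prems in auto)
    next
      case (step1 k)
      have "E ((h(i := k))(i := (h(i := k)) i + 1))"
        using step1(2) by (rule up) (use insert.prems in auto)
      then show ?case by (simp only: fun_upd_upd fun_upd_same)
    next
      case (step2 k)
      have "E ((h(i := k - 1))(i := (h(i := k - 1)) i + 1))"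
        using step2(2) by (simp only: fun_upd_upd fun_upd_same diff_add_cancel)
      then show ?case by (rule down) (use insert.prems in auto)
    qed
    from this[of "h i"] show ?case by simp
  qed
  from this[OF finite_I, of h] have "E h" by simp
  then show "t \<in> indices \<Longrightarrow> single A (unit h) \<otimes>\<^bsub>S\<^esub> dual t \<in> expandable l" by (simp add: E_def)
qed

lemma expandable_all:
  assumes "f \<in> carrier S"
  shows "f \<in> expandable l"
proof (rule additive_subgroup_monoid_ring_eq[OF _ _ assms])
  show "additive_subgroup (expandable l) S"
  proof (intro additive_subgroup.intro, unfold_locales, goal_cases)
    case 1
    then show ?case by (auto simp: expandable_def)
  next
    case (2 x y)
    then show ?case using expandable_add by simp
  next
    case 3
    have "\<zero>\<^bsub>S\<^esub> \<in> expandable l"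
      by (rule subsetD[OF Q0_pow_expandable additive_subgroup.zero_closed[OF ideal.axioms(1)[OF Q0_pow_ideal]]])
    then show ?case by simp
  next
    case (4 x)
    then show ?case using expandable_a_inv unfolding a_inv_def by blast
  qed
  fix a assume a: "a \<in> nonzero A"
  have t: "(rep a, \<lambda>i\<in>I. 0) \<in> indices" using rep(1)[OF a] rep_rep[OF a] by (auto simp: indices_def)
  have "single A a = single A (unit (height a) \<otimes> rep a)"
    using rep(2)[OF a] rep(1)[OF a] by (metis m_comm nonzero_carrier unit_closed)
  also have "\<dots> = single A (unit (height a)) \<otimes>\<^bsub>S\<^esub> dual (rep a, \<lambda>i\<in>I. 0)"
    using rep(1)[OF a] by (subst dual_0) (auto simp: single_mult unit_nonzero)
  finally show "single A a \<in> expandable l" using unit_dual_expandable[OF t] by simp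
qed

subsection \<open>Hilbert-Samuel functions at distinguished points\<close>

lemma lin_finsum:
  assumes "finite F" "\<And>t. t \<in> F \<Longrightarrow> h t \<in> carrier S"
  shows "lin A w (\<Oplus>\<^bsub>S\<^esub>t\<in>F. h t) = (\<Sum>t\<in>F. lin A w (h t))"
  using assms
proof (induction F rule: finite_induct)
  case (insert x F)
  then have "(\<Oplus>\<^bsub>S\<^esub>t\<in>F. h t) \<in> carrier S" by (intro S.finsum_closed) auto
  moreover have "(\<Oplus>\<^bsub>S\<^esub>t\<in>insert x F. h t) = h x \<oplus>\<^bsub>S\<^esub> (\<Oplus>\<^bsub>S\<^esub>t\<in>F. h t)"
    using insert by (intro S.finsum_insert) auto
  ultimately show ?case using insert by (simp add: lin_add)
qed (simp add: lin_zero)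

text \<open>Elements of the power of \<open>Q0\<close> have no coefficients of degree at most
  \<open>l\<close>, so by duality the coefficients in the expansion of \<open>f\<close> are its
  Taylor coefficients. If these lie in \<open>P\<close>, every term lies in \<open>K\<close>. This
  makes the bottom of the chain the least admissible ideal.\<close>

lemma taylor_eq_zeroD:
  assumes P: "ideal P \<Z>" and f: "f \<in> carrier S" "\<And>t. t \<in> indices_upto l \<Longrightarrow> taylor t f \<in> P"
    and K: "ideal K S" "Q0 [^]\<^bsub>ideals_set S\<^esub> Suc l \<subseteq> K" "\<And>n. n \<in> P \<Longrightarrow> \<guillemotleft>n\<guillemotright>\<^bsub>S\<^esub> \<in> K"
  shows "f \<in> K"
proof -
  interpret K: ideal K S by fact
  obtain n where n: "f \<ominus>\<^bsub>S\<^esub> (\<Oplus>\<^bsub>S\<^esub>t\<in>indices_upto l. \<guillemotleft>n t\<guillemotright>\<^bsub>S\<^esub> \<otimes>\<^bsub>S\<^esub> dual t)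
      \<in> Q0 [^]\<^bsub>ideals_set S\<^esub> Suc l"
    using expandable_all[OF f(1), of l] unfolding expandable_def by blast
  define x where "x = (\<Oplus>\<^bsub>S\<^esub>t\<in>indices_upto l. \<guillemotleft>n t\<guillemotright>\<^bsub>S\<^esub> \<otimes>\<^bsub>S\<^esub> dual t)"
  have x: "x \<in> carrier S" unfolding x_def by (rule dual_sum_closed)
  have "n s \<in> P" if s: "s \<in> indices_upto l" for s
  proof -
    have "taylor s (f \<ominus>\<^bsub>S\<^esub> x) \<in> {0}"
      using n s unfolding x_def[symmetric]
      by (intro taylor_point_pow[OF primeideal.axioms(1)[OF int_zero_ideal] Q0_ideal, of _ "Suc l" s l])
        (auto simp: indices_upto_def)
    then have "taylor s f = taylor s x" using taylor_minus[OF f(1) x, of s] by simp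
    also have "taylor s x = (\<Sum>t\<in>indices_upto l. n t * taylor s (dual t))"
      unfolding x_def taylor_def using finite_indices_upto[of l]
      by (subst lin_finsum) (auto simp: dual_closed lin_int_mult[OF S.cring_axioms])
    also have "\<dots> = (\<Sum>t\<in>indices_upto l. if t = s then n t else 0)"
    proof (intro sum.cong refl)
      fix t assume "t \<in> indices_upto l"
      then show "n t * taylor s (dual t) = (if t = s then n t else 0)"
        using taylor_dual[of "fst t" "snd t" s] s by (auto simp: indices_upto_def)
    qed
    also have "\<dots> = n s" using s finite_indices_upto[of l] by simp
    finally show ?thesis using f(2)[OF s] by simp
  qed
  then have mem: "\<guillemotleft>n t\<guillemotright>\<^bsub>S\<^esub> \<otimes>\<^bsub>S\<^esub> dual t \<in> K" if "t \<in> indices_upto l" for t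
    using that K(3) dual_closed by (intro K.I_r_closed) auto
  have "(\<Oplus>\<^bsub>S\<^esub>t\<in>F. \<guillemotleft>n t\<guillemotright>\<^bsub>S\<^esub> \<otimes>\<^bsub>S\<^esub> dual t) \<in> K" if "finite F" "F \<subseteq> indices_upto l" for F
    using that
  proof (induction F rule: finite_induct)
    case (insert t F)
    then show ?case
      using K.a_closed mem by (subst S.finsum_insert) (auto simp: dual_closed)
  qed simp
  from this[OF finite_indices_upto order_refl] have "x \<in> K" unfolding x_def .
  moreover have "f \<ominus>\<^bsub>S\<^esub> x \<in> K" using n K(2) unfolding x_def by blast
  ultimately have "(f \<ominus>\<^bsub>S\<^esub> x) \<oplus>\<^bsub>S\<^esub> x \<in> K" by (rule K.a_closed[rotated])
  moreover have "(f \<ominus>\<^bsub>S\<^esub> x) \<oplus>\<^bsub>S\<^esub> x = f" using f(1) x by (simp add: S.minus_eq S.a_assoc S.l_neg)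
  ultimately show ?thesis by simp
qed

text \<open>The members of the chain impose vanishing modulo \<open>P\<close> on an initial segment
  of the Taylor coefficients, listed by degree. Triangularity makes them saturated ideals, the dual
  basis makes the inclusions strict, and each step frees a single coefficient, so the factors are
  simple over the local ring.\<close>

theorem hilbert_samuel_point:
  assumes P: "primeideal P \<Z>" and T: "local_fraction_hom S T (point P) \<psi>"
    and ker: "\<And>f t. f \<in> carrier S \<Longrightarrow> \<psi> f = \<zero>\<^bsub>T\<^esub> \<Longrightarrow> t \<in> indices_upto l \<Longrightarrow> taylor t f \<in> P"
    and char: "\<And>n. n \<in> P \<Longrightarrow> \<psi> \<guillemotleft>n\<guillemotright>\<^bsub>S\<^esub> = \<zero>\<^bsub>T\<^esub>"
  shows "hilbert_samuel T l = enat (card (indices_upto l))"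
proof -
  interpret L: local_fraction_hom S T "point P" \<psi> by (rule T)
  have PI: "ideal P \<Z>" using P by (rule primeideal.axioms)
  have QI: "ideal (point P) S" by (rule L.Q.is_ideal)
  note P' = int_idealD[OF PI]
  have prime: "m \<in> P \<or> n \<in> P" if "m * n \<in> P" for m n
    using primeideal.I_prime[OF P, of m n] that by simp
  have one: "1 \<notin> P" using primeideal.compl_one[OF P] by simp
  let ?N = "card (indices_upto l)"
  \<comment> \<open>Sorting by degree puts all indices of smaller degree before a given one; the
    order within a degree is arbitrary.\<close>
  obtain ts where ts: "set ts = indices_upto l" "distinct ts" "sorted (map (degree l) ts)"
  proof -
    obtain xs where "set xs = indices_upto l" "distinct xs"
      using finite_distinct_list[OF finite_indices_upto] by blast
    then show ?thesis by (intro that[of "sort_key (degree l) xs"]) auto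
  qed
  have len: "length ts = ?N" using ts distinct_card by force
  have before: "\<exists>k<j. t = ts ! k"
    if b: "t \<in> indices_upto l" "degree l t < degree l (ts ! j)" "j < ?N" for t j
  proof -
    obtain k where k: "k < length ts" "t = ts ! k" using b(1) ts(1) by (metis in_set_conv_nth)
    have "k < j"
    proof (rule ccontr)
      assume "\<not> k < j"
      then have "degree l (ts ! j) \<le> degree l (ts ! k)"
        using ts(3) k(1) by (simp add: sorted_iff_nth_mono)
      then show False using b(2) k(2) by simp
    qed
    then show ?thesis using k(2) by blast
  qed
  have nth: "ts ! j \<in> indices_upto l" if "j < ?N" for j using that ts(1) len nth_mem by metis
  define J where "J = (\<lambda>i. {f \<in> carrier S. \<forall>j < ?N - i. taylor (ts ! j) f \<in> P})"
  have mult: "taylor (ts ! j) (u \<otimes>\<^bsub>S\<^esub> f) - augmentation u * taylor (ts ! j) f \<in> P"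
    if m: "j < ?N" "u \<in> carrier S" "f \<in> carrier S" "\<And>k. k < j \<Longrightarrow> taylor (ts ! k) f \<in> P" for j u f
  proof (rule taylor_mult[OF PI nth[OF m(1)] m(2,3)])
    fix t assume "t \<in> indices_upto l" "degree l t < degree l (ts ! j)"
    then have "\<exists>k<j. t = ts ! k" using m(1) by (rule before)
    then show "taylor t f \<in> P" using m(4) by auto
  qed
  have J_ideal: "ideal (J i) S" for i
  proof (rule idealI[OF S.ring_axioms])
    show "subgroup (J i) (add_monoid S)"
    proof (unfold_locales, goal_cases)
      case (4 x)
      then show ?case unfolding a_inv_def[symmetric] by (auto simp: J_def taylor_a_inv P'(4))
    qed (auto simp: J_def taylor_add taylor_zero P'(1,3))
    have J_mult: "u \<otimes>\<^bsub>S\<^esub> f \<in> J i" if "f \<in> J i" "u \<in> carrier S" for f u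
    proof -
      have "taylor (ts ! j) (u \<otimes>\<^bsub>S\<^esub> f) \<in> P" if j: "j < ?N - i" for j
      proof -
        have "taylor (ts ! j) (u \<otimes>\<^bsub>S\<^esub> f) - augmentation u * taylor (ts ! j) f \<in> P"
          using \<open>f \<in> J i\<close> \<open>u \<in> carrier S\<close> j by (intro mult) (auto simp: J_def)
        moreover have "augmentation u * taylor (ts ! j) f \<in> P"
          using \<open>f \<in> J i\<close> j by (intro P'(2)) (auto simp: J_def)
        ultimately show ?thesis by (rule P'(6))
      qed
      then show ?thesis using that by (auto simp: J_def)
    qed
    show "x \<otimes>\<^bsub>S\<^esub> f \<in> J i" "f \<otimes>\<^bsub>S\<^esub> x \<in> J i" if "f \<in> J i" "x \<in> carrier S" for f x
    proof -
      show "x \<otimes>\<^bsub>S\<^esub> f \<in> J i" using that by (rule J_mult)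
      moreover have "f \<otimes>\<^bsub>S\<^esub> x = x \<otimes>\<^bsub>S\<^esub> f" using that by (intro S.m_comm) (auto simp: J_def)
      ultimately show "f \<otimes>\<^bsub>S\<^esub> x \<in> J i" by simp
    qed
  qed
  have J_saturated: "L.saturated (J i)" for i
    unfolding L.saturated_def
  proof (intro ballI impI)
    fix f u assume f: "f \<in> carrier S" and u: "u \<in> carrier S - point P" and uf: "u \<otimes>\<^bsub>S\<^esub> f \<in> J i"
    \<comment> \<open>Once the earlier coefficients are in \<open>P\<close>, the next one lies in
      \<open>P\<close> after multiplication by the value of \<open>u\<close>, which itself is
      outside the prime \<open>P\<close>.\<close>
    have "taylor (ts ! j) f \<in> P" if "j < ?N - i" for j
      using that
    proof (induction j rule: less_induct)
      case (less j)
      have "taylor (ts ! j) (u \<otimes>\<^bsub>S\<^esub> f) - augmentation u * taylor (ts ! j) f \<in> P"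
        using less f u by (intro mult) auto
      moreover have "taylor (ts ! j) (u \<otimes>\<^bsub>S\<^esub> f) \<in> P" using uf less.prems by (simp add: J_def)
      ultimately have "augmentation u * taylor (ts ! j) f \<in> P" by (rule P'(5))
      then have "augmentation u \<in> P \<or> taylor (ts ! j) f \<in> P" by (rule prime)
      moreover have "augmentation u \<notin> P" using u by (rule not_point)
      ultimately show ?case by blast
    qed
    then show "f \<in> J i" using f by (simp add: J_def)
  qed
  show ?thesis
  proof (rule L.hilbert_samuel_eq[of ?N J])
    fix i assume i: "i < ?N"
    \<comment> \<open>The condition imposed by \<open>J i\<close> and dropped in
      \<open>J (Suc i)\<close>; the dual basis element with this index lies in the
      difference.\<close>
    let ?j = "?N - Suc i"
    have j: "?j < ?N" "ts ! ?j \<in> indices" using i nth[of ?j] by (auto simp: indices_upto_def)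
    have t: "taylor (ts ! k) (dual (ts ! ?j)) = (if k = ?j then 1 else 0)" if "k < ?N" for k
      using taylor_dual[of "fst (ts ! ?j)" "snd (ts ! ?j)" "ts ! k"] j nth[OF that] that
        nth_eq_iff_index_eq[OF ts(2), of ?j k] len by (auto simp: indices_upto_def)
    have "dual (ts ! ?j) \<in> J (Suc i)" using t P'(3) by (auto simp: J_def dual_closed)
    moreover have "dual (ts ! ?j) \<notin> J i"
    proof
      assume "dual (ts ! ?j) \<in> J i"
      moreover have "?j < ?N - i" using i by simp
      ultimately have "taylor (ts ! ?j) (dual (ts ! ?j)) \<in> P" unfolding J_def by blast
      then show False using t[OF j(1)] one by simp
    qed
    ultimately show "J i \<subset> J (Suc i)" by (auto simp: J_def)
  next
    show "J ?N = carrier S" by (simp add: J_def)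
    show "point P [^]\<^bsub>ideals_set S\<^esub> (l + 1) \<subseteq> J 0"
    proof
      fix f assume f: "f \<in> point P [^]\<^bsub>ideals_set S\<^esub> (l + 1)"
      then have "taylor (ts ! j) f \<in> P" if "j < ?N" for j
        using nth[OF that] by (intro taylor_point_pow[OF PI QI f]) (auto simp: indices_upto_def)
      moreover have "f \<in> carrier S" using ideal.Icarr[OF S.ideals_pow_ideal[OF QI] f] .
      ultimately show "f \<in> J 0" by (simp add: J_def)
    qed
    show "{s \<in> carrier S. \<psi> s = \<zero>\<^bsub>T\<^esub>} \<subseteq> J 0"
      using ker[OF _ _ nth] by (auto simp: J_def)
  next
    fix K assume K: "ideal K S" "L.saturated K" "point P [^]\<^bsub>ideals_set S\<^esub> (l + 1) \<subseteq> K"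
      "{s \<in> carrier S. \<psi> s = \<zero>\<^bsub>T\<^esub>} \<subseteq> K"
    show "J 0 \<subseteq> K"
    proof
      fix f assume f: "f \<in> J 0"
      have fc: "f \<in> carrier S" using f by (simp add: J_def)
      show "f \<in> K"
      proof (rule taylor_eq_zeroD[OF PI fc _ K(1)])
        show "taylor t f \<in> P" if t: "t \<in> indices_upto l" for t
        proof -
          obtain j where "j < ?N" "t = ts ! j" using t ts(1) len by (metis in_set_conv_nth)
          then show ?thesis using f by (simp add: J_def)
        qed
        \<comment> \<open>The expansion modulo powers of \<open>Q0\<close> is enough here, because
          the integers of \<open>P\<close> lie in \<open>K\<close> through the kernel.\<close>
        have "Q0 \<subseteq> point P" using P'(3) by (intro point_mono) simp
        from S.ideals_pow_mono[OF this, of "l + 1"] K(3)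
        show "Q0 [^]\<^bsub>ideals_set S\<^esub> Suc l \<subseteq> K" unfolding Suc_eq_plus1 by (rule order_trans)
        show "\<guillemotleft>n\<guillemotright>\<^bsub>S\<^esub> \<in> K" if "n \<in> P" for n
          using char[OF that] K(4) S.of_int_closed[of n] by blast
      qed
    qed
  next
    fix i s t assume i: "i < ?N" and s: "s \<in> J (Suc i)" and t: "t \<in> J (Suc i)" "t \<notin> J i"
    let ?j = "?N - Suc i"
    have c: "s \<in> carrier S" "t \<in> carrier S" using s t by (auto simp: J_def)
    \<comment> \<open>Cross-multiplying with the two values of the freed coefficient cancels it;
      \<open>m\<close> is an integer outside \<open>P\<close>, hence an admissible
      denominator.\<close>
    define m n where "m = taylor (ts ! ?j) t" and "n = taylor (ts ! ?j) s"
    have le: "j < ?j \<or> j = ?j" if "j < ?N - i" for j using that by auto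
    have "m \<notin> P"
    proof
      assume "m \<in> P"
      have "taylor (ts ! j) t \<in> P" if "j < ?N - i" for j
        using le[OF that]
      proof
        assume "j < ?j"
        then show ?thesis using t(1) by (simp add: J_def)
      qed (use \<open>m \<in> P\<close> in \<open>simp add: m_def\<close>)
      then show False using t(2) c by (simp add: J_def)
    qed
    then have "\<guillemotleft>m\<guillemotright>\<^bsub>S\<^esub> \<in> carrier S - point P" by (rule of_integer_not_point)
    moreover have "\<guillemotleft>m\<guillemotright>\<^bsub>S\<^esub> \<otimes>\<^bsub>S\<^esub> s \<ominus>\<^bsub>S\<^esub> \<guillemotleft>n\<guillemotright>\<^bsub>S\<^esub> \<otimes>\<^bsub>S\<^esub> t \<in> J i"
    proof -
      have "m * taylor (ts ! j) s - n * taylor (ts ! j) t \<in> P" if j: "j < ?N - i" for j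
        using le[OF j]
      proof
        assume "j < ?j"
        then have "m * taylor (ts ! j) s \<in> P" "- (n * taylor (ts ! j) t) \<in> P"
          using s t(1) P'(2,4) by (auto simp: J_def)
        from P'(1)[OF this] show ?thesis by simp
      next
        assume "j = ?j"
        then show ?thesis using P'(3) by (simp add: m_def n_def mult.commute)
      qed
      then show ?thesis using c by (auto simp: J_def taylor_minus taylor_int_mult)
    qed
    ultimately show "\<exists>u\<in>carrier S - point P. \<exists>v\<in>carrier S. u \<otimes>\<^bsub>S\<^esub> s \<ominus>\<^bsub>S\<^esub> v \<otimes>\<^bsub>S\<^esub> t \<in> J i"
      by (intro bexI[of _ "\<guillemotleft>m\<guillemotright>\<^bsub>S\<^esub>"] bexI[of _ "\<guillemotleft>n\<guillemotright>\<^bsub>S\<^esub>"]) auto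
  next
    fix i
    show "ideal (J i) S" by (rule J_ideal)
    show "L.saturated (J i)" by (rule J_saturated)
  qed
qed

text \<open>By triangularity a coefficient of \<open>f\<close> of least degree outside
  \<open>P\<close> would appear in the product with \<open>u\<close>, multiplied by the value of
  \<open>u\<close>, and so still be outside \<open>P\<close>.\<close>

lemma taylor_saturated:
  assumes P: "primeideal P \<Z>" and f: "f \<in> carrier S" and u: "u \<in> carrier S - point P"
    and uf: "\<And>t. t \<in> indices_upto l \<Longrightarrow> taylor t (u \<otimes>\<^bsub>S\<^esub> f) \<in> P"
  shows "t \<in> indices_upto l \<Longrightarrow> taylor t f \<in> P"
proof (induction "degree l t" arbitrary: t rule: less_induct)
  case less
  have PI: "ideal P \<Z>" using P by (rule primeideal.axioms)
  note P' = int_idealD[OF PI]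
  have "taylor t (u \<otimes>\<^bsub>S\<^esub> f) - augmentation u * taylor t f \<in> P"
    by (rule taylor_mult[OF PI less.prems _ f]) (use u less.hyps in auto)
  then have "augmentation u * taylor t f \<in> P" using uf[OF less.prems] by (rule P'(5))
  then show ?case
    using primeideal.I_prime[OF P, of "augmentation u" "taylor t f"] u by (auto simp: point_def)
qed

text \<open>An element of \<open>S\<close> that becomes zero in the local ring need not vanish in
  \<open>T\<close>; it is only killed there by some \<open>v\<close> outside the prime. Clearing the
  denominators of \<open>v\<close> gives an \<open>s\<close> outside \<open>point P\<close> whose
  product with the element is in the kernel of \<open>h\<close>, and \<open>taylor_saturated\<close>
  removes \<open>s\<close>.\<close>

theorem hilbert_samuel_at_ext:
  assumes P: "primeideal P \<Z>" and F: "fraction_hom S T (point P) h"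
    and ker: "\<And>f t. f \<in> carrier S \<Longrightarrow> h f = \<zero>\<^bsub>T\<^esub> \<Longrightarrow> taylor t f \<in> P"
    and char: "\<And>n. n \<in> P \<Longrightarrow> h \<guillemotleft>n\<guillemotright>\<^bsub>S\<^esub> = \<zero>\<^bsub>T\<^esub>"
  shows "hilbert_samuel_at T (fraction_hom.ext S T (point P) h (point P)) l =
    enat (card (indices_upto l))"
proof -
  interpret F: fraction_hom S T "point P" h by (rule F)
  interpret E: primeideal "F.ext (point P)" T by (rule F.ext_prime)
  let ?E = "F.ext (point P)"
  show ?thesis
    unfolding hilbert_samuel_at_def
  proof (rule hilbert_samuel_point[OF P E.local_fraction_hom_localization[OF F refl]])
    show "fraction T ?E (h \<guillemotleft>n\<guillemotright>\<^bsub>S\<^esub>) \<one>\<^bsub>T\<^esub> = \<zero>\<^bsub>localization T ?E\<^esub>" if "n \<in> P" for n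
      by (simp add: char[OF that] E.localization_zero)
    fix f t
    assume f: "f \<in> carrier S" "fraction T ?E (h f) \<one>\<^bsub>T\<^esub> = \<zero>\<^bsub>localization T ?E\<^esub>"
      and t: "t \<in> indices_upto l"
    have hf: "h f \<in> carrier T" using f(1) by simp
    obtain v where v: "v \<in> carrier T - ?E" "v \<otimes>\<^bsub>T\<^esub> (h f \<otimes>\<^bsub>T\<^esub> \<one>\<^bsub>T\<^esub>) = v \<otimes>\<^bsub>T\<^esub> (\<zero>\<^bsub>T\<^esub> \<otimes>\<^bsub>T\<^esub> \<one>\<^bsub>T\<^esub>)"
      using f(2) E.fraction_eq_iff[OF hf E.compl_one F.T.zero_closed E.compl_one]
      unfolding E.localization_zero by blast
    have vf: "v \<otimes>\<^bsub>T\<^esub> h f = \<zero>\<^bsub>T\<^esub>" using v hf by simp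
    obtain s u where s: "s \<in> carrier S" "u \<in> carrier S - point P" "h u \<otimes>\<^bsub>T\<^esub> v = h s"
      using F.denominators[of v] v(1) by blast
    have "s \<notin> point P"
      using s v(1) unfolding F.ext_def by blast
    moreover have "h (s \<otimes>\<^bsub>S\<^esub> f) = \<zero>\<^bsub>T\<^esub>"
    proof -
      have "h (s \<otimes>\<^bsub>S\<^esub> f) = h u \<otimes>\<^bsub>T\<^esub> v \<otimes>\<^bsub>T\<^esub> h f" using s(1) f(1) by (simp add: s(3))
      also have "\<dots> = h u \<otimes>\<^bsub>T\<^esub> (v \<otimes>\<^bsub>T\<^esub> h f)" using s(2) v(1) hf by (simp add: F.T.m_assoc)
      finally show ?thesis using s(2) vf by simp
    qed
    ultimately show "taylor t f \<in> P"
      using s(1) f(1) t by (intro taylor_saturated[OF P f(1), of s]) (auto intro: ker)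
  qed
qed

corollary hilbert_samuel_at_point:
  "hilbert_samuel_at S (point {0}) l = enat (card (indices_upto l))"
proof -
  note prime = point_prime[OF int_zero_ideal]
  note F = primeideal.fraction_hom_id[OF prime S.cring_axioms]
  have "hilbert_samuel_at S (fraction_hom.ext S S (point {0}) (\<lambda>x. x) (point {0})) l =
      enat (card (indices_upto l))"
    by (rule hilbert_samuel_at_ext[OF int_zero_ideal F(1)]) (auto simp: taylor_zero)
  then show ?thesis unfolding F(2) .
qed

text \<open>Taylor coefficients are additive maps to the integers, so
  \<open>fibre_fraction_hom\<close> forces them into \<open>P\<close> on the kernel;
  \<open>the_prime_eq\<close> evaluates the definite description of the point.\<close>

corollary hilbert_samuel_at_fibre_point:
  assumes P: "primeideal P \<Z>"
  shows "hilbert_samuel_at (fibre S P) (fibre_point S P (point P)) l =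
    enat (card (indices_upto l))"
proof -
  note fib = fibre_fraction_hom[OF S.cring_axioms P point_prime[OF P] augmentation_add
      augmentation_of_integer point_def]
  have "fibre_point S P (point P) = fraction_hom.ext S (fibre S P) (point P)
      (\<lambda>s. tensor S (residue_field \<Z> P) s \<one>\<^bsub>residue_field \<Z> P\<^esub>) (point P)"
    unfolding fibre_point_def by (rule fraction_hom.the_prime_eq[OF fib(1)])
  moreover have "hilbert_samuel_at (fibre S P) (fraction_hom.ext S (fibre S P) (point P)
      (\<lambda>s. tensor S (residue_field \<Z> P) s \<one>\<^bsub>residue_field \<Z> P\<^esub>) (point P)) l =
      enat (card (indices_upto l))"
    by (rule hilbert_samuel_at_ext[OF P fib(1)]) (use fib(2,3) taylor_add in blast)+
  ultimately show ?thesis by (simp only:)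
qed

end

subsection \<open>Homomorphisms of monoid rings\<close>

lemma lin_mult_of_multiplicative:
  assumes A: "pointed_comm_monoid A" and w: "w (pzero A) = 0"
    and mult: "\<And>a b. a \<in> nonzero A \<Longrightarrow> b \<in> nonzero A \<Longrightarrow> w (a \<otimes>\<^bsub>A\<^esub> b) = w a * w b"
    and f: "f \<in> carrier (monoid_ring \<Z> A)" and f': "f' \<in> carrier (monoid_ring \<Z> A)"
  shows "lin A w (f \<otimes>\<^bsub>monoid_ring \<Z> A\<^esub> f') = lin A w f * lin A w f'"
proof -
  interpret A: pointed_comm_monoid A by fact
  interpret S: cring "monoid_ring \<Z> A" by (rule A.cring_monoid_ring)
  show ?thesis
  proof (rule additive_ext_monoid_ring[where A = A and T = \<Z>, OF _ _ _ _ _ _ f])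
    fix a assume a: "a \<in> nonzero A"
    have "lin A w (single A a \<otimes>\<^bsub>monoid_ring \<Z> A\<^esub> f') = lin A (\<lambda>b. w (a \<otimes>\<^bsub>A\<^esub> b)) f'"
      by (rule A.lin_single_mult[where w = w, OF a w f'])
    also have "\<dots> = lin A (\<lambda>b. w a * w b) f'" by (rule lin_cong) (rule mult[OF a])
    also have "\<dots> = w a * lin A w f'" by (simp add: lin_def sum_distrib_left ac_simps)
    finally show "lin A w (single A a \<otimes>\<^bsub>monoid_ring \<Z> A\<^esub> f') = lin A w (single A a) * lin A w f'"
      by (simp add: lin_single a)
  next
    show "abelian_group \<Z>" by (rule ring.axioms(1)[OF cring.axioms(1)[OF int_is_cring]])
  qed (use f' in \<open>auto simp: S.l_distr lin_add distrib_right\<close>)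
qed

lemma monoid_term_of_integer:
  assumes "pointed_comm_monoid A"
  shows "monoid_term \<Z> A n \<one>\<^bsub>A\<^esub> = \<guillemotleft>n\<guillemotright>\<^bsub>monoid_ring \<Z> A\<^esub>"
proof -
  interpret A: pointed_comm_monoid A by fact
  interpret S: cring "monoid_ring \<Z> A" by (rule A.cring_monoid_ring)
  have add: "monoid_term \<Z> A (m + n) \<one>\<^bsub>A\<^esub> =
      monoid_term \<Z> A m \<one>\<^bsub>A\<^esub> \<oplus>\<^bsub>monoid_ring \<Z> A\<^esub> monoid_term \<Z> A n \<one>\<^bsub>A\<^esub>" for m n
    by (auto simp: monoid_term_def monoid_ring_add)
  show ?thesis
  proof (induction n rule: int_induct[where k = 0])
    case base
    have "monoid_term \<Z> A 0 \<one>\<^bsub>A\<^esub> = \<zero>\<^bsub>monoid_ring \<Z> A\<^esub>"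
      by (auto simp: monoid_term_def monoid_ring_zero)
    then show ?case by simp
  next
    case (step1 n)
    then show ?case by (simp add: add S.of_int_add flip: monoid_ring_one)
  next
    case (step2 n)
    have "\<guillemotleft>n\<guillemotright>\<^bsub>monoid_ring \<Z> A\<^esub> = monoid_term \<Z> A (n - 1) \<one>\<^bsub>A\<^esub> \<oplus>\<^bsub>monoid_ring \<Z> A\<^esub> \<one>\<^bsub>monoid_ring \<Z> A\<^esub>"
      using add[of "n - 1" 1] step2(2) by (simp add: monoid_ring_one)
    moreover have "\<guillemotleft>n\<guillemotright>\<^bsub>monoid_ring \<Z> A\<^esub> = \<guillemotleft>n - 1\<guillemotright>\<^bsub>monoid_ring \<Z> A\<^esub> \<oplus>\<^bsub>monoid_ring \<Z> A\<^esub> \<one>\<^bsub>monoid_ring \<Z> A\<^esub>"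
      using S.of_int_add[of "n - 1" 1] by (simp only: diff_add_cancel S.of_int_1)
    moreover have "monoid_term \<Z> A (n - 1) \<one>\<^bsub>A\<^esub> \<in> carrier (monoid_ring \<Z> A)"
    proof -
      have "supp A (monoid_term \<Z> A (n - 1) \<one>\<^bsub>A\<^esub>) \<subseteq> {\<one>\<^bsub>A\<^esub>}"
        by (auto simp: supp_def monoid_term_def split: if_splits)
      then show ?thesis
        using finite_subset[of _ "{\<one>\<^bsub>A\<^esub>}"] by (simp add: monoid_ring_carrier monoid_term_def)
    qed
    ultimately show ?case by (metis S.add.r_cancel S.of_int_closed S.one_closed)
  qed
qed

text \<open>Each coefficient of the image is a functional \<open>lin\<close>, which gives
  additivity. Multiplicativity is then checked on monoid elements, where a product that vanishes in
  \<open>B\<close> also vanishes in \<open>A\<close>.\<close>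

lemma monoid_ring_map_hom:
  assumes A: "pointed_comm_monoid A" and B: "pointed_comm_monoid B"
    and \<phi>: "\<phi> \<in> pointed_hom B A" and nz: "\<And>b. b \<in> nonzero B \<Longrightarrow> \<phi> b \<in> nonzero A"
  shows "monoid_ring_map \<Z> B A \<phi> \<in> ring_hom (monoid_ring \<Z> B) (monoid_ring \<Z> A)"
    and "\<And>b. b \<in> nonzero B \<Longrightarrow> monoid_ring_map \<Z> B A \<phi> (single B b) = single A (\<phi> b)"
proof -
  interpret A: pointed_comm_monoid A by fact
  interpret B: pointed_comm_monoid B by fact
  let ?S = "monoid_ring \<Z> A" and ?R = "monoid_ring \<Z> B" and ?h = "monoid_ring_map \<Z> B A \<phi>"
  interpret S: cring ?S by (rule A.cring_monoid_ring)
  interpret R: cring ?R by (rule B.cring_monoid_ring)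
  have h: "?h f = (\<lambda>a\<in>nonzero A. lin B (\<lambda>b. if \<phi> b = a then 1 else 0) f)"
    if f: "f \<in> carrier ?R" for f
  proof -
    have "(\<Sum>b\<in>{b \<in> nonzero B. f b \<noteq> 0 \<and> \<phi> b = a}. f b) = lin B (\<lambda>b. if \<phi> b = a then 1 else 0) f" for a
      unfolding lin_def using f
      by (intro sum.mono_neutral_cong_left) (auto simp: supp_def monoid_ring_carrier)
    then show ?thesis by (simp add: monoid_ring_map_def finsum_int_ring)
  qed
  have closed: "?h f \<in> carrier ?S" if f: "f \<in> carrier ?R" for f
  proof -
    have "supp A (?h f) \<subseteq> \<phi> ` supp B f"
    proof
      fix a assume "a \<in> supp A (?h f)"
      then have "lin B (\<lambda>b. if \<phi> b = a then 1 else 0) f \<noteq> 0"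
        unfolding h[OF f] supp_def by auto
      then obtain b where "b \<in> supp B f" "f b * (if \<phi> b = a then 1 else 0) \<noteq> 0"
        unfolding lin_def by (rule sum.not_neutral_contains_not_neutral)
      then show "a \<in> \<phi> ` supp B f" by (auto split: if_splits)
    qed
    then show ?thesis
      using f finite_subset[of _ "\<phi> ` supp B f"] by (simp add: monoid_ring_carrier h[OF f])
  qed
  have add: "?h (f \<oplus>\<^bsub>?R\<^esub> f') = ?h f \<oplus>\<^bsub>?S\<^esub> ?h f'" if "f \<in> carrier ?R" "f' \<in> carrier ?R" for f f'
    using that by (auto simp: h lin_add monoid_ring_add[where A = A])
  show single: "?h (single B b) = single A (\<phi> b)" if b: "b \<in> nonzero B" for b
    using nz[OF b] by (auto simp: h single_closed lin_single b single_apply fun_eq_iff)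
  have \<phi>': "\<phi> (a \<otimes>\<^bsub>B\<^esub> b) = \<phi> a \<otimes>\<^bsub>A\<^esub> \<phi> b" if "a \<in> nonzero B" "b \<in> nonzero B" for a b
    using \<phi> that by (auto simp: pointed_hom_def hom_def nonzero_def)
  have ss: "?h (single B a \<otimes>\<^bsub>?R\<^esub> single B b) = ?h (single B a) \<otimes>\<^bsub>?S\<^esub> ?h (single B b)"
    if ab: "a \<in> nonzero B" "b \<in> nonzero B" for a b
  proof (cases "a \<otimes>\<^bsub>B\<^esub> b \<in> nonzero B")
    case True
    then show ?thesis
      using ab nz by (simp add: single B.single_mult A.single_mult \<phi>')
  next
    case False
    then have "a \<otimes>\<^bsub>B\<^esub> b = pzero B" using ab by (auto simp: nonzero_def)
    moreover from this have "\<phi> a \<otimes>\<^bsub>A\<^esub> \<phi> b = pzero A"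
      using \<phi>'[OF ab] \<phi> by (simp add: pointed_hom_def)
    moreover have "?h \<zero>\<^bsub>?R\<^esub> = \<zero>\<^bsub>?S\<^esub>"
      by (simp add: h lin_zero monoid_ring_zero[of A])
    ultimately show ?thesis
      using ab nz by (simp add: single B.single_mult A.single_mult single_pzero)
  qed
  have sf: "?h (single B a \<otimes>\<^bsub>?R\<^esub> f') = ?h (single B a) \<otimes>\<^bsub>?S\<^esub> ?h f'"
    if a: "a \<in> nonzero B" and f': "f' \<in> carrier ?R" for a f'
    by (rule additive_ext_monoid_ring[where A = B and T = ?S, OF _ _ _ _ _ _ f'])
      (auto simp: S.abelian_group_axioms closed add single_closed R.r_distr S.r_distr ss a)
  have mult: "?h (f \<otimes>\<^bsub>?R\<^esub> f') = ?h f \<otimes>\<^bsub>?S\<^esub> ?h f'" if f: "f \<in> carrier ?R" and f': "f' \<in> carrier ?R" for f f'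
    by (rule additive_ext_monoid_ring[where A = B and T = ?S, OF _ _ _ _ _ _ f])
      (auto simp: S.abelian_group_axioms closed add R.l_distr S.l_distr sf f')
  have one: "?h \<one>\<^bsub>?R\<^esub> = \<one>\<^bsub>?S\<^esub>"
  proof (cases "\<one>\<^bsub>B\<^esub> = pzero B")
    case True
    then have "\<one>\<^bsub>A\<^esub> = pzero A" using \<phi> by (auto simp: pointed_hom_def)
    then have "\<one>\<^bsub>?S\<^esub> = \<zero>\<^bsub>?S\<^esub>" "\<one>\<^bsub>?R\<^esub> = \<zero>\<^bsub>?R\<^esub>"
      using True single_pzero[of A] single_pzero[of B] by (simp_all add: monoid_ring_one single_def)
    then show ?thesis by (simp add: h lin_zero monoid_ring_zero[of A])
  next
    case False
    then have "\<one>\<^bsub>B\<^esub> \<in> nonzero B" by (simp add: nonzero_def)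
    from single[OF this] show ?thesis
      using \<phi> by (simp add: monoid_ring_one single_def pointed_hom_def)
  qed
  show "?h \<in> ring_hom ?R ?S" by (rule ring_hom_memI) (auto simp: closed add mult one)
qed

subsection \<open>The ambient toric scheme\<close>

lemma comm_monoid_exponent_monoid: "comm_monoid (exponent_monoid r s)"
  by (rule comm_monoidI) (auto simp: exponent_monoid_def fun_eq_iff)

lemma pointed_comm_monoid_ambient: "pointed_comm_monoid (ambient_monoid r s)"
  unfolding ambient_monoid_def
  by (rule pointed_comm_monoid_adjoin_zero[OF comm_monoid_exponent_monoid])

locale ambient =
  fixes r s :: nat
begin

abbreviation "B \<equiv> ambient_monoid r s"
abbreviation "R \<equiv> ambient_ring r s"

sublocale B: pointed_comm_monoid B by (rule pointed_comm_monoid_ambient)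

sublocale R: cring R unfolding ambient_ring_def by (rule B.cring_monoid_ring)

definition exponents :: "((nat \<Rightarrow> nat) \<times> (nat \<Rightarrow> int)) set" where
  "exponents = {(\<alpha>, \<gamma>). (\<forall>i\<ge>r. \<alpha> i = 0) \<and> (\<forall>j\<ge>s. \<gamma> j = 0)}"

lemma nonzero_B: "nonzero B = Some ` exponents"
  by (simp add: ambient_monoid_def adjoin_zero_simps exponent_monoid_def exponents_def)

lemma nonzero_BE:
  assumes "b \<in> nonzero B"
  obtains \<alpha> \<gamma> where "b = Some (\<alpha>, \<gamma>)" "(\<alpha>, \<gamma>) \<in> exponents"
  using assms by (auto simp: nonzero_B)

lemma mult_B:
  "Some (\<alpha>, \<gamma>) \<otimes>\<^bsub>B\<^esub> Some (\<alpha>', \<gamma>') = Some (\<lambda>i. \<alpha> i + \<alpha>' i, \<lambda>j. \<gamma> j + \<gamma>' j)"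
  by (simp add: ambient_monoid_def adjoin_zero_simps exponent_monoid_def)

lemma one_B: "\<one>\<^bsub>B\<^esub> = Some (\<lambda>_. 0, \<lambda>_. 0)" and pzero_B: "pzero B = None"
  by (simp_all add: ambient_monoid_def adjoin_zero_simps exponent_monoid_def)

lemma R_eq: "R = monoid_ring \<Z> B"
  by (simp add: ambient_ring_def)

lemma xy_monomial_eq: "xy_monomial r s \<alpha> \<gamma> = single B (Some (\<alpha>, \<gamma>))"
  by (simp add: xy_monomial_def single_def)

lemma xy_monomial_closed [simp]: "xy_monomial r s \<alpha> \<gamma> \<in> carrier R"
  unfolding xy_monomial_eq R_eq by (rule single_closed)

lemma xy_monomial_mult:
  assumes "(\<alpha>, \<gamma>) \<in> exponents" "(\<alpha>', \<gamma>') \<in> exponents"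
  shows "xy_monomial r s \<alpha> \<gamma> \<otimes>\<^bsub>R\<^esub> xy_monomial r s \<alpha>' \<gamma>' =
    xy_monomial r s (\<lambda>i. \<alpha> i + \<alpha>' i) (\<lambda>j. \<gamma> j + \<gamma>' j)"
  using assms unfolding xy_monomial_eq R_eq
  by (subst B.single_mult) (auto simp: nonzero_B mult_B)

lemma one_R: "\<one>\<^bsub>R\<^esub> = xy_monomial r s (\<lambda>_. 0) (\<lambda>_. 0)"
  by (simp add: R_eq monoid_ring_one xy_monomial_def one_B)

text \<open>Evaluation at \<open>x = 0\<close> and \<open>y = 1\<close>.\<close>

definition eval_weight :: "monomial \<Rightarrow> int" where
  "eval_weight b = (case b of None \<Rightarrow> 0 | Some (\<alpha>, \<gamma>) \<Rightarrow> if \<alpha> = (\<lambda>_. 0) then 1 else 0)"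

definition evaluation :: "(monomial \<Rightarrow> int) \<Rightarrow> int" where
  "evaluation = lin B eval_weight"

lemma evaluation_xy_monomial:
  "(\<alpha>, \<gamma>) \<in> exponents \<Longrightarrow> evaluation (xy_monomial r s \<alpha> \<gamma>) = (if \<alpha> = (\<lambda>_. 0) then 1 else 0)"
  unfolding evaluation_def xy_monomial_eq
  by (subst lin_single) (auto simp: nonzero_B eval_weight_def)

lemma evaluation_hom: "evaluation \<in> ring_hom R \<Z>"
proof (rule ring_hom_memI)
  show "evaluation \<one>\<^bsub>R\<^esub> = \<one>\<^bsub>\<Z>\<^esub>"
    unfolding one_R by (subst evaluation_xy_monomial) (auto simp: exponents_def)
  fix f f' assume f: "f \<in> carrier R" "f' \<in> carrier R"
  have w: "eval_weight (a \<otimes>\<^bsub>B\<^esub> b) = eval_weight a * eval_weight b"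
    if "a \<in> nonzero B" "b \<in> nonzero B" for a b
    using that by (auto simp: nonzero_B eval_weight_def mult_B fun_eq_iff)
  show "evaluation (f \<otimes>\<^bsub>R\<^esub> f') = evaluation f \<otimes>\<^bsub>\<Z>\<^esub> evaluation f'"
    unfolding evaluation_def R_eq using f w
    by (subst lin_mult_of_multiplicative[OF pointed_comm_monoid_ambient])
      (auto simp: R_eq eval_weight_def pzero_B)
  show "evaluation (f \<oplus>\<^bsub>R\<^esub> f') = evaluation f \<oplus>\<^bsub>\<Z>\<^esub> evaluation f'"
    unfolding evaluation_def R_eq using f by (simp add: lin_add R_eq)
qed auto

sublocale E: ring_hom_ring R \<Z> evaluation
  by (rule ring_hom_ringI2[OF R.ring_axioms cring.axioms(1)[OF int_is_cring] evaluation_hom])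

lemma evaluation_ideal: "ideal P \<Z> \<Longrightarrow> ideal {f \<in> carrier R. evaluation f \<in> P} R"
  by (rule E.ideal_vimage)

lemma evaluation_minus:
  "f \<in> carrier R \<Longrightarrow> f' \<in> carrier R \<Longrightarrow> evaluation (f \<ominus>\<^bsub>R\<^esub> f') = evaluation f - evaluation f'"
  unfolding evaluation_def R_eq by (rule lin_minus)

text \<open>The inequalities between the exponents put some \<open>x\<close> variable into both
  monomials of the first kind, so both vanish at \<open>x = 0\<close>; monomials in the
  \<open>y\<close> variables have the value one. So the distinguished point satisfies the
  equations.\<close>

lemma evaluation_admissible:
  assumes "f \<in> admissible_binomials r s"
  shows "f \<in> carrier R" "evaluation f = 0"
proof -
  have "f \<in> carrier R \<and> evaluation f = 0"
    using assms unfolding admissible_binomials_def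
  proof (elim UnE CollectE exE conjE)
    fix \<alpha> \<beta> :: "nat \<Rightarrow> nat" and \<gamma> :: "nat \<Rightarrow> int"
    assume f: "f = xy_monomial r s \<alpha> (\<lambda>_. 0) \<ominus>\<^bsub>R\<^esub> xy_monomial r s \<beta> \<gamma>"
      and e: "\<forall>i\<ge>r. \<alpha> i = 0" "\<forall>i\<ge>r. \<beta> i = 0" "\<forall>j\<ge>s. \<gamma> j = 0"
      and le: "1 \<le> (\<Sum>i<r. \<alpha> i)" "(\<Sum>i<r. \<alpha> i) \<le> (\<Sum>i<r. \<beta> i)"
    have "\<alpha> \<noteq> (\<lambda>_. 0)" "\<beta> \<noteq> (\<lambda>_. 0)" using le by auto
    moreover have "(\<alpha>, \<lambda>_. 0) \<in> exponents" "(\<beta>, \<gamma>) \<in> exponents" using e by (auto simp: exponents_def)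
    ultimately show ?thesis
      unfolding f by (simp add: evaluation_minus evaluation_xy_monomial)
  next
    fix \<gamma> :: "nat \<Rightarrow> int"
    assume f: "f = \<one>\<^bsub>R\<^esub> \<ominus>\<^bsub>R\<^esub> xy_monomial r s (\<lambda>_. 0) \<gamma>" and e: "\<forall>j\<ge>s. \<gamma> j = 0"
    have "(\<lambda>_. 0, \<gamma>) \<in> exponents" using e by (auto simp: exponents_def)
    then show ?thesis
      unfolding f using E.hom_one by (simp add: evaluation_minus evaluation_xy_monomial)
  qed
  then show "f \<in> carrier R" "evaluation f = 0" by auto
qed

text \<open>Modulo the ideal every monomial containing an \<open>x\<close> is zero and every
  monomial in the \<open>y\<close> variables is one, so \<open>f\<close> is congruent to the integer
  \<open>evaluation f\<close>. This turns membership in a generated ideal into a numerical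
  condition.\<close>

lemma distinguished_prime_eq:
  assumes P: "ideal P \<Z>"
  shows "distinguished_prime r s P = {f \<in> carrier R. evaluation f \<in> P}"
proof -
  let ?G = "{monoid_term \<Z> B c \<one>\<^bsub>B\<^esub> | c. c \<in> P} \<union> {x_var r s i | i. i < r} \<union>
    {y_var r s j \<ominus>\<^bsub>R\<^esub> \<one>\<^bsub>R\<^esub> | j. j < s}"
  let ?D = "distinguished_prime r s P"
  note P' = int_idealD[OF P]
  have D: "?D = genideal R ?G" by (simp add: distinguished_prime_def)
  have int: "monoid_term \<Z> B c \<one>\<^bsub>B\<^esub> = \<guillemotleft>c\<guillemotright>\<^bsub>R\<^esub>" for c
    unfolding R_eq by (rule monoid_term_of_integer[OF pointed_comm_monoid_ambient])
  have eval_int: "evaluation \<guillemotleft>c\<guillemotright>\<^bsub>R\<^esub> = c" for c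
    using R.ring_hom_of_integer[OF int_is_cring evaluation_hom] by (simp add: of_integer_int)
  have x_exp: "((\<lambda>_. 0)(i := 1), \<lambda>_. 0) \<in> exponents" if "i < r" for i
    using that by (auto simp: exponents_def)
  have y_exp: "(\<lambda>_. 0, (\<lambda>_. 0)(j := 1)) \<in> exponents" if "j < s" for j
    using that by (auto simp: exponents_def)
  have G: "?G \<subseteq> carrier R" by (auto simp: int x_var_def y_var_def)
  have ideal: "ideal ?D R" unfolding D by (rule R.genideal_ideal[OF G])
  have gens: "?G \<subseteq> ?D" unfolding D by (rule R.genideal_self[OF G])
  interpret D: ideal ?D R by (rule ideal)
  show ?thesis
  proof
    show "?D \<subseteq> {f \<in> carrier R. evaluation f \<in> P}"
      unfolding D
    proof (rule R.genideal_minimal[OF evaluation_ideal[OF P]], intro Un_least subsetI; elim CollectE exE conjE)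
      show "f \<in> {f \<in> carrier R. evaluation f \<in> P}" if "f = monoid_term \<Z> B c \<one>\<^bsub>B\<^esub>" "c \<in> P" for f c
        using that by (simp add: int eval_int)
      show "f \<in> {f \<in> carrier R. evaluation f \<in> P}" if "f = x_var r s i" "i < r" for f i
      proof -
        have "(\<lambda>_. 0)(i := 1) \<noteq> (\<lambda>_. 0 :: nat)" by (metis fun_upd_same zero_neq_one)
        then show ?thesis
          using that P'(3) by (simp add: x_var_def evaluation_xy_monomial[OF x_exp] del: One_nat_def)
      qed
      show "f \<in> {f \<in> carrier R. evaluation f \<in> P}" if "f = y_var r s j \<ominus>\<^bsub>R\<^esub> \<one>\<^bsub>R\<^esub>" "j < s" for f j
        using that P'(3) E.hom_one
        by (simp add: y_var_def evaluation_minus evaluation_xy_monomial[OF y_exp])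
    qed
    have x: "xy_monomial r s \<alpha> \<gamma> \<in> ?D" if e: "(\<alpha>, \<gamma>) \<in> exponents" and \<alpha>: "\<alpha> \<noteq> (\<lambda>_. 0)" for \<alpha> \<gamma>
    proof -
      obtain i where i: "\<alpha> i \<noteq> 0" using \<alpha> by auto
      then have ir: "i < r" using e not_le[of r i] by (auto simp: exponents_def)
      have "(\<alpha>(i := \<alpha> i - 1), \<gamma>) \<in> exponents" using e by (auto simp: exponents_def)
      then have "xy_monomial r s (\<alpha>(i := \<alpha> i - 1)) \<gamma> \<otimes>\<^bsub>R\<^esub> x_var r s i = xy_monomial r s \<alpha> \<gamma>"
        unfolding x_var_def using i
        by (subst xy_monomial_mult[OF _ x_exp[OF ir]]) (auto intro!: arg_cong2[of _ _ _ _ "xy_monomial r s"])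
      moreover have "x_var r s i \<in> ?D" using gens ir by blast
      ultimately show ?thesis
        using D.I_l_closed[of "x_var r s i" "xy_monomial r s (\<alpha>(i := \<alpha> i - 1)) \<gamma>"] by simp
    qed
    define E where "E = (\<lambda>\<gamma>. xy_monomial r s (\<lambda>_. 0) \<gamma> \<ominus>\<^bsub>R\<^esub> \<one>\<^bsub>R\<^esub> \<in> ?D)"
    \<comment> \<open>An equivalence, since exponents of the \<open>y\<close> variables may be
      negative and are reached by unit steps in both directions.\<close>
    have step: "E (\<gamma>(j := \<gamma> j + 1)) \<longleftrightarrow> E \<gamma>" if \<gamma>: "\<forall>j\<ge>s. \<gamma> j = 0" and j: "j < s" for \<gamma> j
    proof -
      define u v where "u = xy_monomial r s (\<lambda>_. 0) \<gamma>" and "v = y_var r s j"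
      have c: "u \<in> carrier R" "v \<in> carrier R" by (auto simp: u_def v_def y_var_def)
      have e: "(\<lambda>_. 0, \<gamma>) \<in> exponents" using \<gamma> by (simp add: exponents_def)
      have uv: "xy_monomial r s (\<lambda>_. 0) (\<gamma>(j := \<gamma> j + 1)) = u \<otimes>\<^bsub>R\<^esub> v"
        unfolding u_def v_def y_var_def xy_monomial_mult[OF e y_exp[OF j]]
        by (auto intro!: arg_cong2[of _ _ _ _ "xy_monomial r s"])
      have "v \<ominus>\<^bsub>R\<^esub> \<one>\<^bsub>R\<^esub> \<in> ?D" using gens j unfolding v_def by blast
      then have d: "u \<otimes>\<^bsub>R\<^esub> (v \<ominus>\<^bsub>R\<^esub> \<one>\<^bsub>R\<^esub>) \<in> ?D" using c by (intro D.I_l_closed)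
      have eq: "u \<otimes>\<^bsub>R\<^esub> v \<ominus>\<^bsub>R\<^esub> \<one>\<^bsub>R\<^esub> = u \<otimes>\<^bsub>R\<^esub> (v \<ominus>\<^bsub>R\<^esub> \<one>\<^bsub>R\<^esub>) \<oplus>\<^bsub>R\<^esub> (u \<ominus>\<^bsub>R\<^esub> \<one>\<^bsub>R\<^esub>)"
        using c by algebra
      have eq': "u \<ominus>\<^bsub>R\<^esub> \<one>\<^bsub>R\<^esub> = (u \<otimes>\<^bsub>R\<^esub> v \<ominus>\<^bsub>R\<^esub> \<one>\<^bsub>R\<^esub>) \<oplus>\<^bsub>R\<^esub> (\<ominus>\<^bsub>R\<^esub> (u \<otimes>\<^bsub>R\<^esub> (v \<ominus>\<^bsub>R\<^esub> \<one>\<^bsub>R\<^esub>)))"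
        using c by algebra
      have "u \<otimes>\<^bsub>R\<^esub> v \<ominus>\<^bsub>R\<^esub> \<one>\<^bsub>R\<^esub> \<in> ?D \<longleftrightarrow> u \<ominus>\<^bsub>R\<^esub> \<one>\<^bsub>R\<^esub> \<in> ?D"
      proof
        assume "u \<otimes>\<^bsub>R\<^esub> v \<ominus>\<^bsub>R\<^esub> \<one>\<^bsub>R\<^esub> \<in> ?D"
        then show "u \<ominus>\<^bsub>R\<^esub> \<one>\<^bsub>R\<^esub> \<in> ?D" by (subst eq') (intro D.a_closed D.a_inv_closed d)
      next
        assume "u \<ominus>\<^bsub>R\<^esub> \<one>\<^bsub>R\<^esub> \<in> ?D"
        then show "u \<otimes>\<^bsub>R\<^esub> v \<ominus>\<^bsub>R\<^esub> \<one>\<^bsub>R\<^esub> \<in> ?D" unfolding eq by (intro D.a_closed d)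
      qed
      then show ?thesis unfolding E_def uv u_def[symmetric] .
    qed
    have E: "E \<gamma>" if "finite J" "J \<subseteq> {..<s}" "\<And>j. j \<notin> J \<Longrightarrow> \<gamma> j = 0" for J \<gamma>
      using that
    proof (induction J arbitrary: \<gamma> rule: finite_induct)
      case empty
      then have "\<gamma> = (\<lambda>_. 0)" by auto
      then show ?case
        using D.zero_closed by (simp add: E_def R.minus_eq R.r_neg flip: one_R)
    next
      case (insert j J)
      have j: "j < s" using insert.prems(1) by simp
      have z: "\<forall>i\<ge>s. (\<gamma>(j := k)) i = 0" for k
      proof (intro allI impI)
        fix i assume "s \<le> i"
        then have "i \<notin> insert j J" using insert.prems(1) by auto
        then show "(\<gamma>(j := k)) i = 0" using insert.prems(2) by simp
      qed
      have "E (\<gamma>(j := k))" for k :: int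
      proof (induction k rule: int_induct[where k = 0])
        case base
        show ?case by (rule insert.IH) (use insert.prems in auto)
      next
        case (step1 k)
        have "E ((\<gamma>(j := k))(j := (\<gamma>(j := k)) j + 1))"
          by (rule step[OF z j, THEN iffD2]) (rule step1(2))
        then show ?case by (simp only: fun_upd_upd fun_upd_same)
      next
        case (step2 k)
        have "E ((\<gamma>(j := k - 1))(j := (\<gamma>(j := k - 1)) j + 1))"
          using step2(2) by (simp only: fun_upd_upd fun_upd_same diff_add_cancel)
        then show ?case by (rule step[OF z j, THEN iffD1])
      qed
      from this[of "\<gamma> j"] show ?case by simp
    qed
    \<comment> \<open>Congruence to the value at the point is additive in \<open>f\<close>, so it
      has to be tested on monomials only.\<close>
    define H where "H = {f \<in> carrier R. f \<ominus>\<^bsub>R\<^esub> \<guillemotleft>evaluation f\<guillemotright>\<^bsub>R\<^esub> \<in> ?D}"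
    have "subgroup H (add_monoid R)"
    proof (unfold_locales, goal_cases)
      case 1
      then show ?case by (auto simp: H_def)
    next
      case (2 f f')
      then have c: "f \<in> carrier R" "f' \<in> carrier R" by (auto simp: H_def)
      define m n where "m = \<guillemotleft>evaluation f\<guillemotright>\<^bsub>R\<^esub>" and "n = \<guillemotleft>evaluation f'\<guillemotright>\<^bsub>R\<^esub>"
      have mn: "m \<in> carrier R" "n \<in> carrier R" by (auto simp: m_def n_def)
      have "(f \<oplus>\<^bsub>R\<^esub> f') \<ominus>\<^bsub>R\<^esub> (m \<oplus>\<^bsub>R\<^esub> n) = (f \<ominus>\<^bsub>R\<^esub> m) \<oplus>\<^bsub>R\<^esub> (f' \<ominus>\<^bsub>R\<^esub> n)"
        using c mn by algebra
      moreover have "(f \<ominus>\<^bsub>R\<^esub> m) \<oplus>\<^bsub>R\<^esub> (f' \<ominus>\<^bsub>R\<^esub> n) \<in> ?D"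
        using 2 by (intro D.a_closed) (auto simp: H_def m_def n_def)
      ultimately show ?case using c by (simp add: H_def m_def n_def E.hom_add)
    next
      case 3
      then show ?case using D.zero_closed E.hom_zero by (simp add: H_def R.minus_eq)
    next
      case (4 f)
      then have c: "f \<in> carrier R" by (auto simp: H_def)
      define m where "m = \<guillemotleft>evaluation f\<guillemotright>\<^bsub>R\<^esub>"
      have m: "m \<in> carrier R" by (auto simp: m_def)
      have "evaluation (\<ominus>\<^bsub>R\<^esub> f) = - evaluation f"
        unfolding evaluation_def using c unfolding R_eq by (rule lin_a_inv)
      then have "\<guillemotleft>evaluation (\<ominus>\<^bsub>R\<^esub> f)\<guillemotright>\<^bsub>R\<^esub> = \<ominus>\<^bsub>R\<^esub> m" by (simp add: m_def)
      moreover have "(\<ominus>\<^bsub>R\<^esub> f) \<ominus>\<^bsub>R\<^esub> (\<ominus>\<^bsub>R\<^esub> m) = \<ominus>\<^bsub>R\<^esub> (f \<ominus>\<^bsub>R\<^esub> m)"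
        using c m by algebra
      moreover have "\<ominus>\<^bsub>R\<^esub> (f \<ominus>\<^bsub>R\<^esub> m) \<in> ?D"
        using 4 by (intro D.a_inv_closed) (auto simp: H_def m_def)
      ultimately show ?case unfolding a_inv_def[symmetric] using c by (simp add: H_def)
    qed
    then have H: "additive_subgroup H (monoid_ring \<Z> B)"
      unfolding R_eq by (rule additive_subgroup.intro)
    show "{f \<in> carrier R. evaluation f \<in> P} \<subseteq> ?D"
    proof
      fix f assume f: "f \<in> {f \<in> carrier R. evaluation f \<in> P}"
      have "f \<in> H"
      proof (rule additive_subgroup_monoid_ring_eq[OF H])
        show "f \<in> carrier (monoid_ring \<Z> B)" using f by (simp add: R_eq)
        fix b assume "b \<in> nonzero B"
        then obtain \<alpha> \<gamma> where b: "b = Some (\<alpha>, \<gamma>)" and e: "(\<alpha>, \<gamma>) \<in> exponents" by (rule nonzero_BE)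
        have "xy_monomial r s \<alpha> \<gamma> \<in> H"
        proof (cases "\<alpha> = (\<lambda>_. 0)")
          case True
          have "E \<gamma>" using e by (intro E[of "{..<s}"]) (auto simp: exponents_def)
          then show ?thesis
            unfolding H_def using evaluation_xy_monomial[OF e] True by (simp add: E_def)
        next
          case False
          then show ?thesis
            unfolding H_def using evaluation_xy_monomial[OF e] x[OF e] by (simp add: R.minus_eq)
        qed
        then show "single B b \<in> H" by (simp add: b xy_monomial_eq)
      qed
      then have "f \<ominus>\<^bsub>R\<^esub> \<guillemotleft>evaluation f\<guillemotright>\<^bsub>R\<^esub> \<in> ?D" by (simp add: H_def)
      moreover have "\<guillemotleft>evaluation f\<guillemotright>\<^bsub>R\<^esub> \<in> ?D" using gens f int by auto
      ultimately have "(f \<ominus>\<^bsub>R\<^esub> \<guillemotleft>evaluation f\<guillemotright>\<^bsub>R\<^esub>) \<oplus>\<^bsub>R\<^esub> \<guillemotleft>evaluation f\<guillemotright>\<^bsub>R\<^esub> \<in> ?D"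
        by (rule D.a_closed)
      moreover have "(f \<ominus>\<^bsub>R\<^esub> \<guillemotleft>evaluation f\<guillemotright>\<^bsub>R\<^esub>) \<oplus>\<^bsub>R\<^esub> \<guillemotleft>evaluation f\<guillemotright>\<^bsub>R\<^esub> = f"
        using f by (simp add: R.minus_eq R.a_assoc R.l_neg)
      ultimately show "f \<in> ?D" by simp
    qed
  qed
qed

end

subsection \<open>The distinguished points\<close>

locale toric_closed_immersion = A: toric_monoid A + ambient r s
  for A :: "('a, 'm) pointed_monoid_scheme" and r s +
  fixes \<phi> :: "monomial \<Rightarrow> 'a"
  assumes immersion: "unpointed_closed_immersion B A \<phi>"
    and ideal_generated: "\<exists>F. F \<subseteq> admissible_binomials r s \<and> defining_ideal r s A \<phi> = genideal R F"
begin

abbreviation "\<Phi> \<equiv> monoid_ring_map \<Z> B A \<phi>"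

lemma hom: "\<phi> \<in> pointed_hom B A"
  using immersion by (simp add: unpointed_closed_immersion_def)

lemma hom_mult: "a \<in> carrier B \<Longrightarrow> b \<in> carrier B \<Longrightarrow> \<phi> (a \<otimes>\<^bsub>B\<^esub> b) = \<phi> a \<otimes>\<^bsub>A\<^esub> \<phi> b"
  and hom_one: "\<phi> \<one>\<^bsub>B\<^esub> = \<one>\<^bsub>A\<^esub>" and hom_pzero: "\<phi> (pzero B) = pzero A"
  and hom_closed: "b \<in> carrier B \<Longrightarrow> \<phi> b \<in> carrier A"
  using hom by (auto simp: pointed_hom_def hom_def)

lemma hom_surj:
  assumes "a \<in> carrier A"
  shows "\<exists>b\<in>carrier B. \<phi> b = a"
proof -
  have "\<phi> ` carrier B = carrier A" using immersion by (simp add: unpointed_closed_immersion_def)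
  then have "a \<in> \<phi> ` carrier B" using assms by simp
  then show ?thesis by blast
qed

lemma hom_nonzero: "b \<in> nonzero B \<Longrightarrow> \<phi> b \<in> nonzero A"
  using immersion hom_closed by (auto simp: unpointed_closed_immersion_def nonzero_def)

lemma nonzero_surj: "a \<in> nonzero A \<Longrightarrow> \<exists>b\<in>nonzero B. \<phi> b = a"
  using hom_surj[of a] hom_pzero by (auto simp: nonzero_def)

lemma one_nonzero_B: "\<one>\<^bsub>B\<^esub> \<in> nonzero B"
  by (auto simp: nonzero_B one_B exponents_def)

lemma nontrivial: "\<one>\<^bsub>A\<^esub> \<noteq> pzero A"
  using hom_nonzero[OF one_nonzero_B] by (simp add: hom_one nonzero_def)

sublocale A: nontrivial_toric_monoid A
  by (unfold_locales) (rule nontrivial)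

lemma map_hom: "\<Phi> \<in> ring_hom R (monoid_ring \<Z> A)"
  unfolding R_eq
  by (rule monoid_ring_map_hom[OF A.pointed_comm_monoid_axioms B.pointed_comm_monoid_axioms hom hom_nonzero])

lemma map_single: "b \<in> nonzero B \<Longrightarrow> \<Phi> (single B b) = single A (\<phi> b)"
  by (rule monoid_ring_map_hom[OF A.pointed_comm_monoid_axioms B.pointed_comm_monoid_axioms hom hom_nonzero])

text \<open>The kernel is generated by binomials that vanish at the point, so evaluation descends to
  \<open>\<int>[A]\<close>.\<close>

lemma evaluation_kernel:
  assumes "f \<in> carrier R" "\<Phi> f = \<zero>\<^bsub>monoid_ring \<Z> A\<^esub>"
  shows "evaluation f = 0"
proof -
  obtain F where F: "F \<subseteq> admissible_binomials r s" "defining_ideal r s A \<phi> = genideal R F"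
    using ideal_generated by blast
  have "ideal {0} \<Z>" using primeideal.axioms(1)[OF int_zero_ideal] .
  from R.genideal_minimal[OF evaluation_ideal[OF this], of F]
  have "genideal R F \<subseteq> {f \<in> carrier R. evaluation f \<in> {0}}"
    using F(1) evaluation_admissible by blast
  moreover have "f \<in> defining_ideal r s A \<phi>"
    using assms by (simp add: defining_ideal_def a_kernel_def' )
  ultimately show ?thesis unfolding F(2) by blast
qed

text \<open>If a monomial containing some \<open>x\<close> became a unit, multiplying by a lift of
  the inverse would give a monomial \<open>m\<close>, still containing that \<open>x\<close>, with
  \<open>m - 1\<close> in the kernel; but \<open>m - 1\<close> has the value \<open>-1\<close> at
  the point. The form of the binomials enters the proof here, through
  \<open>evaluation_kernel\<close>.\<close>

lemma map_Units_iff: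
  assumes e: "(\<alpha>, \<gamma>) \<in> exponents"
  shows "\<phi> (Some (\<alpha>, \<gamma>)) \<in> Units A \<longleftrightarrow> \<alpha> = (\<lambda>_. 0)"
proof
  have nz: "Some (\<alpha>, \<gamma>) \<in> nonzero B" using e by (simp add: nonzero_B)
  show "\<phi> (Some (\<alpha>, \<gamma>)) \<in> Units A" if "\<alpha> = (\<lambda>_. 0)"
  proof -
    have nz': "Some (\<alpha>, \<lambda>j. - \<gamma> j) \<in> nonzero B" using e by (auto simp: nonzero_B exponents_def)
    have "\<phi> (Some (\<alpha>, \<gamma>)) \<otimes>\<^bsub>A\<^esub> \<phi> (Some (\<alpha>, \<lambda>j. - \<gamma> j)) = \<one>\<^bsub>A\<^esub>"
      using nz nz' that hom_mult[of "Some (\<alpha>, \<gamma>)" "Some (\<alpha>, \<lambda>j. - \<gamma> j)"]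
      by (simp add: nonzero_def mult_B hom_one flip: one_B)
    then show ?thesis
      using hom_nonzero[OF nz] hom_nonzero[OF nz'] A.unit_factor[of "\<phi> (Some (\<alpha>, \<gamma>))" "\<phi> (Some (\<alpha>, \<lambda>j. - \<gamma> j))"]
      by (simp add: A.nonzero_carrier)
  qed
  show "\<alpha> = (\<lambda>_. 0)" if u: "\<phi> (Some (\<alpha>, \<gamma>)) \<in> Units A"
  proof (rule ccontr)
    assume \<alpha>: "\<alpha> \<noteq> (\<lambda>_. 0)"
    obtain v where v: "v \<in> Units A" "\<phi> (Some (\<alpha>, \<gamma>)) \<otimes>\<^bsub>A\<^esub> v = \<one>\<^bsub>A\<^esub>"
      using A.Units_r_inv[OF u] A.Units_inv_Units[OF u] by blast
    obtain b where b: "b \<in> nonzero B" "\<phi> b = v" using nonzero_surj[OF A.Units_nonzero[OF v(1)]] by blast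
    obtain \<alpha>' \<gamma>' where b': "b = Some (\<alpha>', \<gamma>')" "(\<alpha>', \<gamma>') \<in> exponents" using b(1) by (rule nonzero_BE)
    let ?m = "xy_monomial r s (\<lambda>i. \<alpha> i + \<alpha>' i) (\<lambda>j. \<gamma> j + \<gamma>' j)"
    have e': "(\<lambda>i. \<alpha> i + \<alpha>' i, \<lambda>j. \<gamma> j + \<gamma>' j) \<in> exponents" using e b'(2) by (auto simp: exponents_def)
    have "\<phi> (Some (\<lambda>i. \<alpha> i + \<alpha>' i, \<lambda>j. \<gamma> j + \<gamma>' j)) = \<one>\<^bsub>A\<^esub>"
      using hom_mult[of "Some (\<alpha>, \<gamma>)" b] nz b(1) v(2) unfolding b'(1) mult_B b(2)[unfolded b'(1)]
      by (simp add: nonzero_def)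
    moreover have "\<Phi> ?m = single A (\<phi> (Some (\<lambda>i. \<alpha> i + \<alpha>' i, \<lambda>j. \<gamma> j + \<gamma>' j)))"
      unfolding xy_monomial_eq by (rule map_single) (use e' in \<open>simp add: nonzero_B\<close>)
    ultimately have "\<Phi> ?m = \<one>\<^bsub>monoid_ring \<Z> A\<^esub>" by (simp add: monoid_ring_one single_def)
    moreover have "\<Phi> (?m \<ominus>\<^bsub>R\<^esub> \<one>\<^bsub>R\<^esub>) = \<Phi> ?m \<ominus>\<^bsub>monoid_ring \<Z> A\<^esub> \<one>\<^bsub>monoid_ring \<Z> A\<^esub>"
    proof -
      interpret S: cring "monoid_ring \<Z> A" by (rule A.cring_monoid_ring)
      interpret H: ring_hom_ring R "monoid_ring \<Z> A" \<Phi>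
        by (rule ring_hom_ringI2[OF R.ring_axioms S.ring_axioms map_hom])
      show ?thesis using H.hom_one by (simp add: R.minus_eq S.minus_eq)
    qed
    moreover have "\<one>\<^bsub>monoid_ring \<Z> A\<^esub> \<ominus>\<^bsub>monoid_ring \<Z> A\<^esub> \<one>\<^bsub>monoid_ring \<Z> A\<^esub> = \<zero>\<^bsub>monoid_ring \<Z> A\<^esub>"
      using cring.axioms(1)[OF A.cring_monoid_ring] by (simp add: a_minus_def abelian_group.r_neg ring.axioms(1) ring.is_monoid monoid.one_closed)
    ultimately have "evaluation (?m \<ominus>\<^bsub>R\<^esub> \<one>\<^bsub>R\<^esub>) = 0" by (intro evaluation_kernel) simp_all
    moreover have "(\<lambda>i. \<alpha> i + \<alpha>' i) \<noteq> (\<lambda>_. 0)" using \<alpha> by (auto simp: fun_eq_iff)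
    ultimately show False
      using E.hom_one by (simp add: evaluation_minus evaluation_xy_monomial[OF e'])
  qed
qed

theorem hilbert_samuel_fibres:
  assumes P: "primeideal P \<Z>"
  shows "hilbert_samuel_at (monoid_ring \<Z> A) (distinguished_point r s A \<phi> {0}) =
    hilbert_samuel_at (fibre (monoid_ring \<Z> A) P)
      (fibre_point (monoid_ring \<Z> A) P (distinguished_point r s A \<phi> P))"
proof -
  obtain I g where "toric_coordinates A I g"
  proof (rule A.units_basis)
    fix I :: "'a set" and g
    assume "finite I" "g \<in> I \<rightarrow> Units A"
      "\<And>u. u \<in> Units A \<Longrightarrow> \<exists>h :: 'a \<Rightarrow> int. u = finprod (units_of A) (\<lambda>i. g i [^]\<^bsub>units_of A\<^esub> h i) I"
      "\<And>h i. finprod (units_of A) (\<lambda>i. g i [^]\<^bsub>units_of A\<^esub> (h i :: int)) I = \<one>\<^bsub>A\<^esub> \<Longrightarrow> i \<in> I \<Longrightarrow> h i = 0"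
    then show thesis
      by (intro that[of I g] toric_coordinates.intro toric_coordinates_axioms.intro
          A.nontrivial_toric_monoid_axioms)
  qed
  then interpret C: toric_coordinates A I g .
  let ?S = "monoid_ring \<Z> A"
  interpret H: ring_hom_ring R ?S \<Phi>
    by (rule ring_hom_ringI2[OF R.ring_axioms C.S.ring_axioms map_hom])
  \<comment> \<open>The monomials mapped to nonunits of \<open>A\<close> are those containing an
    \<open>x\<close>, so the augmentation, defined by \<open>A\<close> alone, agrees with evaluation
    at \<open>x = 0\<close> and \<open>y = 1\<close>.\<close>
  have aug: "C.augmentation (\<Phi> f) = evaluation f" if f: "f \<in> carrier R" for f
  proof (rule additive_ext_monoid_ring[where A = B and T = \<Z>, OF _ _ _ _ _ _ f[unfolded R_eq]])
    show "abelian_group \<Z>" by (rule ring.axioms(1)[OF cring.axioms(1)[OF int_is_cring]])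
    show "C.augmentation (\<Phi> (single B b)) = evaluation (single B b)" if b: "b \<in> nonzero B" for b
    proof -
      obtain \<alpha> \<gamma> where "b = Some (\<alpha>, \<gamma>)" "(\<alpha>, \<gamma>) \<in> exponents" using b by (rule nonzero_BE)
      then show ?thesis
        using b hom_nonzero[OF b] map_Units_iff evaluation_xy_monomial[of \<alpha> \<gamma>]
        by (simp add: map_single C.augmentation_single xy_monomial_eq)
    qed
    fix f f' assume f: "f \<in> carrier (monoid_ring \<Z> B)" "f' \<in> carrier (monoid_ring \<Z> B)"
    then show "C.augmentation (\<Phi> (f \<oplus>\<^bsub>monoid_ring \<Z> B\<^esub> f')) = C.augmentation (\<Phi> f) \<oplus>\<^bsub>\<Z>\<^esub> C.augmentation (\<Phi> f')"
      by (simp add: C.augmentation_add flip: R_eq)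
    show "evaluation (f \<oplus>\<^bsub>monoid_ring \<Z> B\<^esub> f') = evaluation f \<oplus>\<^bsub>\<Z>\<^esub> evaluation f'"
      using f by (simp add: evaluation_def lin_add)
  qed auto
  have surj: "\<Phi> ` carrier R = carrier ?S"
  proof
    show "\<Phi> ` carrier R \<subseteq> carrier ?S" by auto
    show "carrier ?S \<subseteq> \<Phi> ` carrier R"
    proof
      fix f assume f: "f \<in> carrier ?S"
      have "additive_subgroup (\<Phi> ` carrier R) ?S"
        using H.img_is_add_subgroup[OF R.add.subgroup_self] by (rule additive_subgroup.intro)
      then show "f \<in> \<Phi> ` carrier R"
      proof (rule additive_subgroup_monoid_ring_eq[OF _ _ f])
        fix a assume "a \<in> nonzero A"
        then obtain b where "b \<in> nonzero B" "\<phi> b = a" using nonzero_surj by blast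
        then have "single A a = \<Phi> (single B b)" by (simp add: map_single)
        then show "single A a \<in> \<Phi> ` carrier R" using single_closed[of B b] by (simp add: R_eq)
      qed
    qed
  qed
  \<comment> \<open>By surjectivity an element of \<open>C.point p\<close> lifts to the ambient
    ring, where it has the same value at the point.\<close>
  have point: "distinguished_point r s A \<phi> p = C.point p" if p: "ideal p \<Z>" for p
  proof -
    have "\<Phi> ` {f \<in> carrier R. evaluation f \<in> p} = C.point p"
    proof
      show "\<Phi> ` {f \<in> carrier R. evaluation f \<in> p} \<subseteq> C.point p"
        using aug H.hom_closed by (auto simp: C.point_def)
      show "C.point p \<subseteq> \<Phi> ` {f \<in> carrier R. evaluation f \<in> p}"
      proof
        fix f assume f: "f \<in> C.point p"
        then have "f \<in> \<Phi> ` carrier R" unfolding surj by (simp add: C.point_def)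
        then obtain f' where "f' \<in> carrier R" "f = \<Phi> f'" by (rule imageE)
        then show "f \<in> \<Phi> ` {f \<in> carrier R. evaluation f \<in> p}"
          using f aug[of f'] by (simp add: C.point_def)
      qed
    qed
    then show ?thesis
      unfolding distinguished_point_def distinguished_prime_eq[OF p] .
  qed
  \<comment> \<open>Both sides equal the number of indices of degree at most \<open>l\<close>, which
    does not involve \<open>P\<close>.\<close>
  have "hilbert_samuel_at ?S (C.point {0}) l =
      hilbert_samuel_at (fibre ?S P) (fibre_point ?S P (C.point P)) l" for l
    unfolding C.hilbert_samuel_at_point C.hilbert_samuel_at_fibre_point[OF P] ..
  then show ?thesis
    using point[OF primeideal.axioms(1)[OF P]] point[OF primeideal.axioms(1)[OF int_zero_ideal]] by auto
qed

end

theorem proposition6p1p1: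
  fixes A :: "('a, 'm) pointed_monoid_scheme"
    and \<phi> :: "monomial \<Rightarrow> 'a"
    and r n :: nat
  assumes "r \<le> n"
    and "toric_monoid A"
    and "unpointed_closed_immersion (ambient_monoid r (n - r)) A \<phi>"
    and "\<exists>F. finite F \<and> F \<subseteq> admissible_binomials r (n - r) \<and>
           defining_ideal r (n - r) A \<phi> = genideal (ambient_ring r (n - r)) F"
  shows "\<forall>\<pp>. primeideal \<pp> \<Z> \<longrightarrow>
           hilbert_samuel_at (monoid_ring \<Z> A) (distinguished_point r (n - r) A \<phi> {0}) =
           hilbert_samuel_at (fibre (monoid_ring \<Z> A) \<pp>)
             (fibre_point (monoid_ring \<Z> A) \<pp> (distinguished_point r (n - r) A \<phi> \<pp>))"
proof -
  interpret toric_closed_immersion A r "n - r" \<phi>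
    using assms by (intro toric_closed_immersion.intro toric_closed_immersion_axioms.intro) auto
  show ?thesis using hilbert_samuel_fibres by blast
qed

end
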